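(* Let $X : S^1\times\mathbb{R}^n\to\mathbb{R}^n$, $(t,p)\mapsto X_t(p)$, be a smooth time-dependent vector field, where $S^1=\mathbb{R}/\mathbb{Z}$. If $x_0:S^1\to\mathbb{R}^n$ is a non-degenerate 1-periodic orbit of $X$, then there is $\tau_0>0$ such that for every delay $\tau\in\mathbb{R}$ with $|\tau|\le\tau_0$ there exists a (locally unique) smooth 1-periodic solution $x_\tau:S^1\to\mathbb{R}^n$ of the delay equation $$\partial_t x(t)=X_t(x(t-\tau))\qquad\text{for all } t\in S^1 .$$ Moreover, the parametrization $\tau\mapsto x_\tau$ is smooth.
   Context: A 1-periodic orbit of $X$ is a map $x:S^1\to\mathbb{R}^n$ with $\partial_t x(t)=X_t(x(t))$ for all $t\in S^1$. Let $\Phi_X^t$ denote the flow of $X$ starting at time $0$ (that is, $\frac{d}{dt}\Phi_X^t(p)=X_t(\Phi_X^t(p))$, $\Phi_X^0(p)=p$). $X$ is not assumed complete; existence of the 1-periodic orbit $x$ guarantees that $\Phi_X^t$ is defined for $t\in[0,1]$ near $x(0)$. A 1-periodic orbit $x$ is called non-degenerate if the linearized time-1-map $\mathrm{d}\Phi_X^1(x(0))$ does not have $1$ as an eigenvalue. The family $(x_\tau)$ extends the given orbit, i.e. its member at $\tau=0$ is $x_0$. "Locally unique" means: there is a neighborhood of $(0,x_0)$ in $\mathbb{R}\times W^{1,2}(S^1,\mathbb{R}^n)$ in which the pairs $(\tau,x)$ with $x$ a 1-periodic solution of the delay equation with delay $\tau$ are exactly the pairs $(\tau,x_\tau)$ (for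 $\tau$ near $0$). "The parametrization is smooth" means that $\tau\mapsto x_\tau$ is a $C^\infty$ map into $W^{m,2}(S^1,\mathbb{R}^n)$ for every $m\ge 0$. *)

theory Defs
  imports "HOL-Analysis.Analysis"
begin

text \<open>
  Throughout, a map on \<open>S\<^sup>1 = R/Z\<close> is a function on \<^typ>\<open>real\<close> of period 1, expressed by the
  library predicate \<^const>\<open>periodic_fun_simple'\<close>.
\<close>

subsection \<open>Smooth maps on Euclidean space\<close>

text \<open>
  Since the domain is finite-dimensional, continuity of the total derivative (and of its higher
  derivatives) is tested on each direction \<open>v\<close> separately.
\<close>

primrec Ck :: "nat \<Rightarrow> ('a::euclidean_space \<Rightarrow> 'b::real_normed_vector) \<Rightarrow> bool" where
  "Ck 0 f \<longleftrightarrow> continuous_on UNIV f"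
| "Ck (Suc k) f \<longleftrightarrow>
     (\<forall>x. f differentiable (at x)) \<and> (\<forall>v. Ck k (\<lambda>x. frechet_derivative f (at x) v))"

definition smooth_map :: "('a::euclidean_space \<Rightarrow> 'b::real_normed_vector) \<Rightarrow> bool" where
  "smooth_map f \<longleftrightarrow> (\<forall>k. Ck k f)"

definition smooth_periodic_vector_field :: "(real \<Rightarrow> 'a::euclidean_space \<Rightarrow> 'a) \<Rightarrow> bool" where
  "smooth_periodic_vector_field X \<longleftrightarrow>
     periodic_fun_simple' X \<and> smooth_map (\<lambda>(t, p). X t p)"


subsection \<open>Periodic orbits, flow, non-degeneracy\<close>

definition periodic_orbit ::
    "(real \<Rightarrow> 'a::euclidean_space \<Rightarrow> 'a) \<Rightarrow> (real \<Rightarrow> 'a) \<Rightarrow> bool" where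
  "periodic_orbit X x \<longleftrightarrow>
     periodic_fun_simple' x \<and> (\<forall>t. (x has_vector_derivative X t (x t)) (at t))"

text \<open>
  The vector field need not be complete: \<open>flow X t p\<close> is meaningful exactly when the initial value
  problem started at \<open>p\<close> at time 0 has a solution on the whole interval between 0 and \<open>t\<close>
  (\<open>t\<close> may be negative). For a smooth field the value at \<open>t\<close> of such a solution is unique.
\<close>

definition flow :: "(real \<Rightarrow> 'a::euclidean_space \<Rightarrow> 'a) \<Rightarrow> real \<Rightarrow> 'a \<Rightarrow> 'a" where
  "flow X t p = (THE q. \<exists>\<gamma>. \<gamma> 0 = p \<and>
     (\<forall>s\<in>closed_segment 0 t.
        (\<gamma> has_vector_derivative X s (\<gamma> s)) (at s within closed_segment 0 t)) \<and>
     \<gamma> t = q)"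

definition is_eigenvalue :: "('a::real_vector \<Rightarrow> 'a) \<Rightarrow> real \<Rightarrow> bool" where
  "is_eigenvalue L c \<longleftrightarrow> (\<exists>v. v \<noteq> 0 \<and> L v = c *\<^sub>R v)"

definition nondegenerate_orbit ::
    "(real \<Rightarrow> 'a::euclidean_space \<Rightarrow> 'a) \<Rightarrow> (real \<Rightarrow> 'a) \<Rightarrow> bool" where
  "nondegenerate_orbit X x \<longleftrightarrow>
     periodic_orbit X x \<and> \<not> is_eigenvalue (frechet_derivative (flow X 1) (at (x 0))) 1"

definition delay_solution ::
    "(real \<Rightarrow> 'a::euclidean_space \<Rightarrow> 'a) \<Rightarrow> real \<Rightarrow> (real \<Rightarrow> 'a) \<Rightarrow> bool" where
  "delay_solution X \<tau> x \<longleftrightarrow>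
     periodic_fun_simple' x \<and> (\<forall>t. (x has_vector_derivative X t (x (t - \<tau>))) (at t))"


subsection \<open>Sobolev spaces on the circle\<close>

text \<open>
  Elements of \<open>L\<^sup>2\<close> and \<open>W\<^sup>m\<^sup>,\<^sup>2\<close> are represented by functions; functions that agree almost everywhere
  represent the same element and have distance 0 with respect to \<open>sobolev_norm\<close>.
\<close>

definition L2_circle :: "(real \<Rightarrow> 'a::euclidean_space) set" where
  "L2_circle = {f. periodic_fun_simple' f \<and> f \<in> borel_measurable lebesgue \<and>
                   set_integrable lebesgue {0..1} (\<lambda>t. (norm (f t))\<^sup>2)}"

definition has_weak_derivative ::
    "nat \<Rightarrow> (real \<Rightarrow> 'a::euclidean_space) \<Rightarrow> (real \<Rightarrow> 'a) \<Rightarrow> bool" where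
  "has_weak_derivative k f g \<longleftrightarrow>
     (\<forall>\<phi> :: real \<Rightarrow> real. periodic_fun_simple' \<phi> \<and> smooth_map \<phi> \<longrightarrow>
        (LINT t:{0..1}|lebesgue. (deriv ^^ k) \<phi> t *\<^sub>R f t) =
        (-1) ^ k *\<^sub>R (LINT t:{0..1}|lebesgue. \<phi> t *\<^sub>R g t))"

definition sobolev_space :: "nat \<Rightarrow> (real \<Rightarrow> 'a::euclidean_space) set" where
  "sobolev_space m =
     {f \<in> L2_circle. \<forall>k\<le>m. \<exists>g\<in>L2_circle. has_weak_derivative k f g}"

text \<open>Weak derivatives are unique almost everywhere, so the choice does not affect the norm.\<close>

definition weak_derivative ::
    "nat \<Rightarrow> (real \<Rightarrow> 'a::euclidean_space) \<Rightarrow> real \<Rightarrow> 'a" where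
  "weak_derivative k f = (SOME g. g \<in> L2_circle \<and> has_weak_derivative k f g)"

definition sobolev_norm :: "nat \<Rightarrow> (real \<Rightarrow> 'a::euclidean_space) \<Rightarrow> real" where
  "sobolev_norm m f =
     sqrt (\<Sum>k\<le>m. LINT t:{0..1}|lebesgue. (norm (weak_derivative k f t))\<^sup>2)"

text \<open>
  \<open>C\<^sup>\<infinity>\<close> curves \<open>I \<rightarrow> W\<^sup>m\<^sup>,\<^sup>2\<close> on an interval \<open>I\<close> (one-sided derivatives at end points):
  \<open>G j\<close> is the \<open>j\<close>-th derivative of \<open>\<gamma>\<close> with respect to the curve parameter, taken in the norm
  of \<open>W\<^sup>m\<^sup>,\<^sup>2\<close>.
\<close>

definition smooth_curve_into_sobolev ::
    "nat \<Rightarrow> real set \<Rightarrow> (real \<Rightarrow> real \<Rightarrow> 'a::euclidean_space) \<Rightarrow> bool" where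
  "smooth_curve_into_sobolev m I \<gamma> \<longleftrightarrow>
     (\<exists>G :: nat \<Rightarrow> real \<Rightarrow> real \<Rightarrow> 'a.
        (\<forall>\<tau>\<in>I. G 0 \<tau> = \<gamma> \<tau>) \<and>
        (\<forall>j. \<forall>\<tau>\<in>I. G j \<tau> \<in> sobolev_space m \<and>
           ((\<lambda>\<sigma>. sobolev_norm m (\<lambda>t. (G j \<sigma> t - G j \<tau> t) /\<^sub>R (\<sigma> - \<tau>) - G (Suc j) \<tau> t))
              \<longlongrightarrow> 0) (at \<tau> within I)))"

end

theory Submission
  imports Defs
begin

text \<open>
  Let \<open>A t\<close> be the derivative of \<open>X t\<close> at \<open>x0 t\<close>. Non-degeneracy means that the monodromy of
  \<open>v' = A v\<close> has no fixed vector, so \<open>v' - A v\<close> has a bounded inverse \<open>K\<close> on continuous periodic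
  functions. A shift by \<open>\<tau>\<close> moves \<open>K g\<close> by \<open>O(\<bar>\<tau>\<bar>)\<close> times the supremum of \<open>g\<close>, hence with the unknown
  \<open>g = v' - A v\<close> the delay equation becomes a fixed point equation for a contraction on the space of continuous
  periodic functions. This gives existence, and the same estimate gives local uniqueness.

  The shift is not a smooth map of any of these function spaces, so a \<open>C\<^sup>\<infinity>\<close> implicit function
  theorem is not available. Instead \<open>u (\<tau>, t) = x\<^sub>\<tau> t\<close> is shown to be jointly smooth: if \<open>u\<close>
  is of class \<open>C\<^sup>k\<close>, its \<open>\<tau>\<close>-derivative solves a linear delay equation of the same kind with
  coefficients of class \<open>C\<^sup>k\<close>, and its \<open>t\<close>-derivative is of class \<open>C\<^sup>k\<close> by the equation
  itself. Compactness of the circle then turns joint smoothness into smoothness of the curve \<open>x\<^sub>\<tau>\<close> in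
  every Sobolev space.
\<close>

section \<open>Maps of class \<open>C\<^sup>k\<close> on open sets\<close>

text \<open>Two losses have to be controlled. Differentiating a shift in \<tau> costs a derivative
  in \<open>t\<close>, so an iteration in spaces of functions of \<open>t\<close> alone runs out of
  regularity; with both arguments treated as one variable, the equation itself pays the derivative
  back. Moreover the interval of delays must not shrink with the order \<open>k\<close>. The only
  smallness required is \<open>\<delta> * \<kappa> + a * (a * \<kappa> + 1) * \<epsilon> \<le>
  1/2\<close>, and each linearised equation inherits it with the same constants, because a Lipschitz
  bound on \<open>F - A\<close> in the space variable passes to its derivative. Hence the induction
  runs over abstract families \<open>delay_family\<close> rather than over \<open>X\<close>.

  Two further obstacles come from the definitions. \<open>flow\<close> is a definite description for
  a field that need be neither complete nor globally Lipschitz, so identifying its derivative with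
  the monodromy takes a uniqueness argument and a cut-off field. \<open>sobolev_norm\<close> uses
  weak derivatives picked by choice, so they must be shown unique almost everywhere before a norm
  can be computed; the embedding of W^{1,2} into continuous functions then turns local uniqueness in
  the supremum norm into the one claimed.\<close>

primrec Ck_on :: "nat \<Rightarrow> 'a set \<Rightarrow> ('a::euclidean_space \<Rightarrow> 'b::real_normed_vector) \<Rightarrow> bool" where
  "Ck_on 0 S f \<longleftrightarrow> continuous_on S f"
| "Ck_on (Suc k) S f \<longleftrightarrow>
     (\<forall>x\<in>S. f differentiable (at x)) \<and> (\<forall>v. Ck_on k S (\<lambda>x. frechet_derivative f (at x) v))"

lemma Ck_on_UNIV: "Ck_on k UNIV f \<longleftrightarrow> Ck k f"
  by (induction k arbitrary: f) auto

lemma frechet_derivative_cong_open: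
  assumes "open S" "x \<in> S" "\<And>x. x \<in> S \<Longrightarrow> f x = g x"
  shows "frechet_derivative f (at x) = frechet_derivative g (at x)"
proof -
  have "(f has_derivative D) (at x) \<longleftrightarrow> (g has_derivative D) (at x)" for D
    using has_derivative_transform_within_open[OF _ assms(1,2), of f D UNIV g]
      has_derivative_transform_within_open[OF _ assms(1,2), of g D UNIV f] assms(3) by auto
  then show ?thesis by (simp add: frechet_derivative_def)
qed

lemma differentiable_cong_open:
  assumes "open S" "x \<in> S" "\<And>x. x \<in> S \<Longrightarrow> f x = g x" "f differentiable (at x)"
  shows "g differentiable (at x)"
  using assms has_derivative_transform_within_open[OF _ assms(1,2), of f _ UNIV g]
  unfolding differentiable_def by blast

text \<open>Derivatives are taken \<open>at x\<close> in the whole space, so it is openness of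
  \<open>S\<close> that makes values outside \<open>S\<close> irrelevant.\<close>

lemma Ck_on_cong:
  assumes "open S" "\<And>x. x \<in> S \<Longrightarrow> f x = g x" "Ck_on k S f"
  shows "Ck_on k S g"
  using assms(2,3)
proof (induction k arbitrary: f g)
  case 0
  then show ?case using continuous_on_cong[of S S f g] by simp
next
  case (Suc k)
  have "Ck_on k S (\<lambda>x. frechet_derivative g (at x) v)" for v
    by (rule Suc.IH[of "\<lambda>x. frechet_derivative f (at x) v"])
      (use Suc.prems frechet_derivative_cong_open[OF assms(1), of _ f g] in auto)
  then show ?case using Suc.prems differentiable_cong_open[OF assms(1), of _ f g] by auto
qed

lemma Ck_on_SucI:
  assumes "open S" "\<And>x. x \<in> S \<Longrightarrow> (f has_derivative f' x) (at x)"
    and "\<And>v. Ck_on k S (\<lambda>x. f' x v)"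
  shows "Ck_on (Suc k) S f"
proof -
  have "Ck_on k S (\<lambda>x. frechet_derivative f (at x) v)" for v
    by (rule Ck_on_cong[OF assms(1) _ assms(3)[of v]])
      (use assms(2) frechet_derivative_at in metis)
  then show ?thesis using assms(2) by (auto simp: differentiable_def)
qed

lemma Ck_on_imp_continuous_on:
  assumes "Ck_on k S f" shows "continuous_on S f"
proof (cases k)
  case (Suc j)
  then have "\<forall>x\<in>S. f differentiable (at x)" using assms by simp
  then have "f differentiable_on S" unfolding differentiable_on_def using differentiable_at_withinI by blast
  then show ?thesis by (rule differentiable_imp_continuous_on)
qed (use assms in simp)

lemma Ck_on_Suc_imp: "Ck_on (Suc k) S f \<Longrightarrow> Ck_on k S f"
proof (induction k arbitrary: f)
  case 0
  then show ?case using Ck_on_imp_continuous_on[of "Suc 0" S f] by simp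
next
  case (Suc k)
  have "Ck_on (Suc k) S (\<lambda>x. frechet_derivative f (at x) v)" for v
    using Suc.prems unfolding Ck_on.simps(2)[of "Suc k"] by blast
  then have "Ck_on k S (\<lambda>x. frechet_derivative f (at x) v)" for v
    by (rule Suc.IH)
  moreover have "\<forall>x\<in>S. f differentiable (at x)"
    using Suc.prems unfolding Ck_on.simps(2)[of "Suc k"] by blast
  ultimately show ?case unfolding Ck_on.simps(2) by blast
qed

lemma Ck_on_mono: "Ck_on k S f \<Longrightarrow> j \<le> k \<Longrightarrow> Ck_on j S f"
proof (induction k)
  case (Suc k)
  show ?case
  proof (cases "j = Suc k")
    case False
    then show ?thesis using Suc.IH[OF Ck_on_Suc_imp[OF Suc.prems(1)]] Suc.prems(2) by linarith
  qed (use Suc.prems in blast)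
qed simp

lemma Ck_on_has_derivative:
  "Ck_on (Suc k) S f \<Longrightarrow> x \<in> S \<Longrightarrow> (f has_derivative frechet_derivative f (at x)) (at x)"
  by (simp add: frechet_derivative_works)

lemma Ck_on_frechet_derivative:
  "Ck_on (Suc k) S f \<Longrightarrow> Ck_on k S (\<lambda>x. frechet_derivative f (at x) v)"
  by simp

lemma Ck_on_const: "open S \<Longrightarrow> Ck_on k S (\<lambda>x. c)"
proof (induction k arbitrary: c)
  case (Suc k)
  show ?case
    by (rule Ck_on_SucI[where f' = "\<lambda>x v. 0"]) (use Suc in auto)
qed auto

lemma Ck_on_compose_linear:
  assumes "open S" "bounded_linear L" "Ck_on k S f"
  shows "Ck_on k S (\<lambda>x. L (f x))"
  using assms(3)
proof (induction k arbitrary: f)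
  case 0
  then show ?case by (auto intro: bounded_linear.continuous_on[OF assms(2)])
next
  case (Suc k)
  show ?case
  proof (rule Ck_on_SucI[OF assms(1)])
    show "((\<lambda>x. L (f x)) has_derivative (\<lambda>v. L (frechet_derivative f (at x) v))) (at x)" if "x \<in> S" for x
      using bounded_linear.has_derivative[OF assms(2)] Ck_on_has_derivative[OF Suc.prems that] by blast
  qed (use Suc in auto)
qed

lemma Ck_on_linear:
  assumes "open S" "bounded_linear L" shows "Ck_on k S L"
proof (cases k)
  case 0 then show ?thesis using assms linear_continuous_on by auto
next
  case (Suc j)
  show ?thesis unfolding Suc
    by (rule Ck_on_SucI[where f' = "\<lambda>x. L"])
      (use assms Ck_on_const bounded_linear.has_derivative[OF assms(2) has_derivative_ident] in auto)
qed

lemma Ck_on_add: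
  assumes "open S" "Ck_on k S f" "Ck_on k S g"
  shows "Ck_on k S (\<lambda>x. f x + g x)"
  using assms(2,3)
proof (induction k arbitrary: f g)
  case (Suc k)
  show ?case
  proof (rule Ck_on_SucI[OF assms(1)])
    show "((\<lambda>x. f x + g x) has_derivative
      (\<lambda>v. frechet_derivative f (at x) v + frechet_derivative g (at x) v)) (at x)" if "x \<in> S" for x
      using Suc.prems that by (intro has_derivative_add Ck_on_has_derivative)
  qed (use Suc in auto)
qed (auto intro: continuous_intros)

lemma Ck_on_uminus: "open S \<Longrightarrow> Ck_on k S f \<Longrightarrow> Ck_on k S (\<lambda>x. - f x)"
  using Ck_on_compose_linear[of S uminus k f] bounded_linear_minus[OF bounded_linear_ident] by simp

lemma Ck_on_diff:
  "open S \<Longrightarrow> Ck_on k S f \<Longrightarrow> Ck_on k S g \<Longrightarrow> Ck_on k S (\<lambda>x. f x - g x)"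
  using Ck_on_add[of S k f "\<lambda>x. - g x"] Ck_on_uminus[of S k g] by simp

lemma Ck_on_sum:
  assumes "open S" "\<And>i. i \<in> I \<Longrightarrow> Ck_on k S (f i)"
  shows "Ck_on k S (\<lambda>x. \<Sum>i\<in>I. f i x)"
  using assms(2)
proof (induction I rule: infinite_finite_induct)
  case (insert i I)
  then show ?case using Ck_on_add[OF assms(1), of k "f i" "\<lambda>x. \<Sum>i\<in>I. f i x"] by simp
qed (use Ck_on_const[OF assms(1)] in auto)

lemma Ck_on_Pair:
  fixes f :: "'a::euclidean_space \<Rightarrow> 'b::real_normed_vector" and g :: "'a \<Rightarrow> 'c::real_normed_vector"
  assumes "open S" "Ck_on k S f" "Ck_on k S g"
  shows "Ck_on k S (\<lambda>x. (f x, g x))"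
proof -
  have "bounded_linear (\<lambda>x::'b. (x, 0::'c))" "bounded_linear (\<lambda>x::'c. (0::'b, x))"
    by (auto intro!: bounded_linear_Pair bounded_linear_zero bounded_linear_ident)
  from Ck_on_add[OF assms(1) Ck_on_compose_linear[OF assms(1) this(1) assms(2)]
      Ck_on_compose_linear[OF assms(1) this(2) assms(3)]]
  show ?thesis by simp
qed

lemma Ck_on_scaleR:
  fixes f :: "'a::euclidean_space \<Rightarrow> real"
  assumes "open S" "Ck_on k S f" "Ck_on k S g"
  shows "Ck_on k S (\<lambda>x. f x *\<^sub>R g x)"
  using assms(2,3)
proof (induction k arbitrary: f g)
  case (Suc k)
  show ?case
  proof (rule Ck_on_SucI[OF assms(1)])
    show "((\<lambda>x. f x *\<^sub>R g x) has_derivative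
      (\<lambda>v. f x *\<^sub>R frechet_derivative g (at x) v + frechet_derivative f (at x) v *\<^sub>R g x)) (at x)"
      if "x \<in> S" for x
      using Suc.prems that by (intro has_derivative_scaleR Ck_on_has_derivative)
    show "Ck_on k S (\<lambda>x. f x *\<^sub>R frechet_derivative g (at x) v + frechet_derivative f (at x) v *\<^sub>R g x)" for v
      using Suc Ck_on_Suc_imp[of k S f] Ck_on_Suc_imp[of k S g]
      by (intro Ck_on_add[OF assms(1)]) auto
  qed
qed (auto intro: continuous_intros)

lemma linear_eq_sum_Basis:
  fixes L :: "'a::euclidean_space \<Rightarrow> 'b::real_normed_vector"
  assumes "linear L"
  shows "L v = (\<Sum>b\<in>Basis. (v \<bullet> b) *\<^sub>R L b)"
proof -
  have "L v = L (\<Sum>b\<in>Basis. (v \<bullet> b) *\<^sub>R b)" by (simp add: euclidean_representation)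
  also have "\<dots> = (\<Sum>b\<in>Basis. (v \<bullet> b) *\<^sub>R L b)"
    using assms by (simp add: linear_sum linear_scale)
  finally show ?thesis .
qed

text \<open>In the chain rule the direction fed to the derivative of \<open>f\<close> varies with
  \<open>x\<close>, whereas \<open>Ck_on\<close> only speaks of fixed directions. Expanding that
  direction in the basis leaves derivatives of \<open>f\<close> in fixed directions, composed with
  \<open>g\<close>, to which the induction hypothesis applies.\<close>

lemma Ck_on_compose:
  fixes g :: "'a::euclidean_space \<Rightarrow> 'b::euclidean_space" and f :: "'b \<Rightarrow> 'c::real_normed_vector"
  assumes "open S" "open T" "Ck_on k T f" "Ck_on k S g" "g ` S \<subseteq> T"
  shows "Ck_on k S (\<lambda>x. f (g x))"
  using assms(3,4)
proof (induction k arbitrary: f)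
  case 0
  then show ?case using assms(5) by (auto intro: continuous_on_compose2)
next
  case (Suc k)
  have der: "((\<lambda>x. f (g x)) has_derivative
      (\<lambda>v. frechet_derivative f (at (g x)) (frechet_derivative g (at x) v))) (at x)" if "x \<in> S" for x
    using has_derivative_compose[OF Ck_on_has_derivative[OF Suc.prems(2) that]
         Ck_on_has_derivative[OF Suc.prems(1), of "g x"]] that assms(5) by auto
  show ?case
  proof (rule Ck_on_SucI[OF assms(1) der])
    fix v
    have "Ck_on k S (\<lambda>x. \<Sum>b\<in>Basis. (frechet_derivative g (at x) v \<bullet> b) *\<^sub>R frechet_derivative f (at (g x)) b)"
      using Suc Ck_on_Suc_imp[OF Suc.prems(2)]
      by (intro Ck_on_sum Ck_on_scaleR assms(1) Ck_on_compose_linear[OF _ bounded_linear_inner_left]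
             Suc.IH) auto
    then show "Ck_on k S (\<lambda>x. frechet_derivative f (at (g x)) (frechet_derivative g (at x) v))"
    proof (rule Ck_on_cong[OF assms(1), rotated])
      fix x assume "x \<in> S"
      then have "linear (frechet_derivative f (at (g x)))"
        using Ck_on_has_derivative[OF Suc.prems(1)] assms(5) has_derivative_linear by blast
      from linear_eq_sum_Basis[OF this, of "frechet_derivative g (at x) v"]
      show "(\<Sum>b\<in>Basis. (frechet_derivative g (at x) v \<bullet> b) *\<^sub>R frechet_derivative f (at (g x)) b)
        = frechet_derivative f (at (g x)) (frechet_derivative g (at x) v)" by simp
    qed
  qed
qed

lemma Ck_on_frechet_derivative_apply:
  fixes g :: "'a::euclidean_space \<Rightarrow> 'b::euclidean_space" and f :: "'b \<Rightarrow> 'c::real_normed_vector"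
  assumes "open S" "open T" "Ck_on (Suc k) T f" "Ck_on k S g" "g ` S \<subseteq> T" "Ck_on k S V"
  shows "Ck_on k S (\<lambda>x. frechet_derivative f (at (g x)) (V x))"
proof -
  have "Ck_on k S (\<lambda>x. \<Sum>b\<in>Basis. (V x \<bullet> b) *\<^sub>R frechet_derivative f (at (g x)) b)"
    by (intro Ck_on_sum Ck_on_scaleR assms(1,6) Ck_on_compose_linear[OF _ bounded_linear_inner_left]
             Ck_on_compose[OF assms(1,2) Ck_on_frechet_derivative[OF assms(3)] assms(4,5)])
  then show ?thesis
  proof (rule Ck_on_cong[OF assms(1), rotated])
    fix x assume "x \<in> S"
    then have "linear (frechet_derivative f (at (g x)))"
      using Ck_on_has_derivative[OF assms(3)] assms(5) has_derivative_linear by blast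
    from linear_eq_sum_Basis[OF this, of "V x"]
    show "(\<Sum>b\<in>Basis. (V x \<bullet> b) *\<^sub>R frechet_derivative f (at (g x)) b)
        = frechet_derivative f (at (g x)) (V x)" by simp
  qed
qed

lemma Ck_on_has_vector_derivativeI:
  fixes f :: "real \<Rightarrow> 'b::real_normed_vector"
  assumes "open S" "\<And>x. x \<in> S \<Longrightarrow> (f has_vector_derivative f' x) (at x)" "Ck_on k S f'"
  shows "Ck_on (Suc k) S f"
  by (rule Ck_on_SucI[where f' = "\<lambda>x v. v *\<^sub>R f' x"])
    (use assms in \<open>auto simp: has_vector_derivative_def intro: Ck_on_compose_linear[OF _ bounded_linear_scaleR_right]\<close>)

lemma Ck_on_partialsI:
  fixes f :: "real \<Rightarrow> real \<Rightarrow> 'b::real_normed_vector"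
  assumes "open I"
    and f1: "\<And>x y. x \<in> I \<Longrightarrow> ((\<lambda>x. f x y) has_vector_derivative f1 (x, y)) (at x)"
    and f2: "\<And>x y. x \<in> I \<Longrightarrow> ((\<lambda>y. f x y) has_vector_derivative f2 (x, y)) (at y)"
    and C: "Ck_on k (I \<times> UNIV) f1" "Ck_on k (I \<times> UNIV) f2"
  shows "Ck_on (Suc k) (I \<times> UNIV) (\<lambda>z. f (fst z) (snd z))"
proof -
  have op: "open (I \<times> (UNIV::real set))" by (simp add: assms(1) open_Times)
  show ?thesis
  proof (rule Ck_on_SucI[OF op])
    fix z assume z: "z \<in> I \<times> (UNIV::real set)"
    obtain x y where xy: "z = (x, y)" "x \<in> I" using z by auto
    have cont: "continuous (at z) f2"
      using Ck_on_imp_continuous_on[OF C(2)] z continuous_on_eq_continuous_at[OF op] by blast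
    \<comment> \<open>Total differentiability needs the first partial only at the point itself, but
      continuity of the second one there; the latter is phrased as a bounded linear
      function.\<close>
    have "((\<lambda>(x,y). f x y) has_derivative (\<lambda>(tx, ty). tx *\<^sub>R f1 (x,y) + blinfun_scaleR_left (f2 (x,y)) ty)) (at (x, y) within I \<times> UNIV)"
    proof (rule has_derivative_partialsI)
      show "((\<lambda>x. f x y) has_derivative (\<lambda>tx. tx *\<^sub>R f1 (x, y))) (at x within I)"
        using f1[OF xy(2), of y] unfolding has_vector_derivative_def by (rule has_derivative_at_withinI)
      show "(f x has_derivative blinfun_apply (blinfun_scaleR_left (f2 (x, y)))) (at y within UNIV)"
        if "x \<in> I" for x y
        using f2[OF that, of y] by (simp add: has_vector_derivative_def)
      have "continuous (at (x,y) within I \<times> UNIV) f2"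
        using cont unfolding xy(1) by (rule continuous_at_imp_continuous_within)
      from bounded_linear.continuous[OF bounded_linear_blinfun_scaleR_left this]
      show "continuous (at (x, y) within I \<times> UNIV) (\<lambda>(x, y). blinfun_scaleR_left (f2 (x, y)))"
        by (simp add: split_def)
    qed auto
    then have "((\<lambda>z. f (fst z) (snd z)) has_derivative (\<lambda>(tx, ty). tx *\<^sub>R f1 (x,y) + blinfun_scaleR_left (f2 (x,y)) ty)) (at (x, y))"
      using at_within_open[OF z op] xy(1) by (simp add: split_def)
    then show "((\<lambda>z. f (fst z) (snd z)) has_derivative (\<lambda>v. fst v *\<^sub>R f1 z + snd v *\<^sub>R f2 z)) (at z)"
      by (simp add: xy(1) split_def)
  next
    show "Ck_on k (I \<times> UNIV) (\<lambda>z. fst v *\<^sub>R f1 z + snd v *\<^sub>R f2 z)" for v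
      by (intro Ck_on_add op Ck_on_compose_linear[OF _ bounded_linear_scaleR_right] C)
  qed
qed

section \<open>Ordinary differential equations\<close>

lemma has_vector_derivative_imp_continuous_on:
  "(\<And>t. (v has_vector_derivative v' t) (at t)) \<Longrightarrow> continuous_on S v"
  by (meson continuous_at_imp_continuous_on has_vector_derivative_continuous)

text \<open>The norm is not differentiable at 0, its square is. Bounding
  \<open>2 * norm y * e\<close> by the sum of the squares costs the \<open>+ 1\<close> in the
  exponent, and with \<open>e\<^sup>2\<close> added to the square the exponentially weighted
  quantity \<open>g\<close> is nonincreasing.\<close>

lemma gronwall_norm_square:
  fixes y :: "real \<Rightarrow> 'a::real_inner"
  assumes der: "\<And>s. s \<in> {0..t} \<Longrightarrow> (y has_vector_derivative y' s) (at s within {0..t})"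
    and bd: "\<And>s. s \<in> {0..t} \<Longrightarrow> norm (y' s) \<le> L * norm (y s) + e"
    and "0 \<le> t" "0 \<le> e" "0 \<le> L"
  shows "(norm (y t))\<^sup>2 \<le> exp ((2 * L + 1) * t) * ((norm (y 0))\<^sup>2 + e\<^sup>2)"
proof -
  define c where "c = 2 * L + 1"
  define g where "g s = exp (- c * s) * (y s \<bullet> y s + e\<^sup>2)" for s
  define g' where "g' s = exp (- c * s) * (2 * (y s \<bullet> y' s)) + (- c * exp (- c * s)) * (y s \<bullet> y s + e\<^sup>2)" for s
  have dg: "(g has_real_derivative g' s) (at s within {0..t})" if "s \<in> {0..t}" for s
  proof -
    have "((\<lambda>s. y s \<bullet> y s) has_real_derivative 2 * (y s \<bullet> y' s)) (at s within {0..t})"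
      using has_derivative_inner[OF der[OF that, unfolded has_vector_derivative_def]
          der[OF that, unfolded has_vector_derivative_def]]
      unfolding has_field_derivative_def
      by (rule has_derivative_eq_rhs) (auto simp: fun_eq_iff inner_commute algebra_simps)
    then show ?thesis unfolding g_def g'_def
      by (auto intro!: derivative_eq_intros simp: algebra_simps)
  qed
  have le0: "g' s \<le> 0" if "s \<in> {0..t}" for s
  proof -
    have "2 * (y s \<bullet> y' s) \<le> 2 * (norm (y s) * norm (y' s))"
      using norm_cauchy_schwarz by simp
    also have "\<dots> \<le> 2 * (norm (y s) * (L * norm (y s) + e))"
      using bd[OF that] by (simp add: mult_left_mono)
    also have "\<dots> = 2 * L * (norm (y s))\<^sup>2 + 2 * norm (y s) * e"
      by (simp add: power2_eq_square algebra_simps)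
    also have "\<dots> \<le> 2 * L * (norm (y s))\<^sup>2 + ((norm (y s))\<^sup>2 + e\<^sup>2)"
      using sum_squares_bound[of "norm (y s)" e] by simp
    also have "\<dots> \<le> c * (y s \<bullet> y s + e\<^sup>2) - 2 * L * e\<^sup>2"
      by (simp add: c_def power2_norm_eq_inner algebra_simps)
    also have "\<dots> \<le> c * (y s \<bullet> y s + e\<^sup>2)" using \<open>0 \<le> L\<close> by simp
    finally have "exp (- c * s) * (2 * (y s \<bullet> y' s)) \<le> exp (- c * s) * (c * (y s \<bullet> y s + e\<^sup>2))"
      by (intro mult_left_mono) auto
    then show ?thesis by (simp add: g'_def algebra_simps)
  qed
  have "g t \<le> g 0"
  proof (rule DERIV_nonpos_imp_decreasing_open[OF \<open>0 \<le> t\<close>])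
    fix s assume s: "0 < s" "s < t"
    then have "at s within {0..t} = at s" by (intro at_within_interior) auto
    then show "\<exists>y. (g has_real_derivative y) (at s) \<and> y \<le> 0"
      using dg[of s] le0[of s] s by auto
  next
    show "continuous_on {0..t} g"
      using dg by (meson DERIV_continuous continuous_on_eq_continuous_within)
  qed
  then have "exp (c * t) * (exp (- c * t) * (y t \<bullet> y t + e\<^sup>2)) \<le> exp (c * t) * (y 0 \<bullet> y 0 + e\<^sup>2)"
    unfolding g_def by (intro mult_left_mono) auto
  moreover have "exp (c * t) * exp (- c * t) = 1" by (simp flip: exp_add)
  ultimately have "y t \<bullet> y t + e\<^sup>2 \<le> exp (c * t) * (y 0 \<bullet> y 0 + e\<^sup>2)"
    by (metis mult.assoc mult_1)
  then show ?thesis unfolding c_def power2_norm_eq_inner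
    using zero_le_power2[of e] by linarith
qed

text \<open>The exponent is enlarged from \<open>2 * L + 1\<close> to \<open>2 * (L + 1)\<close> so
  that the right-hand side becomes a square. The result is linear in the initial value and the error
  and uniform on the interval, which is the form all later comparisons use.\<close>

lemma gronwall_norm:
  fixes y :: "real \<Rightarrow> 'a::real_inner"
  assumes der: "\<And>s. s \<in> {0..T} \<Longrightarrow> (y has_vector_derivative y' s) (at s within {0..T})"
    and bd: "\<And>s. s \<in> {0..T} \<Longrightarrow> norm (y' s) \<le> L * norm (y s) + e"
    and "0 \<le> e" "0 \<le> L" "t \<in> {0..T}"
  shows "norm (y t) \<le> exp ((L + 1) * T) * (norm (y 0) + e)"
proof -
  have "(norm (y t))\<^sup>2 \<le> exp ((2 * L + 1) * t) * ((norm (y 0))\<^sup>2 + e\<^sup>2)"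
  proof (rule gronwall_norm_square[where y' = y'])
    show "(y has_vector_derivative y' s) (at s within {0..t})" if "s \<in> {0..t}" for s
      using der[of s] that \<open>t \<in> {0..T}\<close> by (auto intro: has_vector_derivative_within_subset)
  qed (use assms in auto)
  also have "\<dots> \<le> exp (2 * ((L + 1) * T)) * (norm (y 0) + e)\<^sup>2"
  proof (rule mult_mono)
    have "(2 * L + 1) * t \<le> (2 * L + 2) * T"
      using assms by (intro mult_mono) auto
    then show "exp ((2 * L + 1) * t) \<le> exp (2 * ((L + 1) * T))"
      by (simp add: algebra_simps)
    show "(norm (y 0))\<^sup>2 + e\<^sup>2 \<le> (norm (y 0) + e)\<^sup>2"
      using \<open>0 \<le> e\<close> by (simp add: power2_sum)
  qed auto
  also have "\<dots> = (exp ((L + 1) * T) * (norm (y 0) + e))\<^sup>2"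
    by (simp add: power_mult_distrib exp_double)
  finally show ?thesis
    by (rule power2_le_imp_le) (use \<open>0 \<le> e\<close> in auto)
qed

lemma integral_exp_bound:
  fixes f :: "real \<Rightarrow> 'a::euclidean_space"
  assumes "continuous_on {0..t} f" "\<And>s. s \<in> {0..t} \<Longrightarrow> norm (f s) \<le> K * exp (c * s)"
    and "0 < c" "0 \<le> t" "0 \<le> K"
  shows "norm (integral {0..t} f) \<le> K * exp (c * t) / c"
proof -
  have "((\<lambda>s. K * exp (c * s)) has_integral (K * exp (c * t) / c - K * exp (c * 0) / c)) {0..t}"
    using assms(3,4) by (intro fundamental_theorem_of_calculus)
      (auto intro!: derivative_eq_intros simp flip: has_real_derivative_iff_has_vector_derivative)
  then have "norm (integral {0..t} f) \<le> K * exp (c * t) / c - K * exp (c * 0) / c"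
    using integral_norm_bound_integral[OF integrable_continuous_interval[OF assms(1)], of "\<lambda>s. K * exp (c * s)"]
      assms(2) by (auto simp: has_integral_iff)
  then show ?thesis using assms by (smt (verit) divide_nonneg_pos mult_nonneg_nonneg exp_ge_zero)
qed

text \<open>Picard iteration is a contraction for the weighted norm \<open>sup exp (- c * t) * norm (y t)\<close>.\<close>

lemma global_lipschitz_ode:
  fixes F :: "real \<Rightarrow> 'a::euclidean_space \<Rightarrow> 'a"
  assumes cont: "continuous_on UNIV (\<lambda>(t, p). F t p)"
    and lip: "\<And>t p q. norm (F t p - F t q) \<le> L * norm (p - q)"
    and bd: "\<And>t. norm (F t 0) \<le> b" and "0 < L"
  shows "\<exists>y. y 0 = p \<and> (\<forall>t\<ge>0. (y has_vector_derivative F t (y t)) (at t within {0..}))"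
proof -
  \<comment> \<open>The weighted iteration contracts with factor \<open>L / c\<close>, here
    1/2.\<close>
  define c where "c = 2 * L"
  have "c > 0" using \<open>0 < L\<close> by (simp add: c_def)
  have "b \<ge> 0" using bd[of 0] norm_ge_zero order_trans by blast
  \<comment> \<open>Here \<open>z\<close> is the weighted curve, so the solution sought is
    \<open>exp (c * s) *\<^sub>R z s\<close>. In \<Psi> the argument \<open>max 0 t\<close> extends
    everything constantly to negative times, which makes the iteration act on bounded continuous
    functions of the whole line.\<close>
  define f where "f z s = F s (exp (c * s) *\<^sub>R z s)" for z :: "real \<Rightarrow> 'a" and s
  define J where "J z t = p + integral {0..t} (f z)" for z :: "real \<Rightarrow> 'a" and t
  define \<Psi> where "\<Psi> z t = exp (- c * max 0 t) *\<^sub>R J z (max 0 t)" for z :: "real \<Rightarrow> 'a" and t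
  have cf: "continuous_on S (f z)" if "continuous_on UNIV z" for z S
  proof -
    have "continuous_on UNIV (\<lambda>s. (s, exp (c * s) *\<^sub>R z s))"
      by (intro continuous_intros that)
    from continuous_on_compose2[OF cont this]
    have "continuous_on UNIV (f z)" by (simp add: f_def)
    then show ?thesis using continuous_on_subset by blast
  qed
  have dJ: "(J z has_vector_derivative f z t) (at t within {0..})" if "continuous_on UNIV z" "0 \<le> t" for z t
  proof -
    have "((\<lambda>u. integral {0..u} (f z)) has_vector_derivative f z t) (at t within {0..t+1})"
      using that cf[OF that(1)] by (intro integral_has_vector_derivative) auto
    then have "(J z has_vector_derivative f z t) (at t within {0..t+1})"
      unfolding J_def by (auto intro!: derivative_eq_intros)
    moreover have "at t within {0..t+1} = at t within {0..}"
      by (rule at_within_nhd[of _ "{..<t+1}"]) (use that in auto)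
    ultimately show ?thesis by simp
  qed
  have cJ: "continuous_on {0..} (J z)" if "continuous_on UNIV z" for z
    using dJ[OF that] has_vector_derivative_continuous
    by (fastforce simp: continuous_on_eq_continuous_within)
  have c\<Psi>: "continuous_on UNIV (\<Psi> z)" if "continuous_on UNIV z" for z
    unfolding \<Psi>_def
    by (intro continuous_intros continuous_on_compose2[OF cJ[OF that]]) auto
  have b\<Psi>: "norm (\<Psi> z t) \<le> norm p + (b + L * K) / c"
    if "continuous_on UNIV z" "\<And>s. norm (z s) \<le> K" for z t K
  proof -
    define u where "u = max 0 t"
    have "K \<ge> 0" using that(2)[of 0] norm_ge_zero order_trans by blast
    have "norm (f z s) \<le> (b + L * K) * exp (c * s)" if s: "s \<in> {0..u}" for s
    proof -
      have "norm (f z s) \<le> norm (F s 0) + L * (exp (c * s) * norm (z s))"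
        using lip[of s "exp (c * s) *\<^sub>R z s" 0] norm_triangle_sub[of "f z s" "F s 0"] by (simp add: f_def)
      also have "\<dots> \<le> b * exp (c * s) + L * (exp (c * s) * K)"
      proof (intro add_mono mult_left_mono)
        have "b * 1 \<le> b * exp (c * s)" using \<open>b \<ge> 0\<close> s \<open>c > 0\<close> by (intro mult_left_mono) auto
        then show "norm (F s 0) \<le> b * exp (c * s)" using bd[of s] by simp
      qed (use \<open>0 < L\<close> \<open>\<And>s. norm (z s) \<le> K\<close> in auto)
      finally show ?thesis by (simp add: algebra_simps)
    qed
    then have "norm (integral {0..u} (f z)) \<le> (b + L * K) * exp (c * u) / c"
      using cf[OF that(1)] \<open>c > 0\<close> \<open>K \<ge> 0\<close> \<open>b \<ge> 0\<close> \<open>0 < L\<close>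
      by (intro integral_exp_bound) (auto simp: u_def)
    moreover have "norm p \<le> norm p * exp (c * u)"
      using \<open>c > 0\<close> by (simp add: mult_le_cancel_left1 u_def)
    ultimately have "norm (J z u) \<le> norm p * exp (c * u) + (b + L * K) * exp (c * u) / c"
      unfolding J_def by (meson add_mono norm_triangle_le)
    then have "exp (- c * u) * norm (J z u) \<le> exp (- c * u) * (norm p * exp (c * u) + (b + L * K) * exp (c * u) / c)"
      by (intro mult_left_mono) auto
    also have "\<dots> = (exp (- c * u) * exp (c * u)) * (norm p + (b + L * K) / c)"
      by (simp add: algebra_simps)
    also have "exp (- c * u) * exp (c * u) = 1" by (simp flip: exp_add)
    finally show ?thesis by (simp add: \<Psi>_def u_def)
  qed
  define TT where "TT z = Bcontfun (\<Psi> (apply_bcontfun z))" for z :: "real \<Rightarrow>\<^sub>C 'a"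
  have TT: "apply_bcontfun (TT z) = \<Psi> (apply_bcontfun z)" for z
    unfolding TT_def using c\<Psi>[of "apply_bcontfun z"] b\<Psi>[of "apply_bcontfun z", OF _ norm_bounded[of z]]
    by (intro Bcontfun_inverse bcontfun_normI) auto
  have "dist (TT z) (TT w) \<le> 1/2 * dist z w" for z w
  proof (rule dist_bound)
    fix t :: real
    define u where "u = max 0 t"
    have cz: "continuous_on UNIV (apply_bcontfun z)" "continuous_on UNIV (apply_bcontfun w)" by auto
    have "norm (integral {0..u} (\<lambda>s. f z s - f w s)) \<le> (L * dist z w) * exp (c * u) / c"
    proof (rule integral_exp_bound)
      show "norm (f z s - f w s) \<le> L * dist z w * exp (c * s)" for s
      proof -
        have "norm (f z s - f w s) \<le> L * (exp (c * s) * dist (z s) (w s))"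
          using lip[of s "exp (c * s) *\<^sub>R z s" "exp (c * s) *\<^sub>R w s"]
          by (simp add: f_def dist_norm flip: scaleR_diff_right)
        also have "\<dots> \<le> L * (exp (c * s) * dist z w)"
          using \<open>0 < L\<close> by (simp add: dist_bounded)
        finally show ?thesis by (simp add: mult_ac)
      qed
    qed (use \<open>0 < L\<close> \<open>c > 0\<close> cf[OF cz(1)] cf[OF cz(2)] in \<open>auto simp: u_def intro!: continuous_intros\<close>)
    moreover have "J z u - J w u = integral {0..u} (\<lambda>s. f z s - f w s)"
      unfolding J_def using cf[OF cz(1)] cf[OF cz(2)]
      by (simp add: integral_diff integrable_continuous_interval)
    ultimately have "norm (J z u - J w u) \<le> (1/2 * dist z w) * exp (c * u)"
      using \<open>0 < L\<close> by (simp add: c_def)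
    then have "exp (- c * u) * norm (J z u - J w u) \<le> exp (- c * u) * ((1/2 * dist z w) * exp (c * u))"
      by (intro mult_left_mono) auto
    also have "\<dots> = (exp (- c * u) * exp (c * u)) * (1/2 * dist z w)"
      by (simp add: algebra_simps)
    also have "exp (- c * u) * exp (c * u) = 1" by (simp flip: exp_add)
    finally show "dist (TT z t) (TT w t) \<le> 1/2 * dist z w"
      by (simp add: TT \<Psi>_def dist_norm u_def flip: scaleR_diff_right)
  qed
  then obtain z where "TT z = z"
    using banach_fix_type[of "1/2" TT] by auto
  then have z: "apply_bcontfun z t = \<Psi> z t" for t using TT[of z] by simp
  have cz: "continuous_on UNIV (apply_bcontfun z)" by auto
  have eq: "exp (c * t) *\<^sub>R z t = J z t" if "0 \<le> t" for t
    using that by (subst z) (simp add: \<Psi>_def flip: exp_add)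
  have "(J z has_vector_derivative F t (J z t)) (at t within {0..})" if "0 \<le> t" for t
    using dJ[OF cz that] eq[OF that] by (simp add: f_def)
  moreover have "J z 0 = p" by (simp add: J_def)
  ultimately show ?thesis by blast
qed

section \<open>Uniform estimates near compact sets\<close>

lemma uniformly_near_compact:
  fixes f :: "'a::heine_borel \<Rightarrow> 'b::metric_space"
  assumes "open \<Omega>" "continuous_on \<Omega> f" "compact K" "K \<subseteq> \<Omega>" "0 < \<eta>"
  obtains r where "r > 0" "\<And>x y. x \<in> K \<Longrightarrow> dist y x < r \<Longrightarrow> y \<in> \<Omega> \<and> dist (f y) (f x) < \<eta>"
proof -
  \<comment> \<open>A Lebesgue number of this cover of \<open>K\<close> gives the radius. It also
    controls points \<open>y\<close> outside \<open>K\<close>, which uniform continuity on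
    \<open>K\<close> alone would not.\<close>
  define \<G> where "\<G> = {U. open U \<and> U \<subseteq> \<Omega> \<and> (\<forall>y\<in>U. \<forall>z\<in>U. dist (f y) (f z) < \<eta>)}"
  have "K \<subseteq> \<Union>\<G>"
  proof
    fix x assume "x \<in> K"
    then have "x \<in> \<Omega>" using assms by auto
    then have "isCont f x" using assms(1,2) by (simp add: continuous_on_eq_continuous_at)
    then obtain d where d: "d > 0" "\<And>y. dist y x < d \<Longrightarrow> dist (f y) (f x) < \<eta> / 2"
      using \<open>0 < \<eta>\<close> unfolding continuous_at_eps_delta by (metis half_gt_zero)
    obtain d' where d': "d' > 0" "ball x d' \<subseteq> \<Omega>"
      by (rule openE[OF assms(1) \<open>x \<in> \<Omega>\<close>])
    have "dist (f y) (f z) < \<eta>" if "y \<in> ball x (min d d')" "z \<in> ball x (min d d')" for y z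
    proof -
      have "dist (f y) (f x) < \<eta> / 2" "dist (f z) (f x) < \<eta> / 2"
        using that d(2)[of y] d(2)[of z] by (auto simp: dist_commute)
      then show ?thesis using dist_triangle2[of "f y" "f z" "f x"] by linarith
    qed
    moreover have "ball x (min d d') \<subseteq> \<Omega>" using d'(2) subset_ball[of "min d d'" d' x] by auto
    ultimately have "ball x (min d d') \<in> \<G>" unfolding \<G>_def by blast
    then show "x \<in> \<Union>\<G>" using d(1) d'(1) by (intro UnionI[of "ball x (min d d')"]) auto
  qed
  then obtain r where r: "r > 0" "\<And>x. x \<in> K \<Longrightarrow> \<exists>U\<in>\<G>. ball x r \<subseteq> U"
    using Heine_Borel_lemma[OF assms(3), of \<G>] unfolding \<G>_def by blast
  have "y \<in> \<Omega> \<and> dist (f y) (f x) < \<eta>" if xy: "x \<in> K" "dist y x < r" for x y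
  proof -
    obtain U where U: "U \<in> \<G>" "ball x r \<subseteq> U" using r(2)[OF xy(1)] by blast
    have "x \<in> U" "y \<in> U" using U(2) xy(2) r(1) by (auto simp: dist_commute)
    then show ?thesis using U(1) unfolding \<G>_def by blast
  qed
  then show ?thesis using that r(1) by blast
qed

text \<open>Since \<open>Ck_on\<close> gives continuity of the derivative one direction at a time,
  bounds in operator norm have to be assembled from the basis, at the price of the
  dimension.\<close>

lemma onorm_le_Basis:
  fixes L :: "'a::euclidean_space \<Rightarrow> 'b::real_normed_vector"
  assumes "linear L" "\<And>b. b \<in> Basis \<Longrightarrow> norm (L b) \<le> \<eta>"
  shows "norm (L v) \<le> real DIM('a) * \<eta> * norm v"
proof -
  have "norm (L v) \<le> (\<Sum>b\<in>Basis. \<bar>v \<bullet> b\<bar> * norm (L b))"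
    by (subst linear_eq_sum_Basis[OF assms(1)]) (rule order_trans[OF norm_sum], simp)
  also have "\<dots> \<le> (\<Sum>b\<in>(Basis::'a set). norm v * \<eta>)"
    by (intro sum_mono mult_mono assms(2)) (auto simp: Basis_le_norm)
  finally show ?thesis by (simp add: mult_ac)
qed

text \<open>On a small ball around \<open>x\<close> all derivatives are \<eta>-close to the one at
  \<open>x\<close>, so by the mean value inequality on this convex set \<open>F\<close> minus its
  linearisation at \<open>x\<close> is \<eta>-Lipschitz there. The base point \<open>x\<close> need
  not be one of the two points compared.\<close>

lemma uniform_linearization_near_compact:
  fixes F :: "'a::euclidean_space \<Rightarrow> 'b::real_normed_vector"
  assumes "open \<Omega>" "Ck_on (Suc 0) \<Omega> F" "compact K" "K \<subseteq> \<Omega>" "0 < \<eta>"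
  obtains r where "r > 0" "\<And>x y. x \<in> K \<Longrightarrow> dist y x < r \<Longrightarrow> y \<in> \<Omega>"
    "\<And>x y z. x \<in> K \<Longrightarrow> dist y x < r \<Longrightarrow> dist z x < r \<Longrightarrow>
       norm (F y - F z - frechet_derivative F (at x) (y - z)) \<le> \<eta> * norm (y - z)"
    "\<And>x y v. x \<in> K \<Longrightarrow> dist y x < r \<Longrightarrow>
       norm (frechet_derivative F (at y) v - frechet_derivative F (at x) v) \<le> \<eta> * norm v"
proof -
  let ?D = "\<lambda>x. frechet_derivative F (at x)"
  define \<epsilon> where "\<epsilon> = \<eta> / real DIM('a)"
  have "\<epsilon> > 0" using \<open>0 < \<eta>\<close> by (simp add: \<epsilon>_def)
  have "\<exists>r>0. \<forall>x y. x \<in> K \<longrightarrow> dist y x < r \<longrightarrow> y \<in> \<Omega> \<and> dist (?D y b) (?D x b) < \<epsilon>" for b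
    using uniformly_near_compact[OF assms(1) _ assms(3,4) \<open>\<epsilon> > 0\<close>, of "\<lambda>x. ?D x b"]
      Ck_on_imp_continuous_on[OF Ck_on_frechet_derivative[OF assms(2), of b]] by metis
  then obtain r where r: "\<And>b. r b > 0"
    "\<And>b x y. x \<in> K \<Longrightarrow> dist y x < r b \<Longrightarrow> y \<in> \<Omega> \<and> dist (?D y b) (?D x b) < \<epsilon>" by metis
  define R where "R = Min (r ` Basis)"
  have "R > 0" using r(1) by (simp add: R_def)
  have Rr: "R \<le> r b" if "b \<in> Basis" for b using that by (simp add: R_def)
  have near: "y \<in> \<Omega>" if "x \<in> K" "dist y x < R" for x y
    using r(2)[OF that(1)] that(2) Rr[OF SOME_Basis] by (meson less_le_trans)
  have lin: "linear (?D y)" if "y \<in> \<Omega>" for y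
    using Ck_on_has_derivative[OF assms(2) that] has_derivative_linear by blast
  have D: "norm (?D y v - ?D x v) \<le> \<eta> * norm v" if "x \<in> K" "dist y x < R" for x y v
  proof -
    have "linear (\<lambda>v. ?D y v - ?D x v)"
      using lin[OF near[OF that]] lin[of x] that(1) assms(4) by (intro linear_compose_sub) auto
    moreover have "norm (?D y b - ?D x b) \<le> \<epsilon>" if "b \<in> Basis" for b
      using r(2)[OF \<open>x \<in> K\<close>, of y b] \<open>dist y x < R\<close> Rr[OF that] by (auto simp: dist_norm)
    ultimately show ?thesis
      using onorm_le_Basis[of "\<lambda>v. ?D y v - ?D x v" \<epsilon> v] by (simp add: \<epsilon>_def)
  qed
  have "norm (F y - F z - ?D x (y - z)) \<le> \<eta> * norm (y - z)"
    if x: "x \<in> K" and yz: "dist y x < R" "dist z x < R" for x y z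
  proof -
    have "norm (F y - F z - ?D x (y - z)) \<le> norm (y - z) * \<eta>"
    proof (rule differentiable_bound_linearization[where S = "ball x R"])
      show "z + t *\<^sub>R (y - z) \<in> ball x R" if "t \<in> {0..1}" for t
      proof -
        have "(1 - t) *\<^sub>R z + t *\<^sub>R y \<in> ball x R"
          using yz that convex_ball[of x R] by (intro convexD) (auto simp: dist_commute)
        then show ?thesis by (simp add: algebra_simps)
      qed
      show "(F has_derivative ?D u) (at u within ball x R)" if "u \<in> ball x R" for u
        using Ck_on_has_derivative[OF assms(2) near[OF x]] that
        by (auto simp: dist_commute intro: has_derivative_at_withinI)
      show "onorm (?D u - ?D x) \<le> \<eta>" if "u \<in> ball x R" for u
        using D[OF x, of u] that by (intro onorm_le) (simp add: dist_commute)
      show "x \<in> ball x R" using \<open>R > 0\<close> by simp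
    qed
    then show ?thesis by (simp add: mult.commute)
  qed
  with that[OF \<open>R > 0\<close>] near D show ?thesis by blast
qed

section \<open>Periodic linear equations and the linearised flow\<close>

lemma periodic_frac:
  assumes "\<And>t::real. f (t + 1) = f t" shows "f (frac t) = f t"
proof -
  interpret periodic_fun_simple' f by standard (rule assms)
  show ?thesis using minus_of_int[of t "\<lfloor>t\<rfloor>"] by (simp add: frac_def)
qed

lemma frac_in_unit: "frac t \<in> {0..1::real}"
  using frac_ge_0[of t] frac_lt_1[of t] by (simp add: less_imp_le)

lemma periodic_ball:
  assumes "\<And>t::real. f (t + 1) = f t" "\<And>t. t \<in> {0..1} \<Longrightarrow> P (f t)"
  shows "P (f t)"
  using assms(2)[OF frac_in_unit, of t] periodic_frac[of f t] assms(1) by simp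

locale periodic_linear =
  fixes A :: "real \<Rightarrow> 'a::euclidean_space \<Rightarrow> 'a" and a :: real
  assumes cont_A: "continuous_on UNIV (\<lambda>(t, v). A t v)"
    and lin_A: "\<And>t. linear (A t)"
    and per_A: "\<And>t. A (t + 1) = A t"
    and bd_A: "\<And>t v. norm (A t v) \<le> a * norm v"
    and a_pos: "0 < a"
begin

lemma cont_A_compose: "continuous_on S f \<Longrightarrow> continuous_on S (\<lambda>t. A t (f t))"
proof -
  assume "continuous_on S f"
  then have "continuous_on S (\<lambda>t. (t, f t))" by (intro continuous_intros)
  from continuous_on_compose2[OF cont_A this] show ?thesis by simp
qed

lemma homogeneous_eq_0:
  assumes "\<And>s. s \<in> {0..T} \<Longrightarrow> (y has_vector_derivative A s (y s)) (at s within {0..T})"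
    "y 0 = 0" "t \<in> {0..T}"
  shows "y t = 0"
  using gronwall_norm[of T y "\<lambda>s. A s (y s)" a 0 t] assms bd_A a_pos by simp

definition evol :: "'a \<Rightarrow> real \<Rightarrow> 'a" where
  "evol p = (SOME y. y 0 = p \<and> (\<forall>t\<ge>0. (y has_vector_derivative A t (y t)) (at t within {0..})))"

lemma evol:
  shows evol_0: "evol p 0 = p"
    and evol_deriv: "0 \<le> t \<Longrightarrow> (evol p has_vector_derivative A t (evol p t)) (at t within {0..})"
proof -
  have "\<exists>y. y 0 = p \<and> (\<forall>t\<ge>0. (y has_vector_derivative A t (y t)) (at t within {0..}))"
  proof (rule global_lipschitz_ode[where L = a and b = 0])
    show "norm (A t p - A t q) \<le> a * norm (p - q)" for t p q
      using bd_A[of t "p - q"] linear_diff[OF lin_A] by metis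
    show "norm (A t 0) \<le> 0" for t using linear_0[OF lin_A] by simp
  qed (use a_pos cont_A in auto)
  from someI_ex[OF this] show "evol p 0 = p"
    "0 \<le> t \<Longrightarrow> (evol p has_vector_derivative A t (evol p t)) (at t within {0..})"
    unfolding evol_def by blast+
qed

lemma evol_deriv_within:
  "t \<in> {0..T} \<Longrightarrow> (evol p has_vector_derivative A t (evol p t)) (at t within {0..T})"
  using evol_deriv[of t p] by (rule has_vector_derivative_within_subset) auto

lemma homogeneous_eq_evol:
  assumes "\<And>s. s \<in> {0..T} \<Longrightarrow> (y has_vector_derivative A s (y s)) (at s within {0..T})"
    "t \<in> {0..T}"
  shows "y t = evol (y 0) t"
proof -
  have "y t - evol (y 0) t = 0"
  proof (rule homogeneous_eq_0[where y = "\<lambda>t. y t - evol (y 0) t" and T = T])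
    fix s assume "s \<in> {0..T}"
    from has_vector_derivative_diff[OF assms(1)[OF this] evol_deriv_within[OF this]]
    show "((\<lambda>t. y t - evol (y 0) t) has_vector_derivative A s (y s - evol (y 0) s)) (at s within {0..T})"
      by (simp add: linear_diff[OF lin_A])
  qed (use assms evol_0 in auto)
  then show ?thesis by simp
qed

definition monodromy :: "'a \<Rightarrow> 'a" where "monodromy p = evol p 1"

lemma linear_monodromy: "linear monodromy"
proof (rule linearI)
  fix p q :: 'a and c :: real
  have "evol p 1 + evol q 1 = evol (evol p 0 + evol q 0) 1"
  proof (rule homogeneous_eq_evol[where y = "\<lambda>t. evol p t + evol q t" and T = 1])
    fix s assume "s \<in> {0..1::real}"
    from has_vector_derivative_add[OF evol_deriv_within[OF this] evol_deriv_within[OF this]]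
    show "((\<lambda>t. evol p t + evol q t) has_vector_derivative A s (evol p s + evol q s)) (at s within {0..1})"
      by (simp add: linear_add[OF lin_A])
  qed auto
  then show "monodromy (p + q) = monodromy p + monodromy q" by (simp add: monodromy_def evol_0)
  have "c *\<^sub>R evol p 1 = evol (c *\<^sub>R evol p 0) 1"
  proof (rule homogeneous_eq_evol[where y = "\<lambda>t. c *\<^sub>R evol p t" and T = 1])
    fix s assume s: "s \<in> {0..1::real}"
    have "((\<lambda>t. c *\<^sub>R evol p t) has_vector_derivative c *\<^sub>R A s (evol p s)) (at s within {0..1})"
      using evol_deriv_within[OF s] by (auto intro!: derivative_eq_intros)
    then show "((\<lambda>t. c *\<^sub>R evol p t) has_vector_derivative A s (c *\<^sub>R evol p s)) (at s within {0..1})"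
      by (simp add: linear_scale[OF lin_A])
  qed auto
  then show "monodromy (c *\<^sub>R p) = c *\<^sub>R monodromy p" by (simp add: monodromy_def evol_0)
qed

text \<open>Let \<open>M\<close> be the monodromy. For the bound, \<open>v\<close> is compared with
  the homogeneous solution starting at \<open>v 0\<close>: the difference starts at 0, so after one
  period it is at most \<open>C * H\<close>, while by periodicity it equals
  \<open>v 0 - M (v 0)\<close>. The lower bound \<mu> for the injective map \<open>p - M p\<close>
  then controls \<open>v 0\<close>, and a second use of Gronwall controls the whole period; hence
  \<open>\<kappa> = C * (C / \<mu> + 1)\<close>. Existence rests on surjectivity of the same
  map.\<close>

lemma periodic_inverse:
  assumes nondeg: "\<And>p. monodromy p = p \<Longrightarrow> p = 0"
  obtains \<kappa> where "0 < \<kappa>"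
    "\<And>h. continuous_on UNIV h \<Longrightarrow> (\<And>t. h (t + 1) = h t) \<Longrightarrow>
       \<exists>v. (\<forall>t. v (t + 1) = v t) \<and> (\<forall>t. (v has_vector_derivative A t (v t) + h t) (at t))"
    "\<And>v h H t. (\<And>t. v (t + 1) = v t) \<Longrightarrow> (\<And>t. (v has_vector_derivative A t (v t) + h t) (at t)) \<Longrightarrow>
       (\<And>t. norm (h t) \<le> H) \<Longrightarrow> norm (v t) \<le> \<kappa> * H"
proof -
  let ?N = "\<lambda>p. p - monodromy p"
  have linN: "linear ?N" using linear_monodromy by (intro linear_compose_sub linear_id[unfolded id_def])
  have injN: "inj ?N" using nondeg by (subst linear_injective_0[OF linN]) auto
  obtain \<mu> where \<mu>: "\<mu> > 0" "\<And>p. \<mu> * norm p \<le> norm (?N p)"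
    using linear_inj_bounded_below_pos[OF linN injN] by metis
  define C where "C = exp (a + 1)"
  have C: "C > 0" by (simp add: C_def)
  define \<kappa> where "\<kappa> = C * (C / \<mu> + 1)"
  have "\<kappa> > 0" using C \<mu>(1) by (simp add: \<kappa>_def add_nonneg_pos)
  have bound: "norm (v t) \<le> \<kappa> * H"
    if per: "\<And>t. v (t + 1) = v t" and dv: "\<And>t. (v has_vector_derivative A t (v t) + h t) (at t)"
      and H: "\<And>t. norm (h t) \<le> H" for v h H t
  proof -
    have "H \<ge> 0" using H[of 0] norm_ge_zero order_trans by blast
    have dv': "(v has_vector_derivative A t (v t) + h t) (at t within S)" for t S
      using dv by (rule has_vector_derivative_at_within)
    have "norm (v 1 - evol (v 0) 1) \<le> exp ((a + 1) * 1) * (norm (v 0 - evol (v 0) 0) + H)"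
    proof (rule gronwall_norm[where y = "\<lambda>t. v t - evol (v 0) t" and
          y' = "\<lambda>t. A t (v t - evol (v 0) t) + h t" and T = 1])
      fix s assume s: "s \<in> {0..1::real}"
      from has_vector_derivative_diff[OF dv'[of s] evol_deriv_within[OF s]]
      show "((\<lambda>t. v t - evol (v 0) t) has_vector_derivative A s (v s - evol (v 0) s) + h s) (at s within {0..1})"
        by (simp add: linear_diff[OF lin_A] algebra_simps)
      show "norm (A s (v s - evol (v 0) s) + h s) \<le> a * norm (v s - evol (v 0) s) + H"
        using bd_A H by (intro norm_triangle_mono)
    qed (use a_pos \<open>H \<ge> 0\<close> in auto)
    then have "norm (?N (v 0)) \<le> C * H"
      using per[of 0] by (simp add: monodromy_def evol_0 C_def)
    then have "\<mu> * norm (v 0) \<le> C * H" using \<mu>(2)[of "v 0"] by linarith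
    then have v0: "norm (v 0) \<le> C / \<mu> * H" using \<mu>(1) by (simp add: field_simps)
    have "norm (v s) \<le> \<kappa> * H" if s: "s \<in> {0..1}" for s
    proof -
      have "norm (v s) \<le> exp ((a + 1) * 1) * (norm (v 0) + H)"
        by (rule gronwall_norm[where y' = "\<lambda>t. A t (v t) + h t" and T = 1])
          (use dv' bd_A H a_pos \<open>H \<ge> 0\<close> s in \<open>auto intro: norm_triangle_mono\<close>)
      also have "\<dots> \<le> C * (C / \<mu> * H + H)" using v0 C by (simp add: C_def)
      finally show ?thesis by (simp add: \<kappa>_def algebra_simps)
    qed
    then show ?thesis by (rule periodic_ball[where f = v, OF per])
  qed
  have ex: "\<exists>v. (\<forall>t. v (t + 1) = v t) \<and> (\<forall>t. (v has_vector_derivative A t (v t) + h t) (at t))"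
    if ch: "continuous_on UNIV h" and ph: "\<And>t. h (t + 1) = h t" for h
  proof -
    obtain b where b: "\<And>t. norm (h t) \<le> b"
    proof -
      have "compact (h ` {0..1})" using ch continuous_on_subset by (intro compact_continuous_image) auto
      then obtain b where "\<forall>x\<in>h ` {0..1}. norm x \<le> b" using compact_imp_bounded bounded_iff by metis
      then show ?thesis using that[of b] periodic_ball[where f = h and P = "\<lambda>x. norm x \<le> b", OF ph] by auto
    qed
    define F where "F t p = A t p + h t" for t p
    have pF: "F (t + 1) = F t" for t using per_A ph by (simp add: F_def fun_eq_iff)
    have ode: "\<exists>y. y 0 = p \<and> (\<forall>t\<ge>0. (y has_vector_derivative F t (y t)) (at t within {0..}))" for p
    proof (rule global_lipschitz_ode[where L = a and b = b])
      show "continuous_on UNIV (\<lambda>(t, p). F t p)"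
        using continuous_on_add[OF cont_A continuous_on_compose2[OF ch continuous_on_fst[OF continuous_on_id]]]
        unfolding F_def by (simp add: split_def)
      show "norm (F t p - F t q) \<le> a * norm (p - q)" for t p q
        using bd_A[of t "p - q"] by (simp add: F_def linear_diff[OF lin_A])
      show "norm (F t 0) \<le> b" for t using linear_0[OF lin_A] b by (simp add: F_def)
    qed (use a_pos in auto)
    have unique: "y t = z t"
      if "\<And>t. t \<ge> 0 \<Longrightarrow> (y has_vector_derivative F t (y t)) (at t within {0..})"
        "\<And>t. t \<ge> 0 \<Longrightarrow> (z has_vector_derivative F t (z t)) (at t within {0..})" "y 0 = z 0" "0 \<le> t" for y z t
    proof -
      have "y t - z t = 0"
      proof (rule homogeneous_eq_0[where y = "\<lambda>t. y t - z t" and T = t])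
        fix s assume s: "s \<in> {0..t}"
        then have "((\<lambda>t. y t - z t) has_vector_derivative F s (y s) - F s (z s)) (at s within {0..})"
          using that(1,2) by (intro has_vector_derivative_diff) auto
        then have "((\<lambda>t. y t - z t) has_vector_derivative F s (y s) - F s (z s)) (at s within {0..t})"
          by (rule has_vector_derivative_within_subset) auto
        then show "((\<lambda>t. y t - z t) has_vector_derivative A s (y s - z s)) (at s within {0..t})"
          by (simp add: F_def linear_diff[OF lin_A])
      qed (use that in auto)
      then show ?thesis by simp
    qed
    obtain y0 where y0: "y0 0 = 0" "\<And>t. t \<ge> 0 \<Longrightarrow> (y0 has_vector_derivative F t (y0 t)) (at t within {0..})"
      using ode[of 0] by blast
    \<comment> \<open>Starting at \<open>p\<close> instead of 0 adds \<open>evol p\<close> to the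
      solution, so it closes up after one period exactly if
      \<open>y0 1 + monodromy p = p\<close>.\<close>
    have "surj ?N" by (rule linear_inj_imp_surj[OF linN injN])
    then obtain p where p: "y0 1 = p - monodromy p" by (metis surjE)
    obtain y where y: "y 0 = p" "\<And>t. t \<ge> 0 \<Longrightarrow> (y has_vector_derivative F t (y t)) (at t within {0..})"
      using ode[of p] by blast
    have "y 1 = y0 1 + evol p 1"
    proof (rule unique[of y "\<lambda>t. y0 t + evol p t"])
      fix t :: real assume t: "t \<ge> 0"
      from has_vector_derivative_add[OF y0(2)[OF t] evol_deriv[OF t, of p]]
      show "((\<lambda>t. y0 t + evol p t) has_vector_derivative F t (y0 t + evol p t)) (at t within {0..})"
        by (simp add: F_def linear_add[OF lin_A] algebra_simps)
    qed (use y y0 evol_0 in auto)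
    then have "y 1 = y 0" using p y(1) by (simp add: monodromy_def)
    have y_per: "y (t + 1) = y t" if "0 \<le> t" for t
    proof (rule unique[of "\<lambda>t. y (t + 1)" y])
      fix t :: real assume t: "t \<ge> 0"
      have "(y has_vector_derivative F (t + 1) (y (t + 1))) (at (t + 1) within (\<lambda>t. t + 1) ` {0..})"
        using t by (intro has_vector_derivative_within_subset[OF y(2)]) auto
      then have "((y \<circ> (\<lambda>t. t + 1)) has_vector_derivative 1 *\<^sub>R F (t + 1) (y (t + 1))) (at t within {0..})"
        by (intro vector_diff_chain_within) (auto intro!: derivative_eq_intros)
      then show "((\<lambda>t. y (t + 1)) has_vector_derivative F t (y (t + 1))) (at t within {0..})"
        by (simp add: o_def pF)
    qed (use y that \<open>y 1 = y 0\<close> in auto)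
    have y_per_nat: "y (t + real n) = y t" if "0 \<le> t" for t n
    proof (induction n)
      case (Suc n)
      then show ?case using y_per[of "t + real n"] that by (simp add: add_ac)
    qed simp
    \<comment> \<open>The solution is known for nonnegative times only. Adding enough periods
      extends it to all \<open>t\<close>, and \<open>v_eq\<close> says that the number of periods
      added is immaterial, so locally one fixed \<open>n\<close> may be used for
      differentiation.\<close>
    define v where "v t = y (t + real (nat \<lceil>\<bar>t\<bar>\<rceil>))" for t
    have v_eq: "v t = y (t + real n)" if "0 \<le> t + real n" for t n
    proof -
      let ?m = "nat \<lceil>\<bar>t\<bar>\<rceil>"
      have m: "0 \<le> t + real ?m" by linarith
      have "y (t + real ?m + real n) = y (t + real n + real ?m)" by (simp add: add_ac)
      then show ?thesis using y_per_nat[OF m, of n] y_per_nat[OF that, of ?m] by (simp add: v_def)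
    qed
    have pF_nat: "F (t + real n) = F t" for t n
    proof (induction n)
      case (Suc n)
      then show ?case using pF[of "t + real n"] by (simp add: add_ac)
    qed simp
    have "(v has_vector_derivative A t (v t) + h t) (at t)" for t
    proof -
      obtain n where n: "\<bar>t\<bar> + 1 < real n" using reals_Archimedean2 by blast
      have "(y has_vector_derivative F (t + real n) (y (t + real n))) (at (t + real n) within {0..})"
        using n by (intro y(2)) linarith
      moreover have "at (t + real n) within {0..} = at (t + real n)"
        using n by (intro at_within_interior) (simp add: interior_real_atLeast)
      ultimately have "((y \<circ> (\<lambda>t. t + real n)) has_vector_derivative 1 *\<^sub>R F (t + real n) (y (t + real n))) (at t)"
        by (intro vector_diff_chain_at) (auto intro!: derivative_eq_intros)
      then have d: "((\<lambda>t. y (t + real n)) has_vector_derivative F t (y (t + real n))) (at t)"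
        by (simp add: o_def pF_nat)
      have "(v has_vector_derivative F t (y (t + real n))) (at t)"
        by (rule has_vector_derivative_transform_within_open[OF d, of "ball t 1"])
          (use n in \<open>auto simp: dist_real_def intro!: v_eq[symmetric]\<close>)
      then show ?thesis using v_eq[of t n] n by (simp add: F_def)
    qed
    moreover have "v (t + 1) = v t" for t
    proof -
      obtain n where n: "\<bar>t\<bar> + 1 < real n" using reals_Archimedean2 by blast
      have "v (t + 1) = y (t + real n + 1)" using n v_eq[of "t + 1" n] by (simp add: add_ac)
      also have "\<dots> = v t" using n y_per[of "t + real n"] v_eq[of t n] by simp
      finally show ?thesis .
    qed
    ultimately show ?thesis by blast
  qed
  show ?thesis using that[OF \<open>\<kappa> > 0\<close>] ex bound by blast
qed

end


section \<open>The flow near a periodic orbit and its derivative\<close>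

lemma frechet_derivative_periodic:
  assumes "open S" "z \<in> S" "\<And>x. x \<in> S \<Longrightarrow> f (x + c) = f x"
  shows "frechet_derivative f (at (z + c)) = frechet_derivative f (at z)"
proof -
  have "(f has_derivative D) (at (z + c)) \<longleftrightarrow> (f has_derivative D) (at z)" for D
  proof
    assume "(f has_derivative D) (at (z + c))"
    then have "((\<lambda>x. f (x + c)) has_derivative (\<lambda>v. D v)) (at z)"
      by (intro has_derivative_compose[where g = f and f = "\<lambda>x. x + c"]) (auto intro!: derivative_eq_intros)
    from has_derivative_transform_within_open[OF this assms(1,2) assms(3)]
    show "(f has_derivative D) (at z)" by simp
  next
    assume "(f has_derivative D) (at z)"
    then have "((\<lambda>x. f (x - c)) has_derivative (\<lambda>v. D v)) (at (z + c))"
      by (intro has_derivative_compose[where g = f and f = "\<lambda>x. x - c"]) (auto intro!: derivative_eq_intros)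
    moreover have "open ((\<lambda>x. x + c) ` S)"
      using open_translation[OF assms(1), of c] by (simp add: add.commute)
    ultimately show "(f has_derivative D) (at (z + c))"
      by (rule has_derivative_transform_within_open) (use assms(2,3) in auto)
  qed
  then show ?thesis by (simp add: frechet_derivative_def)
qed

lemma uniform_bound_linear_on_compact:
  fixes L :: "'z::metric_space \<Rightarrow> 'a::euclidean_space \<Rightarrow> 'b::real_normed_vector"
  assumes "continuous_on (K \<times> UNIV) (\<lambda>(z, v). L z v)" "compact K" "\<And>z. z \<in> K \<Longrightarrow> linear (L z)"
  obtains B where "0 < B" "\<And>z v. z \<in> K \<Longrightarrow> norm (L z v) \<le> B * norm v"
proof -
  have "compact ((\<lambda>(z, v). L z v) ` (K \<times> cball 0 1))"
    using assms(2) by (intro compact_continuous_image continuous_on_subset[OF assms(1)] compact_Times) auto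
  then obtain B where B: "0 < B" "\<forall>x\<in>(\<lambda>(z, v). L z v) ` (K \<times> cball 0 1). norm x \<le> B"
    using compact_imp_bounded bounded_pos by metis
  have "norm (L z v) \<le> B * norm v" if "z \<in> K" for z v
  proof (cases "v = 0")
    case True
    then show ?thesis using linear_0[OF assms(3)[OF that]] by simp
  next
    case False
    have "norm (L z (v /\<^sub>R norm v)) \<le> B" using B(2) that False by force
    then show ?thesis using False linear_scale[OF assms(3)[OF that]] by (simp add: field_simps)
  qed
  with that B(1) show ?thesis by blast
qed

text \<open>\<open>flow\<close> is defined by \<open>THE\<close>, so a competing solution must be
  excluded although the field is only locally Lipschitz. Both curves are continuous on the unit
  interval and stay in one ball, and there the bounded derivative gives a Lipschitz constant for
  Gronwall.\<close>

lemma flow_1_eq: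
  fixes X :: "real \<Rightarrow> 'a::euclidean_space \<Rightarrow> 'a"
  assumes C1: "Ck_on (Suc 0) UNIV (\<lambda>(t, p). X t p)"
    and sol: "\<And>s. s \<in> {0..1} \<Longrightarrow> (\<gamma> has_vector_derivative X s (\<gamma> s)) (at s within {0..1})"
  shows "flow X 1 (\<gamma> 0) = \<gamma> 1"
proof -
  have unique: "\<beta> 1 = \<gamma> 1"
    if d: "\<And>s. s \<in> {0..1} \<Longrightarrow> (\<beta> has_vector_derivative X s (\<beta> s)) (at s within {0..1})"
      and "\<beta> 0 = \<gamma> 0" for \<beta>
  proof -
    have "continuous_on {0..1} \<beta>" "continuous_on {0..1} \<gamma>"
      using d sol by (meson has_vector_derivative_continuous continuous_on_eq_continuous_within)+
    then have "bounded (\<beta> ` {0..1} \<union> \<gamma> ` {0..1})"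
      by (simp add: compact_continuous_image compact_imp_bounded)
    then obtain R where R: "\<And>s. s \<in> {0..1} \<Longrightarrow> \<beta> s \<in> cball 0 R \<and> \<gamma> s \<in> cball 0 R"
      by (force simp: bounded_iff)
    let ?F = "\<lambda>(t, p). X t p"
    let ?D = "\<lambda>z. frechet_derivative ?F (at z)"
    let ?K = "{0..1::real} \<times> cball (0::'a) R"
    have der: "(?F has_derivative ?D z) (at z)" for z using Ck_on_has_derivative[OF C1, of z] by simp
    have "Ck_on 0 UNIV (\<lambda>w::(real \<times> 'a) \<times> (real \<times> 'a). ?D (fst w) (snd w))"
      by (rule Ck_on_frechet_derivative_apply[OF open_UNIV open_UNIV C1]) (auto intro!: continuous_intros)
    then have "continuous_on (?K \<times> UNIV) (\<lambda>(z, v). ?D z v)"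
      using continuous_on_subset by (simp add: split_def) blast
    moreover have "compact ?K" by (intro compact_Times) auto
    ultimately obtain B where B: "0 < B" "\<And>z v. z \<in> ?K \<Longrightarrow> norm (?D z v) \<le> B * norm v"
      using uniform_bound_linear_on_compact[of ?K ?D] der has_derivative_linear by metis
    have lip: "norm (X s p - X s q) \<le> B * norm (p - q)"
      if "s \<in> {0..1}" "p \<in> cball 0 R" "q \<in> cball 0 R" for s p q
    proof (rule differentiable_bound[of "cball 0 R" "X s" "\<lambda>p v. ?D (s, p) (0, v)"])
      fix p :: 'a assume p: "p \<in> cball 0 R"
      have "((\<lambda>p. ?F (s, p)) has_derivative (\<lambda>v. ?D (s, p) (0, v))) (at p)"
        by (rule has_derivative_compose[OF _ der]) (auto intro!: derivative_eq_intros)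
      then have "(X s has_derivative (\<lambda>v. ?D (s, p) (0, v))) (at p)" by simp
      then show "(X s has_derivative (\<lambda>v. ?D (s, p) (0, v))) (at p within cball 0 R)"
        by (rule has_derivative_at_withinI)
      show "onorm (\<lambda>v. ?D (s, p) (0, v)) \<le> B"
      proof (rule onorm_le)
        show "norm (?D (s, p) (0, v)) \<le> B * norm v" for v
          using B(2)[of "(s, p)" "(0, v)"] that(1) p by (simp add: norm_Pair)
      qed
    qed (use that in auto)
    have "norm (\<beta> 1 - \<gamma> 1) \<le> exp ((B + 1) * 1) * (norm (\<beta> 0 - \<gamma> 0) + 0)"
      by (rule gronwall_norm[where y = "\<lambda>s. \<beta> s - \<gamma> s" and y' = "\<lambda>s. X s (\<beta> s) - X s (\<gamma> s)" and T = 1])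
        (use d sol lip R B(1) in \<open>auto intro: has_vector_derivative_diff simp del: mem_cball\<close>)
    then show ?thesis using that(2) by simp
  qed
  have "closed_segment 0 (1::real) = {0..1}" by (simp add: closed_segment_eq_real_ivl)
  then show ?thesis unfolding flow_def using sol unique
    by (intro the_equality) (auto intro!: exI[of _ \<gamma>])
qed

locale smooth_periodic_orbit =
  fixes X :: "real \<Rightarrow> 'a::euclidean_space \<Rightarrow> 'a" and x0 :: "real \<Rightarrow> 'a"
  assumes smooth_X: "smooth_periodic_vector_field X" and orbit: "periodic_orbit X x0"
begin

abbreviation "XX \<equiv> (\<lambda>(t, p). X t p)"

abbreviation "DX z \<equiv> frechet_derivative XX (at z)"

lemma Ck_XX: "Ck_on k UNIV XX"
  using smooth_X by (simp add: smooth_periodic_vector_field_def smooth_map_def Ck_on_UNIV)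

lemma per_X: "X (t + 1) = X t"
  using smooth_X by (simp add: smooth_periodic_vector_field_def periodic_fun_simple'_def)

lemma per_x0: "x0 (t + 1) = x0 t"
  using orbit by (simp add: periodic_orbit_def periodic_fun_simple'_def)

lemma deriv_x0: "(x0 has_vector_derivative X t (x0 t)) (at t)"
  using orbit by (simp add: periodic_orbit_def)

lemma cont_x0: "continuous_on S x0"
  by (rule has_vector_derivative_imp_continuous_on[OF deriv_x0])

lemma DX_has_derivative: "(XX has_derivative DX z) (at z)"
  using Ck_on_has_derivative[OF Ck_XX] by simp

lemma linear_DX: "linear (DX z)"
  using DX_has_derivative has_derivative_linear by blast

lemma cont_DX: "continuous_on UNIV (\<lambda>w. DX (fst w) (snd w))"
proof -
  have "Ck_on 0 UNIV (\<lambda>w. DX (fst w) (snd w))"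
    by (rule Ck_on_frechet_derivative_apply[OF open_UNIV open_UNIV Ck_XX]) (auto intro!: continuous_intros)
  then show ?thesis by simp
qed

definition "A t v = DX (t, x0 t) (0, v)"

text \<open>Fixed as a constant so that it can serve as a parameter of the sublocale
  \<open>periodic_linear\<close>; its existence comes from compactness of one period.\<close>

definition "a = (SOME a. 0 < a \<and> (\<forall>t v. norm (A t v) \<le> a * norm v))"

lemma per_A0: "A (t + 1) = A t"
  using frechet_derivative_periodic[of UNIV "(t, x0 t)" XX "(1, 0)"]
  by (simp add: A_def fun_eq_iff per_x0 per_X split_def)

lemma lin_A0: "linear (A t)"
proof -
  have "linear (DX (t, x0 t) \<circ> (\<lambda>v. (0, v)))"
    by (intro linear_compose linear_DX) (auto intro!: linearI)
  then show ?thesis by (simp add: A_def[abs_def] o_def)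
qed

lemma cont_A0: "continuous_on UNIV (\<lambda>(t, v). A t v)"
proof -
  have "continuous_on UNIV (\<lambda>z::real \<times> 'a. ((fst z, x0 (fst z)), (0::real, snd z)))"
    by (intro continuous_intros continuous_on_compose2[OF cont_x0[of UNIV]]) auto
  from continuous_on_compose2[OF cont_DX this]
  show ?thesis by (simp add: A_def split_def)
qed

lemma a: "0 < a" "norm (A t v) \<le> a * norm v"
proof -
  obtain B where B: "0 < B" "\<And>t v. t \<in> {0..1} \<Longrightarrow> norm (A t v) \<le> B * norm v"
    using uniform_bound_linear_on_compact[of "{0..1}" A] lin_A0 continuous_on_subset[OF cont_A0]
    by (metis compact_Icc subset_UNIV)
  then have "\<forall>v. norm (A t v) \<le> B * norm v" for t
    using periodic_ball[where f = A and P = "\<lambda>f. \<forall>v. norm (f v) \<le> B * norm v", OF per_A0] by blast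
  with B(1) have "\<exists>a. 0 < a \<and> (\<forall>t v. norm (A t v) \<le> a * norm v)" by blast
  from someI_ex[OF this] show "0 < a" "norm (A t v) \<le> a * norm v" unfolding a_def by auto
qed

sublocale periodic_linear A a
  by (rule periodic_linear.intro) (fact cont_A0 lin_A0 per_A0 a)+

lemma near_orbit:
  assumes "0 < \<eta>"
  obtains r where "0 < r" "\<And>t p q. norm (p - x0 t) < r \<Longrightarrow> norm (q - x0 t) < r \<Longrightarrow>
    norm (X t p - X t q - A t (p - q)) \<le> \<eta> * norm (p - q)"
proof -
  let ?K = "(\<lambda>t. (t, x0 t)) ` {0..1}"
  have "compact ?K"
    by (intro compact_continuous_image continuous_on_Pair continuous_on_id cont_x0 compact_Icc)
  show ?thesis
  proof (rule uniform_linearization_near_compact[OF open_UNIV Ck_XX \<open>compact ?K\<close> subset_UNIV assms])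
    fix r :: real
    assume r: "0 < r" "\<And>x y z. x \<in> ?K \<Longrightarrow> dist y x < r \<Longrightarrow> dist z x < r \<Longrightarrow>
       norm (XX y - XX z - DX x (y - z)) \<le> \<eta> * norm (y - z)"
    \<comment> \<open>Packing the values of \<open>X\<close>, \<open>A\<close> and \<open>x0\<close>
      into a triple, which is periodic as a whole, lets \<open>periodic_ball\<close> carry the
      estimate from the unit interval to all times.\<close>
    define P where "P = (\<lambda>(Y, B, y::'a). \<forall>p q. norm (p - y) < r \<longrightarrow> norm (q - y) < r \<longrightarrow>
      norm (Y p - Y q - B (p - q) :: 'a) \<le> \<eta> * norm (p - q))"
    have P01: "P (X t, A t, x0 t)" if "t \<in> {0..1}" for t
      unfolding P_def
    proof (clarify)
      fix p q assume "norm (p - x0 t) < r" "norm (q - x0 t) < r"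
      then show "norm (X t p - X t q - A t (p - q)) \<le> \<eta> * norm (p - q)"
        using r(2)[of "(t, x0 t)" "(t, p)" "(t, q)"] that
        by (auto simp: dist_Pair_Pair A_def norm_Pair dist_norm)
    qed
    have "P (X t, A t, x0 t)" for t
      by (rule periodic_ball[where f = "\<lambda>t. (X t, A t, x0 t)" and P = P and t = t, OF _ P01])
        (simp_all only: per_X per_A0 per_x0)
    then show thesis using that[OF r(1)] unfolding P_def by blast
  qed
qed

text \<open>A solution starting near \<open>x0 0\<close> might a priori not reach time 1. The
  deviation \<open>w\<close> from the orbit is therefore taken from the field \<open>G\<close>, in
  which the space variable is first projected to a small ball; projection is 1-Lipschitz, so
  \<open>G\<close> is globally Lipschitz and \<open>w\<close> exists for every initial deviation
  \<open>q\<close>. Gronwall gives \<open>norm (w q t) \<le> C * norm q\<close>, so for small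
  \<open>q\<close> the projection is inactive and \<open>x0 t + w q t\<close> solves the original
  equation. Comparing \<open>w q\<close> with \<open>evol q\<close> yields the derivative.\<close>

lemma flow_has_derivative: "(flow X 1 has_derivative monodromy) (at (x0 0))"
proof -
  obtain r1 where r1: "0 < r1" "\<And>t p q. norm (p - x0 t) < r1 \<Longrightarrow> norm (q - x0 t) < r1 \<Longrightarrow>
    norm (X t p - X t q - A t (p - q)) \<le> 1 * norm (p - q)"
    using near_orbit[of 1] zero_less_one by blast
  have lip1: "norm (X t p - X t q) \<le> (a + 1) * norm (p - q)"
    if "norm (p - x0 t) < r1" "norm (q - x0 t) < r1" for t p q
    using r1(2)[OF that] bd_A[of t "p - q"] norm_triangle_sub[of "X t p - X t q" "A t (p - q)"]
    by (simp add: algebra_simps)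
  \<comment> \<open>Half the radius keeps projected points strictly inside the region where
    \<open>lip1\<close> holds.\<close>
  let ?B = "cball (0::'a) (r1 / 2)"
  let ?c = "closest_point ?B"
  have B: "convex ?B" "closed ?B" "?B \<noteq> {}" using r1(1) by auto
  have c: "norm (?c w) < r1" for w
    using closest_point_in_set[OF B(2,3), of w] r1(1) by simp
  define G where "G t w = X t (x0 t + ?c w) - X t (x0 t)" for t w
  have cont_X: "continuous_on UNIV (\<lambda>z. X (f z) (g z))"
    if "continuous_on UNIV f" "continuous_on UNIV g" for f and g :: "real \<times> 'a \<Rightarrow> 'a"
    using continuous_on_compose2[OF Ck_on_imp_continuous_on[OF Ck_XX] continuous_on_Pair[OF that]] by simp
  define C where "C = exp (a + 2)"
  have "C \<ge> 1" using a_pos by (simp add: C_def)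
  have sol: "\<exists>w. w 0 = q \<and> (\<forall>t\<ge>0. (w has_vector_derivative G t (w t)) (at t within {0..}))" for q
  proof (rule global_lipschitz_ode[where L = "a + 1" and b = 0])
    show "continuous_on UNIV (\<lambda>(t, w). G t w)"
      unfolding G_def split_def
      by (intro continuous_intros cont_X continuous_on_compose2[OF cont_x0[of UNIV]]
          continuous_on_compose2[OF continuous_on_closest_point[OF B, of UNIV]]) auto
    show "norm (G t p - G t q) \<le> (a + 1) * norm (p - q)" for t p q
    proof -
      have "norm (G t p - G t q) \<le> (a + 1) * norm (?c p - ?c q)"
        using lip1[of "x0 t + ?c p" t "x0 t + ?c q"] c by (simp add: G_def)
      also have "\<dots> \<le> (a + 1) * norm (p - q)"
        using closest_point_lipschitz[OF B, of p q] a_pos by (intro mult_left_mono) (auto simp: dist_norm)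
      finally show ?thesis .
    qed
    have "?c 0 = 0" using r1(1) by (intro closest_point_self) auto
    then show "norm (G t 0) \<le> 0" for t by (simp add: G_def)
  qed (use a_pos in auto)
  then obtain w where w0: "\<And>q. w q 0 = q"
    and dw: "\<And>q t. 0 \<le> t \<Longrightarrow> (w q has_vector_derivative G t (w q t)) (at t within {0..})" by metis
  have dw': "(w q has_vector_derivative G t (w q t)) (at t within {0..1})" if "t \<in> {0..1}" for q t
    using that dw[of t q] by (auto intro: has_vector_derivative_within_subset)
  have G_le: "norm (G t p) \<le> (a + 1) * norm p" for t p
  proof -
    have "norm (G t p) \<le> (a + 1) * norm (?c p - ?c 0)"
      using lip1[of "x0 t + ?c p" t "x0 t"] c r1(1) closest_point_self[of 0 ?B] by (simp add: G_def)
    also have "\<dots> \<le> (a + 1) * norm (p - 0)"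
      using closest_point_lipschitz[OF B, of p 0] a_pos by (intro mult_left_mono) (auto simp: dist_norm)
    finally show ?thesis by simp
  qed
  have w_le: "norm (w q t) \<le> C * norm q" if "t \<in> {0..1}" for q t
    using gronwall_norm[of 1 "w q" "\<lambda>t. G t (w q t)" "a + 1" 0 t] dw' G_le a_pos that w0
    by (simp add: C_def add.commute)
  have w_small: "G t (w q t) = X t (x0 t + w q t) - X t (x0 t)"
    if "t \<in> {0..1}" "C * norm q \<le> r1 / 2" for q t
  proof -
    have "w q t \<in> ?B" using w_le[OF that(1), of q] that(2) by simp
    then show ?thesis by (simp add: G_def closest_point_self)
  qed
  have flow_w: "flow X 1 (x0 0 + q) = x0 1 + w q 1" if q: "C * norm q \<le> r1 / 2" for q
  proof -
    have "flow X 1 (x0 0 + w q 0) = x0 1 + w q 1"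
    proof (rule flow_1_eq[where \<gamma> = "\<lambda>t. x0 t + w q t", OF Ck_XX])
      fix t assume t: "t \<in> {0..1::real}"
      from has_vector_derivative_add[OF has_vector_derivative_at_within[OF deriv_x0] dw'[OF t, of q]]
      show "((\<lambda>t. x0 t + w q t) has_vector_derivative X t (x0 t + w q t)) (at t within {0..1})"
        by (simp add: w_small[OF t q])
    qed
    then show ?thesis by (simp add: w0)
  qed
  show ?thesis
    unfolding has_derivative_within_alt
  proof (intro conjI allI impI)
    show "bounded_linear monodromy" using linear_monodromy linear_conv_bounded_linear by blast
    fix e :: real assume "0 < e"
    \<comment> \<open>One factor \<open>C\<close> is the growth of \<open>w q\<close>, the other
      comes from the Gronwall comparison with \<open>evol q\<close>.\<close>
    define \<eta> where "\<eta> = e / (C * C)"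
    have "\<eta> > 0" using \<open>0 < e\<close> \<open>C \<ge> 1\<close> by (simp add: \<eta>_def)
    then obtain r where r: "0 < r" "\<And>t p q. norm (p - x0 t) < r \<Longrightarrow> norm (q - x0 t) < r \<Longrightarrow>
      norm (X t p - X t q - A t (p - q)) \<le> \<eta> * norm (p - q)"
      using near_orbit by blast
    define d where "d = min (r / 2) (r1 / 2) / C"
    have "d > 0" using r(1) r1(1) \<open>C \<ge> 1\<close> by (simp add: d_def)
    have "norm (flow X 1 y - flow X 1 (x0 0) - monodromy (y - x0 0)) \<le> e * norm (y - x0 0)"
      if y: "norm (y - x0 0) < d" for y
    proof -
      define q where "q = y - x0 0"
      have Cq: "C * norm q < min (r / 2) (r1 / 2)" using y \<open>C \<ge> 1\<close> by (simp add: q_def d_def field_simps)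
      have f1: "flow X 1 y = x0 1 + w q 1" using flow_w[of q] Cq by (simp add: q_def)
      have f2: "flow X 1 (x0 0) = x0 1"
        by (rule flow_1_eq[OF Ck_XX has_vector_derivative_at_within[OF deriv_x0]])
      have "norm (w q 1 - evol q 1) \<le> exp ((a + 1) * 1) * (norm (w q 0 - evol q 0) + \<eta> * (C * norm q))"
      proof (rule gronwall_norm[where y = "\<lambda>t. w q t - evol q t" and y' = "\<lambda>t. G t (w q t) - A t (evol q t)" and T = 1])
        fix t assume t: "t \<in> {0..1::real}"
        show "((\<lambda>t. w q t - evol q t) has_vector_derivative G t (w q t) - A t (evol q t)) (at t within {0..1})"
          by (intro has_vector_derivative_diff dw' evol_deriv_within t)
        have "norm (w q t) < r" using w_le[OF t, of q] Cq r(1) by linarith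
        then have "norm (G t (w q t) - A t (w q t)) \<le> \<eta> * norm (w q t)"
          using r(2)[of "x0 t + w q t" t "x0 t"] r(1) w_small[OF t, of q] Cq by simp
        also have "\<dots> \<le> \<eta> * (C * norm q)" using w_le[OF t, of q] \<open>\<eta> > 0\<close> by simp
        finally have "norm (G t (w q t) - A t (w q t)) \<le> \<eta> * (C * norm q)" .
        then have "norm (A t (w q t - evol q t) + (G t (w q t) - A t (w q t))) \<le>
            a * norm (w q t - evol q t) + \<eta> * (C * norm q)"
          using bd_A by (intro norm_triangle_mono)
        then show "norm (G t (w q t) - A t (evol q t)) \<le> a * norm (w q t - evol q t) + \<eta> * (C * norm q)"
          by (simp add: linear_diff[OF lin_A])
      qed (use a_pos \<open>\<eta> > 0\<close> \<open>C \<ge> 1\<close> in auto)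
      then have "norm (w q 1 - evol q 1) \<le> exp (a + 1) * (\<eta> * (C * norm q))"
        by (simp add: w0 evol_0)
      also have "\<dots> \<le> C * (\<eta> * (C * norm q))" using \<open>\<eta> > 0\<close> \<open>C \<ge> 1\<close>
        by (intro mult_right_mono) (auto simp: C_def)
      also have "\<dots> = e * norm q" using \<open>C \<ge> 1\<close> by (simp add: \<eta>_def)
      finally have "norm (w q 1 - evol q 1) \<le> e * norm q" .
      with f1 f2 show ?thesis by (simp add: monodromy_def flip: q_def)
    qed
    then show "\<exists>d>0. \<forall>y\<in>UNIV. norm (y - x0 0) < d \<longrightarrow>
        norm (flow X 1 y - flow X 1 (x0 0) - monodromy (y - x0 0)) \<le> e * norm (y - x0 0)"
      using \<open>d > 0\<close> by blast
  qed
qed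

lemma nondegenerate_monodromy:
  assumes "nondegenerate_orbit X x0" "monodromy p = p"
  shows "p = 0"
  using assms frechet_derivative_at[OF flow_has_derivative]
  by (auto simp: nondegenerate_orbit_def is_eigenvalue_def)

end

section \<open>Delay equations close to a non-degenerate linear equation\<close>

lemma periodic_attains_sup:
  fixes f :: "real \<Rightarrow> 'a::real_normed_vector"
  assumes "continuous_on UNIV f" "\<And>t. f (t + 1) = f t"
  obtains t0 where "t0 \<in> {0..1}" "\<And>t. norm (f t) \<le> norm (f t0)"
proof -
  have "continuous_on {0..1} (\<lambda>t. norm (f t))"
    using assms(1) continuous_on_subset by (intro continuous_on_norm) blast
  then obtain t0 where t0: "t0 \<in> {0..1}" "\<forall>t\<in>{0..1}. norm (f t) \<le> norm (f t0)"
    using continuous_attains_sup[of "{0..1::real}" "\<lambda>t. norm (f t)"] by auto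
  then have "norm (f t) \<le> norm (f t0)" for t
    using periodic_ball[of f "\<lambda>x. norm x \<le> norm (f t0)" t] assms(2) by blast
  with that t0(1) show ?thesis by blast
qed

lemma continuous_on_shift:
  fixes v :: "real \<Rightarrow> 'a::topological_space"
  assumes "continuous_on UNIV v" shows "continuous_on S (\<lambda>t. v (t - \<tau>))"
  by (rule continuous_on_compose2[OF assms]) (auto intro!: continuous_intros)

lemma has_vector_derivative_periodic:
  fixes v :: "real \<Rightarrow> 'a::real_normed_vector"
  assumes "\<And>t. (v has_vector_derivative v' t) (at t)" "\<And>t. v (t + 1) = v t"
  shows "v' (t + 1) = v' t"
proof -
  have "((v \<circ> (\<lambda>t. t + 1)) has_vector_derivative 1 *\<^sub>R v' (t + 1)) (at t)"
    by (rule vector_diff_chain_at[OF _ assms(1)]) (auto intro!: derivative_eq_intros)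
  then have "(v has_vector_derivative v' (t + 1)) (at t)"
    using assms(2) by (simp add: o_def)
  then show ?thesis using assms(1) vector_derivative_unique_at by blast
qed

lemma vector_lipschitz:
  fixes v :: "real \<Rightarrow> 'a::real_normed_vector"
  assumes "\<And>u. u \<in> closed_segment s t \<Longrightarrow> (v has_vector_derivative v' u) (at u)"
    and "\<And>u. u \<in> closed_segment s t \<Longrightarrow> norm (v' u) \<le> M"
  shows "norm (v s - v t) \<le> M * \<bar>s - t\<bar>"
proof -
  have "norm (v s - v t) \<le> M * norm (s - t)"
  proof (rule differentiable_bound[of "closed_segment s t"])
    show "(v has_derivative (\<lambda>x. x *\<^sub>R v' u)) (at u within closed_segment s t)"
      if "u \<in> closed_segment s t" for u
      using assms(1)[OF that] by (auto simp: has_vector_derivative_def intro: has_derivative_at_withinI)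
    show "onorm (\<lambda>x. x *\<^sub>R v' u) \<le> M" if "u \<in> closed_segment s t" for u
      using assms(2)[OF that] by (intro onorm_le) (auto simp: mult.commute[of M] intro: mult_left_mono)
  qed auto
  then show ?thesis by simp
qed

lemma norm_Pair_le: "norm (x, y) \<le> norm x + norm y"
  by (simp add: norm_Pair sqrt_sum_squares_le_sum)

lemma dist_Pair_le: "dist (x, y) (x', y') \<le> dist x x' + dist y y'"
  by (simp add: dist_Pair_Pair sqrt_sum_squares_le_sum)

text \<open>\<kappa> bounds the inverse of \<open>v' - A v\<close>, \<delta> is the tolerated
  Lipschitz deviation of a right-hand side from \<open>A\<close>, and \<epsilon> bounds the delay.
  In \<open>small\<close> the first term is the deviation, the second the cost of replacing
  \<open>v (t - \<tau>)\<close> by \<open>v t\<close> inside \<open>A\<close>; their sum 1/2 is the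
  contraction factor.\<close>

locale delay_linear = periodic_linear A a for A :: "real \<Rightarrow> 'a::euclidean_space \<Rightarrow> 'a" and a +
  fixes \<kappa> \<delta> \<epsilon> :: real
  assumes \<kappa>_pos: "0 < \<kappa>" and \<delta>_pos: "0 < \<delta>" and \<epsilon>_pos: "0 < \<epsilon>"
    and inverse_exists: "\<And>h. continuous_on UNIV h \<Longrightarrow> (\<And>t. h (t + 1) = h t) \<Longrightarrow>
       \<exists>v. (\<forall>t. v (t + 1) = v t) \<and> (\<forall>t. (v has_vector_derivative A t (v t) + h t) (at t))"
    and inverse_bound: "\<And>v h H t. (\<And>t. v (t + 1) = v t) \<Longrightarrow>
       (\<And>t. (v has_vector_derivative A t (v t) + h t) (at t)) \<Longrightarrow>
       (\<And>t. norm (h t) \<le> H) \<Longrightarrow> norm (v t) \<le> \<kappa> * H"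
    and small: "\<delta> * \<kappa> + a * (a * \<kappa> + 1) * \<epsilon> \<le> 1/2"
begin

text \<open>The inverse gains one derivative: \<open>v' = A v + h\<close> is bounded by
  \<open>(a * \<kappa> + 1) * H\<close>, so a shift costs only a factor proportional to the
  delay.\<close>

lemma inverse_shift:
  assumes "\<And>t. v (t + 1) = v t" "\<And>t. (v has_vector_derivative A t (v t) + h t) (at t)"
    "\<And>t. norm (h t) \<le> H"
  shows "norm (v (t - \<tau>) - v t) \<le> (a * \<kappa> + 1) * H * \<bar>\<tau>\<bar>"
proof -
  have "norm (A u (v u) + h u) \<le> (a * \<kappa> + 1) * H" for u
  proof -
    have "norm (A u (v u) + h u) \<le> a * norm (v u) + H"
      using bd_A assms(3) by (intro norm_triangle_mono)
    also have "\<dots> \<le> a * (\<kappa> * H) + H"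
      using inverse_bound[OF assms, of u] a_pos by simp
    finally show ?thesis by (simp add: algebra_simps)
  qed
  from vector_lipschitz[OF assms(2) this, where s = "t - \<tau>" and t = t] show ?thesis by simp
qed

lemma delay_estimate:
  assumes "\<And>t. v (t + 1) = v t" "\<And>t. (v has_vector_derivative A t (v t) + h t) (at t)"
    "\<And>t. norm (h t) \<le> H" "\<bar>\<tau>\<bar> \<le> \<epsilon>"
  shows "\<delta> * norm (v (t - \<tau>)) + norm (A t (v (t - \<tau>) - v t)) \<le> H / 2"
proof -
  have "H \<ge> 0" using assms(3)[of 0] norm_ge_zero order_trans by blast
  have "norm (A t (v (t - \<tau>) - v t)) \<le> a * ((a * \<kappa> + 1) * H * \<bar>\<tau>\<bar>)"
    using inverse_shift[OF assms(1-3), of t \<tau>] a_pos bd_A[of t "v (t - \<tau>) - v t"]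
    by (meson mult_left_mono order_less_imp_le order_trans)
  also have "\<dots> \<le> a * ((a * \<kappa> + 1) * H * \<epsilon>)"
    using assms(4) a_pos \<kappa>_pos \<open>H \<ge> 0\<close> by (intro mult_left_mono) auto
  finally have "norm (A t (v (t - \<tau>) - v t)) \<le> a * (a * \<kappa> + 1) * \<epsilon> * H"
    by (simp add: algebra_simps)
  moreover have "\<delta> * norm (v (t - \<tau>)) \<le> \<delta> * (\<kappa> * H)"
    using inverse_bound[OF assms(1-3)] \<delta>_pos by simp
  moreover have "(\<delta> * \<kappa> + a * (a * \<kappa> + 1) * \<epsilon>) * H \<le> 1 / 2 * H"
    using small \<open>H \<ge> 0\<close> by (rule mult_right_mono)
  ultimately show ?thesis by (simp add: algebra_simps)
qed

text \<open>With \<open>g = v' - A v\<close>, the hypothesis is evaluated at a point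
  \<open>t0\<close> where \<open>norm g\<close> is maximal. By \<open>delay_estimate\<close> both
  the delay and the \<delta> term are at most half of this maximum and can be absorbed, leaving
  \<open>norm (g t0) \<le> 2 * e\<close>. As \<open>t0\<close> lies in the unit interval, the
  hypothesis is only asked for there.\<close>

lemma apriori:
  assumes "\<bar>\<tau>\<bar> \<le> \<epsilon>" and per: "\<And>t. v (t + 1) = v t"
    and dv: "\<And>t. (v has_vector_derivative v' t) (at t)" and cv': "continuous_on UNIV v'"
    and le: "\<And>t. t \<in> {0..1} \<Longrightarrow> norm (v' t - A t (v (t - \<tau>))) \<le> \<delta> * norm (v (t - \<tau>)) + e"
  shows "norm (v t) \<le> 2 * \<kappa> * e"
proof -
  define g where "g t = v' t - A t (v t)" for t
  have "continuous_on UNIV v" by (rule has_vector_derivative_imp_continuous_on[OF dv])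
  then have cg: "continuous_on UNIV g" unfolding g_def by (intro continuous_intros cv' cont_A_compose)
  have pg: "g (t + 1) = g t" for t
    unfolding g_def using has_vector_derivative_periodic[where v = v and v' = v', OF dv per] per_A per by simp
  obtain t0 where t0: "t0 \<in> {0..1}" "\<And>t. norm (g t) \<le> norm (g t0)"
    using periodic_attains_sup[of g, OF cg pg] by blast
  have dv': "(v has_vector_derivative A t (v t) + g t) (at t)" for t
    using dv by (simp add: g_def)
  have "norm (g t0) \<le> norm (v' t0 - A t0 (v (t0 - \<tau>))) + norm (A t0 (v (t0 - \<tau>) - v t0))"
    unfolding g_def linear_diff[OF lin_A] using norm_triangle_ineq[of "v' t0 - A t0 (v (t0 - \<tau>))" "A t0 (v (t0 - \<tau>)) - A t0 (v t0)"] by simp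
  also have "\<dots> \<le> norm (g t0) / 2 + e"
    using le[OF t0(1)] delay_estimate[OF per dv' t0(2) assms(1), of t0] by linarith
  finally have "norm (g t0) \<le> 2 * e" by simp
  have "norm (v t) \<le> \<kappa> * norm (g t0)" by (rule inverse_bound[OF per dv' t0(2)])
  also have "\<dots> \<le> \<kappa> * (2 * e)" using \<open>norm (g t0) \<le> 2 * e\<close> \<kappa>_pos by simp
  finally show ?thesis by simp
qed

text \<open>The fixed point is sought among periodic \<open>g\<close> of norm at most
  \<open>R / \<kappa>\<close>, because then the corresponding \<open>V g\<close> stays within
  \<open>R\<close>, where \<Phi> is close to \<open>A\<close>. Contraction by 1/2 uses up half of
  this radius; the assumption on \<open>\<Phi> t 0\<close> provides that the other half suffices for
  \<Theta> to map the ball into itself.\<close>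

lemma delay_exists:
  assumes "\<bar>\<tau>\<bar> \<le> \<epsilon>" "0 < R"
    and cont: "continuous_on UNIV (\<lambda>(t, p). \<Phi> t p)"
    and per: "\<And>t. \<Phi> (t + 1) = \<Phi> t"
    and close: "\<And>t p q. norm p \<le> R \<Longrightarrow> norm q \<le> R \<Longrightarrow>
      norm (\<Phi> t p - \<Phi> t q - A t (p - q)) \<le> \<delta> * norm (p - q)"
    and zero: "\<And>t. norm (\<Phi> t 0) \<le> R / (2 * \<kappa>)"
  shows "\<exists>v. (\<forall>t. v (t + 1) = v t) \<and> (\<forall>t. (v has_vector_derivative \<Phi> t (v (t - \<tau>))) (at t)) \<and>
    (\<forall>t. norm (v t) \<le> R)"
proof -
  define S where "S = {g :: real \<Rightarrow>\<^sub>C 'a. (\<forall>t. apply_bcontfun g (t + 1) = apply_bcontfun g t) \<and> norm g \<le> R / \<kappa>}"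
  define V where "V g = (SOME v. (\<forall>t. v (t + 1) = v t) \<and> (\<forall>t. (v has_vector_derivative A t (v t) + apply_bcontfun g t) (at t)))"
    for g :: "real \<Rightarrow>\<^sub>C 'a"
  have "(\<forall>t. V g (t + 1) = V g t) \<and> (\<forall>t. (V g has_vector_derivative A t (V g t) + apply_bcontfun g t) (at t))"
    if "g \<in> S" for g
    unfolding V_def using that by (intro someI_ex[OF inverse_exists]) (auto simp: S_def)
  then have pV: "V g (t + 1) = V g t" and dV: "(V g has_vector_derivative A t (V g t) + apply_bcontfun g t) (at t)"
    if "g \<in> S" for g t using that by auto
  have cV: "continuous_on UNIV (V g)" if "g \<in> S" for g
    by (rule has_vector_derivative_imp_continuous_on[OF dV[OF that]])
  have V_le: "norm (V g t) \<le> R" if "g \<in> S" for g t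
  proof -
    have "norm (V g t) \<le> \<kappa> * norm g" by (rule inverse_bound[OF pV dV norm_bounded]) (rule that)+
    also have "\<dots> \<le> \<kappa> * (R / \<kappa>)" using that \<kappa>_pos by (intro mult_left_mono) (auto simp: S_def)
    finally show ?thesis using \<kappa>_pos by simp
  qed
  \<comment> \<open>Since \<open>V g\<close> has derivative \<open>A t (V g t) + g t\<close>, the
    delay equation for \<open>V g\<close> says precisely that \<open>g\<close> is fixed by
    \<Theta>.\<close>
  define \<Theta> where "\<Theta> g t = \<Phi> t (V g (t - \<tau>)) - A t (V g t)" for g :: "real \<Rightarrow>\<^sub>C 'a" and t
  have c\<Theta>: "continuous_on UNIV (\<Theta> g)" if "g \<in> S" for g
  proof -
    have "continuous_on UNIV (\<lambda>t. (t, V g (t - \<tau>)))"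
      by (intro continuous_intros continuous_on_compose2[OF cV[OF that]]) auto
    from continuous_on_compose2[OF cont this]
    show ?thesis unfolding \<Theta>_def by (intro continuous_intros cont_A_compose cV that) simp
  qed
  have p\<Theta>: "\<Theta> g (t + 1) = \<Theta> g t" if "g \<in> S" for g t
  proof -
    have "t + 1 - \<tau> = (t - \<tau>) + 1" by simp
    then show ?thesis by (simp only: \<Theta>_def per per_A pV[OF that])
  qed
  have \<Theta>_le: "norm (\<Theta> g t) \<le> R / \<kappa>" if "g \<in> S" for g t
  proof -
    have "norm (\<Theta> g t) = norm (((\<Phi> t (V g (t - \<tau>)) - \<Phi> t 0 - A t (V g (t - \<tau>) - 0))
       + A t (V g (t - \<tau>) - V g t)) + \<Phi> t 0)"
      by (simp add: \<Theta>_def linear_diff[OF lin_A] linear_0[OF lin_A])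
    also have "\<dots> \<le> (\<delta> * norm (V g (t - \<tau>) - 0) + norm (A t (V g (t - \<tau>) - V g t))) + R / (2 * \<kappa>)"
      using V_le[OF that] \<open>0 < R\<close> by (intro norm_triangle_mono close zero order_refl) auto
    also have "\<dots> \<le> norm g / 2 + R / (2 * \<kappa>)"
      using delay_estimate[OF pV dV norm_bounded assms(1), OF that that, of t] by simp
    also have "\<dots> \<le> R / \<kappa>"
    proof -
      have "norm g \<le> R / \<kappa>" "R / (2 * \<kappa>) = R / \<kappa> / 2" using that by (auto simp: S_def)
      then show ?thesis by linarith
    qed
    finally show ?thesis .
  qed
  have \<Theta>_diff: "norm (\<Theta> g t - \<Theta> h t) \<le> dist g h / 2" if "g \<in> S" "h \<in> S" for g h t
  proof -
    define d where "d t = V g t - V h t" for t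
    have pd: "d (t + 1) = d t" for t using pV that by (simp add: d_def)
    have dd: "(d has_vector_derivative A t (d t) + (apply_bcontfun g t - apply_bcontfun h t)) (at t)" for t
      using has_vector_derivative_diff[OF dV[OF that(1), of t] dV[OF that(2), of t]]
      by (simp add: d_def[abs_def] linear_diff[OF lin_A] algebra_simps)
    have bd: "norm (apply_bcontfun g t - apply_bcontfun h t) \<le> dist g h" for t using dist_bounded[of g t h] by (simp add: dist_norm)
    have "A t (d (t - \<tau>) - d t) = A t (d (t - \<tau>)) - (A t (V g t) - A t (V h t))"
      by (simp add: d_def[of t] linear_diff[OF lin_A])
    then have "\<Theta> g t - \<Theta> h t = (\<Phi> t (V g (t - \<tau>)) - \<Phi> t (V h (t - \<tau>)) - A t (d (t - \<tau>)))
       + A t (d (t - \<tau>) - d t)"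
      unfolding \<Theta>_def by (simp only:) (simp add: algebra_simps)
    then have "norm (\<Theta> g t - \<Theta> h t) = norm ((\<Phi> t (V g (t - \<tau>)) - \<Phi> t (V h (t - \<tau>)) - A t (d (t - \<tau>)))
       + A t (d (t - \<tau>) - d t))" by (simp only:)
    also have "\<dots> \<le> \<delta> * norm (d (t - \<tau>)) + norm (A t (d (t - \<tau>) - d t))"
      unfolding d_def[of "t - \<tau>"] using V_le that by (intro norm_triangle_mono close order_refl) auto
    also have "\<dots> \<le> dist g h / 2" by (rule delay_estimate[OF pd dd bd assms(1)])
    finally show ?thesis .
  qed
  define TT where "TT g = Bcontfun (\<Theta> g)" for g :: "real \<Rightarrow>\<^sub>C 'a"
  have TT: "apply_bcontfun (TT g) = \<Theta> g" if "g \<in> S" for g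
    unfolding TT_def using c\<Theta>[OF that] \<Theta>_le[OF that] by (intro Bcontfun_inverse bcontfun_normI) auto
  have "complete S"
  proof -
    have "closed S"
      unfolding closed_sequential_limits
    proof (intro allI impI, elim conjE)
      fix g :: "nat \<Rightarrow> real \<Rightarrow>\<^sub>C 'a" and l assume g: "\<forall>n. g n \<in> S" and l: "g \<longlonglongrightarrow> l"
      have lim: "(\<lambda>n. apply_bcontfun (g n) t) \<longlonglongrightarrow> apply_bcontfun l t" for t
        by (rule metric_tendsto_imp_tendsto[OF l]) (simp add: dist_bounded)
      have "apply_bcontfun l (t + 1) = apply_bcontfun l t" for t
        by (rule LIMSEQ_unique[OF lim]) (use g lim[of t] in \<open>simp add: S_def\<close>)
      moreover have "norm l \<le> R / \<kappa>"
        by (rule LIMSEQ_le_const2[OF tendsto_norm[OF l]]) (use g in \<open>simp add: S_def\<close>)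
      ultimately show "l \<in> S" by (simp add: S_def)
    qed
    then show ?thesis by (simp add: complete_eq_closed)
  qed
  moreover have "0 \<in> S" using \<open>0 < R\<close> \<kappa>_pos by (simp add: S_def)
  moreover have "TT ` S \<subseteq> S"
  proof clarify
    fix g assume g: "g \<in> S"
    have "norm (TT g) \<le> R / \<kappa>" by (rule norm_bound) (simp add: TT[OF g] \<Theta>_le[OF g])
    then show "TT g \<in> S" using TT[OF g] p\<Theta>[OF g] by (simp add: S_def)
  qed
  moreover have "dist (TT g) (TT h) \<le> 1/2 * dist g h" if "g \<in> S" "h \<in> S" for g h
  proof (rule dist_bound)
    show "dist (apply_bcontfun (TT g) t) (apply_bcontfun (TT h) t) \<le> 1/2 * dist g h" for t
      using \<Theta>_diff[OF that, of t] TT[OF that(1)] TT[OF that(2)] by (simp add: dist_norm)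
  qed
  ultimately obtain g where g: "g \<in> S" "TT g = g"
    using Banach_fix[of S "1/2" TT] by auto
  then have "apply_bcontfun g t = \<Theta> g t" for t using TT[OF g(1)] by simp
  then have "(V g has_vector_derivative \<Phi> t (V g (t - \<tau>))) (at t)" for t
    using dV[OF g(1), of t] by (simp add: \<Theta>_def)
  then show ?thesis using pV[OF g(1)] V_le[OF g(1)] by blast
qed

section \<open>Solution families depending on the delay\<close>

abbreviation "I \<equiv> {- \<epsilon><..<\<epsilon>}"

abbreviation "strip \<equiv> I \<times> (UNIV :: real set)"

lemma open_strip: "open strip" "open (strip \<times> UNIV)"
  by (auto intro!: open_Times)

text \<open>Delay, time and position form a single argument of \<open>F\<close>, so that joint
  regularity is expressible by \<open>Ck_on\<close>. \<open>P t\<close> is the region in which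
  \<open>F\<close> is \<delta>-close to \<open>A\<close>. Membership in it is demanded for two
  parameters at once, since the estimates compare \<open>w \<sigma>\<close> and
  \<open>w \<tau>\<close> at the same delayed time \<open>t - \<tau>\<close>. The final clause
  confines nearby solutions to a compact set, on which \<open>F\<close> can be controlled
  uniformly.\<close>

definition delay_family ::
    "((real \<times> real) \<times> 'a \<Rightarrow> 'a) \<Rightarrow> (real \<Rightarrow> 'a set) \<Rightarrow> (real \<Rightarrow> real \<Rightarrow> 'a) \<Rightarrow> bool" where
  "delay_family F P w \<longleftrightarrow>
     (\<forall>\<tau>\<in>I. \<forall>t p. F ((\<tau>, t + 1), p) = F ((\<tau>, t), p)) \<and>
     (\<forall>\<tau>\<in>I. \<forall>t. w \<tau> (t + 1) = w \<tau> t) \<and>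
     (\<forall>\<tau>\<in>I. \<forall>t. (w \<tau> has_vector_derivative F ((\<tau>, t), w \<tau> (t - \<tau>))) (at t)) \<and>
     (\<forall>\<tau>\<in>I. \<forall>\<sigma>\<in>I. \<forall>t. w \<sigma> (t - \<tau>) \<in> P t) \<and>
     (\<forall>\<tau>\<in>I. \<forall>t. \<forall>p\<in>P t. \<forall>q\<in>P t.
        norm (F ((\<tau>, t), p) - F ((\<tau>, t), q) - A t (p - q)) \<le> \<delta> * norm (p - q)) \<and>
     (\<forall>t. open (P t)) \<and>
     (\<forall>\<tau>\<in>I. \<exists>r>0. \<exists>M. \<forall>\<sigma>\<in>I. \<bar>\<sigma> - \<tau>\<bar> < r \<longrightarrow> (\<forall>t. norm (w \<sigma> t) \<le> M))"

lemma delay_familyD: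
  assumes "delay_family F P w" "\<tau> \<in> I"
  shows "F ((\<tau>, t + 1), p) = F ((\<tau>, t), p)" "w \<tau> (t + 1) = w \<tau> t"
    "(w \<tau> has_vector_derivative F ((\<tau>, t), w \<tau> (t - \<tau>))) (at t)"
    "\<sigma> \<in> I \<Longrightarrow> w \<sigma> (t - \<tau>) \<in> P t"
    "p \<in> P t \<Longrightarrow> q \<in> P t \<Longrightarrow> norm (F ((\<tau>, t), p) - F ((\<tau>, t), q) - A t (p - q)) \<le> \<delta> * norm (p - q)"
    "\<exists>r>0. \<exists>M. \<forall>\<sigma>\<in>I. \<bar>\<sigma> - \<tau>\<bar> < r \<longrightarrow> (\<forall>t. norm (w \<sigma> t) \<le> M)"
  using assms unfolding delay_family_def by blast+

lemma delay_family_continuous_t: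
  assumes "delay_family F P w" "\<tau> \<in> I"
  shows "continuous_on S (w \<tau>)"
  by (rule has_vector_derivative_imp_continuous_on[OF delay_familyD(3)[OF assms]])

lemma near_interval:
  assumes "\<tau> \<in> I" "0 < (e::real)"
  obtains r where "0 < r" "r \<le> e" "\<And>\<sigma>. \<bar>\<sigma> - \<tau>\<bar> < r \<Longrightarrow> \<sigma> \<in> I"
proof (rule that[of "min e (\<epsilon> - \<bar>\<tau>\<bar>)"])
  show "0 < min e (\<epsilon> - \<bar>\<tau>\<bar>)" using assms by auto
qed (use assms in auto)

text \<open>The difference \<open>w \<sigma> - w \<tau>\<close> is treated as an approximate
  solution with delay \<tau>, so \<open>apriori\<close> applies. Its error is the change of
  \<open>F\<close> when \<sigma> is replaced by \<tau>, also in the delayed time inside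
  \<open>w \<sigma>\<close>; this is small because the local bound on the family makes all nearby
  \<open>w \<sigma>\<close> Lipschitz with one constant.\<close>

lemma delay_family_uniformly_continuous:
  assumes fam: "delay_family F P w" and cF: "continuous_on (strip \<times> UNIV) F"
    and \<tau>: "\<tau> \<in> I" and "0 < e"
  obtains r where "0 < r" "\<And>\<sigma> t. \<bar>\<sigma> - \<tau>\<bar> < r \<Longrightarrow> \<sigma> \<in> I \<and> norm (w \<sigma> t - w \<tau> t) \<le> e"
proof -
  obtain r0 M where r0: "r0 > 0" "\<And>\<sigma> t. \<sigma> \<in> I \<Longrightarrow> \<bar>\<sigma> - \<tau>\<bar> < r0 \<Longrightarrow> norm (w \<sigma> t) \<le> M"
    using delay_familyD(6)[OF fam \<tau>] by blast
  define K where "K = ({\<tau>} \<times> {0..1::real}) \<times> cball (0::'a) M"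
  have K: "compact K" "K \<subseteq> strip \<times> UNIV" using \<tau> unfolding K_def by (auto intro!: compact_Times)
  have near_F: "\<exists>r>0. \<forall>x y. x \<in> K \<longrightarrow> dist y x < r \<longrightarrow> y \<in> strip \<times> UNIV \<and> dist (F y) (F x) < \<eta>" if "\<eta> > 0" for \<eta>
    using uniformly_near_compact[OF open_strip(2) cF K that] by metis
  obtain r1 where r1: "r1 > 0" "\<And>x y. x \<in> K \<Longrightarrow> dist y x < r1 \<Longrightarrow> dist (F y) (F x) < 1"
    using near_F[of 1] by auto
  have "compact (F ` K)" using cF K continuous_on_subset by (intro compact_continuous_image) auto
  then obtain B where B: "B > 0" "\<And>x. x \<in> K \<Longrightarrow> norm (F x) \<le> B"
    using compact_imp_bounded bounded_pos[of "F ` K"] by auto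
  obtain r2 where r2: "0 < r2" "r2 \<le> min r0 r1" "\<And>\<sigma>. \<bar>\<sigma> - \<tau>\<bar> < r2 \<Longrightarrow> \<sigma> \<in> I"
    using near_interval[OF \<tau>, of "min r0 r1"] r0(1) r1(1) by (metis min_less_iff_conj)
  have lip: "norm (w \<sigma> s - w \<sigma> t) \<le> (B + 1) * \<bar>s - t\<bar>" if \<sigma>: "\<bar>\<sigma> - \<tau>\<bar> < r2" for \<sigma> s t
  proof (rule vector_lipschitz[where v = "w \<sigma>" and v' = "\<lambda>t. F ((\<sigma>, t), w \<sigma> (t - \<sigma>))"])
    have \<sigma>I: "\<sigma> \<in> I" using r2(3)[OF \<sigma>] .
    show dw: "(w \<sigma> has_vector_derivative F ((\<sigma>, t), w \<sigma> (t - \<sigma>))) (at t)" for t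
      by (rule delay_familyD(3)[OF fam \<sigma>I])
    have "norm (F ((\<sigma>, t), w \<sigma> (t - \<sigma>))) \<le> B + 1" if t: "t \<in> {0..1}" for t
    proof -
      have x: "((\<tau>, t), w \<sigma> (t - \<sigma>)) \<in> K" using t r0(2)[OF \<sigma>I] \<sigma> r2(2) by (simp add: K_def)
      have "dist (F ((\<sigma>, t), w \<sigma> (t - \<sigma>))) (F ((\<tau>, t), w \<sigma> (t - \<sigma>))) < 1"
        using \<sigma> r2(2) by (intro r1(2)[OF x]) (simp add: dist_Pair_Pair dist_real_def)
      then show ?thesis using B(2)[OF x] norm_triangle_sub[of "F ((\<sigma>, t), w \<sigma> (t - \<sigma>))" "F ((\<tau>, t), w \<sigma> (t - \<sigma>))"]
        by (simp add: dist_norm)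
    qed
    then show "norm (F ((\<sigma>, u), w \<sigma> (u - \<sigma>))) \<le> B + 1" for u
      by (rule periodic_ball[where f = "\<lambda>t. F ((\<sigma>, t), w \<sigma> (t - \<sigma>))" and P = "\<lambda>x. norm x \<le> B + 1" and t = u,
           OF has_vector_derivative_periodic[where v = "w \<sigma>" and v' = "\<lambda>t. F ((\<sigma>, t), w \<sigma> (t - \<sigma>))",
             OF dw delay_familyD(2)[OF fam \<sigma>I]]])
  qed
  define e' where "e' = e / (2 * \<kappa>)"
  have "e' > 0" using \<open>e > 0\<close> \<kappa>_pos by (simp add: e'_def)
  then obtain r3 where r3: "r3 > 0" "\<And>x y. x \<in> K \<Longrightarrow> dist y x < r3 \<Longrightarrow> dist (F y) (F x) < e'"
    using near_F by meson
  \<comment> \<open>The arguments of \<open>F\<close> move by the change of the delay itself plus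
    \<open>B + 1\<close> times it, the Lipschitz constant of \<open>w \<sigma>\<close>.\<close>
  define r where "r = min r2 (r3 / (B + 2))"
  have "r > 0" using r2(1) r3(1) B(1) by (simp add: r_def)
  have "norm (w \<sigma> t - w \<tau> t) \<le> e" if \<sigma>: "\<bar>\<sigma> - \<tau>\<bar> < r" for \<sigma> t
  proof -
    have \<sigma>2: "\<bar>\<sigma> - \<tau>\<bar> < r2" and \<sigma>3: "\<bar>\<sigma> - \<tau>\<bar> * (B + 2) < r3"
      using \<sigma> B(1) by (auto simp: r_def field_simps)
    have \<sigma>I: "\<sigma> \<in> I" using r2(3)[OF \<sigma>2] .
    have cF': "continuous_on UNIV (\<lambda>t. F ((\<sigma>, t), w \<sigma> (t - \<sigma>)))" if "\<sigma> \<in> I" for \<sigma>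
      by (rule continuous_on_compose2[OF cF])
        (use that in \<open>auto intro!: continuous_intros continuous_on_compose2[OF delay_family_continuous_t[OF fam that, of UNIV]]\<close>)
    have "norm (w \<sigma> t - w \<tau> t) \<le> 2 * \<kappa> * e'"
    proof (rule apriori[of \<tau> "\<lambda>t. w \<sigma> t - w \<tau> t" "\<lambda>t. F ((\<sigma>, t), w \<sigma> (t - \<sigma>)) - F ((\<tau>, t), w \<tau> (t - \<tau>))"])
      show "\<bar>\<tau>\<bar> \<le> \<epsilon>" using \<tau> by auto
      show "w \<sigma> (t + 1) - w \<tau> (t + 1) = w \<sigma> t - w \<tau> t" for t
        using delay_familyD(2)[OF fam] \<tau> \<sigma>I by simp
      show "((\<lambda>t. w \<sigma> t - w \<tau> t) has_vector_derivative F ((\<sigma>, t), w \<sigma> (t - \<sigma>)) - F ((\<tau>, t), w \<tau> (t - \<tau>))) (at t)" for t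
        by (intro has_vector_derivative_diff delay_familyD(3)[OF fam] \<tau> \<sigma>I)
      show "continuous_on UNIV (\<lambda>t. F ((\<sigma>, t), w \<sigma> (t - \<sigma>)) - F ((\<tau>, t), w \<tau> (t - \<tau>)))"
        by (intro continuous_on_diff cF' \<tau> \<sigma>I)
      fix t assume t: "t \<in> {0..1::real}"
      let ?p = "w \<sigma> (t - \<tau>)" and ?q = "w \<tau> (t - \<tau>)"
      have x: "((\<tau>, t), ?p) \<in> K" using t r0(2)[OF \<sigma>I] \<sigma>2 r2(2) by (simp add: K_def)
      have "dist ((\<sigma>, t), w \<sigma> (t - \<sigma>)) ((\<tau>, t), ?p) \<le> dist (\<sigma>, t) (\<tau>, t) + dist (w \<sigma> (t - \<sigma>)) ?p"
        by (rule dist_Pair_le)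
      also have "\<dots> \<le> \<bar>\<sigma> - \<tau>\<bar> + (B + 1) * \<bar>\<sigma> - \<tau>\<bar>"
        using lip[OF \<sigma>2, of "t - \<sigma>" "t - \<tau>"] by (simp add: dist_Pair_Pair dist_real_def dist_norm abs_minus_commute)
      also have "\<dots> < r3" using \<sigma>3 by (simp add: algebra_simps)
      finally have "norm (F ((\<sigma>, t), w \<sigma> (t - \<sigma>)) - F ((\<tau>, t), ?p)) \<le> e'"
        using r3(2)[OF x] by (simp add: dist_norm less_imp_le)
      moreover have "norm (F ((\<tau>, t), ?p) - F ((\<tau>, t), ?q) - A t (?p - ?q)) \<le> \<delta> * norm (?p - ?q)"
        by (intro delay_familyD(5)[OF fam] delay_familyD(4)[OF fam] \<tau> \<sigma>I)
      ultimately have "norm ((F ((\<tau>, t), ?p) - F ((\<tau>, t), ?q) - A t (?p - ?q)) + (F ((\<sigma>, t), w \<sigma> (t - \<sigma>)) - F ((\<tau>, t), ?p)))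
          \<le> \<delta> * norm (?p - ?q) + e'" by (intro norm_triangle_mono)
      then show "norm (F ((\<sigma>, t), w \<sigma> (t - \<sigma>)) - F ((\<tau>, t), ?q) - A t (?p - ?q)) \<le> \<delta> * norm (?p - ?q) + e'"
        by (simp add: algebra_simps)
    qed
    then show ?thesis using \<kappa>_pos by (simp add: e'_def)
  qed
  with that[OF \<open>r > 0\<close>] r2(3) show ?thesis by (simp add: r_def)
qed

lemma delay_family_continuous:
  assumes fam: "delay_family F P w" and cF: "continuous_on (strip \<times> UNIV) F"
  shows "continuous_on strip (\<lambda>z. w (fst z) (snd z))"
  unfolding continuous_on_iff
proof (intro ballI allI impI)
  fix z :: "real \<times> real" and e :: real assume z: "z \<in> strip" "0 < e"
  obtain \<tau> t where zt: "z = (\<tau>, t)" "\<tau> \<in> I" using z by auto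
  obtain r where r: "0 < r" "\<And>\<sigma> t. \<bar>\<sigma> - \<tau>\<bar> < r \<Longrightarrow> \<sigma> \<in> I \<and> norm (w \<sigma> t - w \<tau> t) \<le> e / 2"
    using delay_family_uniformly_continuous[OF fam cF zt(2), of "e / 2"] z(2) half_gt_zero by metis
  have "isCont (w \<tau>) t"
    using delay_familyD(3)[OF fam zt(2)] has_vector_derivative_continuous by blast
  then obtain d where d: "d > 0" "\<And>s. dist s t < d \<Longrightarrow> dist (w \<tau> s) (w \<tau> t) < e / 2"
    using z(2) unfolding continuous_at_eps_delta by (metis half_gt_zero)
  have "dist (w (fst y) (snd y)) (w (fst z) (snd z)) < e" if y: "dist y z < min r d" for y
  proof -
    have "dist (fst y) \<tau> < r" "dist (snd y) t < d"
      using y dist_fst_le[of y z] dist_snd_le[of y z] by (auto simp: zt)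
    then have "norm (w (fst y) (snd y) - w \<tau> (snd y)) \<le> e / 2" "dist (w \<tau> (snd y)) (w \<tau> t) < e / 2"
      using r(2)[of "fst y"] d(2) by (auto simp: dist_real_def)
    then show ?thesis
      using dist_triangle[of "w (fst y) (snd y)" "w \<tau> t" "w \<tau> (snd y)"] by (simp add: zt dist_norm)
  qed
  then show "\<exists>d>0. \<forall>y\<in>strip. dist y z < d \<longrightarrow> dist (w (fst y) (snd y)) (w (fst z) (snd z)) < e"
    using r(1) d(1) by (intro exI[of _ "min r d"]) auto
qed

text \<open>The map \<open>F - A\<close> is \<delta>-Lipschitz in the space variable on the open set
  \<open>P t\<close>, hence so bounded is its derivative, by difference quotients in direction
  \<open>v\<close>. This makes the linearised equation satisfy the smallness condition with the same
  \<delta>.\<close>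

lemma delay_family_derivative_close:
  assumes fam: "delay_family F P w" and C1: "Ck_on (Suc 0) (strip \<times> UNIV) F" and \<tau>: "\<tau> \<in> I"
  shows "norm (frechet_derivative F (at ((\<tau>, t), w \<tau> (t - \<tau>))) (0, v) - A t v) \<le> \<delta> * norm v"
proof -
  define p where "p = w \<tau> (t - \<tau>)"
  define D where "D = frechet_derivative F (at ((\<tau>, t), p))"
  define G where "G q = F ((\<tau>, t), q) - A t q" for q
  define E where "E v = D (0, v) - A t v" for v
  have p: "p \<in> P t" unfolding p_def by (rule delay_familyD(4)[OF fam \<tau> \<tau>])
  have "(F has_derivative D) (at ((\<tau>, t), p))"
    unfolding D_def by (rule Ck_on_has_derivative[OF C1]) (use \<tau> in auto)
  then have "((\<lambda>q. F ((\<tau>, t), q)) has_derivative (\<lambda>v. D (0, v))) (at p)"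
    by (intro has_derivative_compose[where g = F and f = "\<lambda>q. ((\<tau>, t), q)"]) (auto intro!: derivative_eq_intros simp: zero_prod_def)
  moreover have "(A t has_derivative A t) (at p)"
    using lin_A linear_conv_bounded_linear linear_imp_has_derivative by blast
  ultimately have dG: "(G has_derivative E) (at p)" unfolding G_def[abs_def] E_def[abs_def]
    by (rule has_derivative_diff)
  have linE: "linear E" using has_derivative_linear[OF dG] .
  have "norm (E v) \<le> \<delta> * norm v + e" if "e > 0" for e
  proof -
    define e1 where "e1 = e / (norm v + 1)"
    have "e1 > 0" using that by (simp add: e1_def add_nonneg_pos)
    then obtain d where d: "d > 0" "\<And>y. norm (y - p) < d \<Longrightarrow> norm (G y - G p - E (y - p)) \<le> e1 * norm (y - p)"
      using dG unfolding has_derivative_within_alt by auto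
    have "open (P t)" using fam unfolding delay_family_def by blast
    then obtain d' where d': "d' > 0" "ball p d' \<subseteq> P t" using p by (rule openE)
    define s where "s = min d d' / (2 * (norm v + 1))"
    have s: "s > 0" using d(1) d'(1) by (simp add: s_def add_nonneg_pos)
    have "s * norm v < s * (norm v + 1)" using s by simp
    also have "\<dots> = min d d' / 2" by (simp add: s_def field_simps add_nonneg_eq_0_iff)
    also have "\<dots> < min d d'" using d(1) d'(1) by linarith
    finally have sv: "s * norm v < min d d'" .
    define y where "y = p + s *\<^sub>R v"
    have y: "norm (y - p) = s * norm v" "E (y - p) = s *\<^sub>R E v" using s linear_scale[OF linE] by (auto simp: y_def)
    have "y \<in> P t" using d'(2) sv y(1) by (auto simp: dist_norm norm_minus_commute)
    then have "norm (F ((\<tau>, t), y) - F ((\<tau>, t), p) - A t (y - p)) \<le> \<delta> * norm (y - p)"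
      using delay_familyD(5)[OF fam \<tau> _ p] by blast
    then have "norm (G y - G p) \<le> \<delta> * norm (y - p)"
      by (simp add: G_def linear_diff[OF lin_A] algebra_simps)
    moreover have "norm (G y - G p - E (y - p)) \<le> e1 * norm (y - p)" using sv y(1) by (intro d(2)) auto
    ultimately have "norm (E (y - p)) \<le> (\<delta> + e1) * norm (y - p)"
      using norm_triangle_sub[of "E (y - p)" "G y - G p"] by (simp add: norm_minus_commute algebra_simps)
    then have "s * norm (E v) \<le> s * ((\<delta> + e1) * norm v)" using y s by (simp add: algebra_simps)
    then have "norm (E v) \<le> (\<delta> + e1) * norm v" using s by simp
    also have "\<dots> \<le> \<delta> * norm v + e"
    proof -
      have "e1 * norm v \<le> e1 * (norm v + 1)" using \<open>e1 > 0\<close> by simp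
      also have "\<dots> = e" by (simp add: e1_def add_nonneg_eq_0_iff)
      finally show ?thesis by (simp add: algebra_simps)
    qed
    finally show ?thesis .
  qed
  then have "norm (E v) \<le> \<delta> * norm v" by (rule field_le_epsilon)
  then show ?thesis by (simp add: E_def D_def p_def)
qed

lemma delay_family_velocity_continuous:
  assumes fam: "delay_family F P w" and cF: "continuous_on (strip \<times> UNIV) F"
  shows "continuous_on strip (\<lambda>(\<sigma>, t). F ((\<sigma>, t), w \<sigma> (t - \<sigma>)))"
proof -
  have "continuous_on strip (\<lambda>z. (fst z, snd z - fst z))" by (intro continuous_intros)
  from continuous_on_compose2[OF delay_family_continuous[OF fam cF] this]
  have "continuous_on strip (\<lambda>z. w (fst z) (snd z - fst z))" by (simp add: image_subset_iff)
  then have "continuous_on strip (\<lambda>z. (z, w (fst z) (snd z - fst z)))" by (intro continuous_intros)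
  from continuous_on_compose2[OF cF this] show ?thesis by (simp add: split_def image_subset_iff)
qed

text \<open>The remainder \<open>w \<sigma> - w \<tau> - (\<sigma> - \<tau>) * w'\<close> satisfies the linearised equation up to an error
  \<open>\<eta> * (\<bar>\<sigma> - \<tau>\<bar> + sup \<bar>w \<sigma> - w \<tau>\<bar>)\<close>, and the a priori estimate absorbs the second summand.\<close>

lemma delay_family_parameter_derivative:
  assumes fam: "delay_family F P w" and C1: "Ck_on (Suc 0) (strip \<times> UNIV) F" and \<tau>: "\<tau> \<in> I"
    and per: "\<And>t. w' (t + 1) = w' t"
    and dw': "\<And>t. (w' has_vector_derivative
      frechet_derivative F (at ((\<tau>, t), w \<tau> (t - \<tau>))) (0, w' (t - \<tau>)) +
      frechet_derivative F (at ((\<tau>, t), w \<tau> (t - \<tau>))) ((1, 0), - F ((\<tau>, t - \<tau>), w \<tau> (t - \<tau> - \<tau>)))) (at t)"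
    and cont': "continuous_on UNIV (\<lambda>t. frechet_derivative F (at ((\<tau>, t), w \<tau> (t - \<tau>))) (0, w' (t - \<tau>)) +
      frechet_derivative F (at ((\<tau>, t), w \<tau> (t - \<tau>))) ((1, 0), - F ((\<tau>, t - \<tau>), w \<tau> (t - \<tau> - \<tau>))))"
  shows "((\<lambda>\<sigma>. w \<sigma> t) has_vector_derivative w' t) (at \<tau>)"
proof -
  have cF: "continuous_on (strip \<times> UNIV) F" using Ck_on_imp_continuous_on[OF C1] .
  define x where "x t = ((\<tau>, t), w \<tau> (t - \<tau>))" for t
  define D where "D t = frechet_derivative F (at (x t))" for t
  define W where "W \<sigma> t = F ((\<sigma>, t), w \<sigma> (t - \<sigma>))" for \<sigma> t
  \<comment> \<open>The formal \<tau>-derivative of \<open>w \<tau> (t - \<tau>)\<close> is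
    \<open>w' (t - \<tau>) - W \<tau> (t - \<tau>)\<close>. The first term gives the linear part;
    the second, together with the explicit dependence of \<open>F\<close> on the delay, gives the
    inhomogeneity \<open>h\<close>.\<close>
  define h where "h t = D t ((1, 0), - W \<tau> (t - \<tau>))" for t
  have dw: "(w \<sigma> has_vector_derivative W \<sigma> t) (at t)" if "\<sigma> \<in> I" for \<sigma> t
    unfolding W_def by (rule delay_familyD(3)[OF fam that])
  have perw: "w \<sigma> (t + 1) = w \<sigma> t" if "\<sigma> \<in> I" for \<sigma> t by (rule delay_familyD(2)[OF fam that])
  have cW: "continuous_on strip (\<lambda>(\<sigma>, t). W \<sigma> t)"
    unfolding W_def by (rule delay_family_velocity_continuous[OF fam cF])
  have cW_t: "continuous_on UNIV (W \<sigma>)" if "\<sigma> \<in> I" for \<sigma>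
  proof -
    have "continuous_on UNIV (\<lambda>t::real. (\<sigma>, t))" by (intro continuous_intros)
    from continuous_on_compose2[OF cW this] show ?thesis using that by (simp add: image_subset_iff)
  qed
  have cw: "continuous_on UNIV (w \<sigma>)" if "\<sigma> \<in> I" for \<sigma>
    by (rule delay_family_continuous_t[OF fam that])
  have dw'': "(w' has_vector_derivative D t (0, w' (t - \<tau>)) + h t) (at t)" for t
    using dw'[of t] by (simp add: D_def h_def W_def x_def)
  have cont'': "continuous_on UNIV (\<lambda>t. D t (0, w' (t - \<tau>)) + h t)"
    using cont' by (simp add: D_def h_def W_def x_def)
  have linD: "linear (D t)" for t
    using Ck_on_has_derivative[OF C1, of "x t"] \<tau> has_derivative_linear by (auto simp: D_def x_def)
  have close: "norm (D t (0, v) - A t v) \<le> \<delta> * norm v" for t v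
    unfolding D_def x_def by (rule delay_family_derivative_close[OF fam C1 \<tau>])
  have D_le: "norm (D t (0, v)) \<le> (a + \<delta>) * norm v" for t v
    using close[of t v] bd_A[of t v] norm_triangle_sub[of "D t (0, v)" "A t v"] by (simp add: algebra_simps)
  obtain M where M: "M \<ge> 0" "\<And>t. norm (W \<tau> t) \<le> M"
    using periodic_attains_sup[of "W \<tau>", OF cW_t[OF \<tau>]
        has_vector_derivative_periodic[where v = "w \<tau>" and v' = "W \<tau>", OF dw[OF \<tau>] perw[OF \<tau>]]]
    by (metis norm_ge_zero)
  have "continuous_on UNIV w'" by (rule has_vector_derivative_imp_continuous_on[OF dw''])
  then obtain N where N: "N \<ge> 0" "\<And>t. norm (w' t) \<le> N"
    using periodic_attains_sup per by (metis norm_ge_zero)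
  have main: "\<exists>r>0. \<forall>\<sigma>. \<bar>\<sigma> - \<tau>\<bar> < r \<longrightarrow> norm (w \<sigma> t - w \<tau> t - (\<sigma> - \<tau>) *\<^sub>R w' t) \<le> e * \<bar>\<sigma> - \<tau>\<bar>"
    if "e > 0" for e t
  proof -
    \<comment> \<open>\<open>Q\<close> collects the coefficients of \<open>\<eta> * s\<close> below,
      whose sum is \<open>Q - 1\<close>. The bounds on \<eta> are then chosen so that the
      \<open>m\<close> term of the a priori estimate can be absorbed by half of \<open>m\<close> and
      what remains is at most \<open>e * s\<close>.\<close>
    define Q where "Q = M + N + a + \<delta> + 3"
    have "Q > 0" using M N a_pos \<delta>_pos by (simp add: Q_def)
    define \<eta> where "\<eta> = min 1 (min (1 / (4 * \<kappa>)) (e / (4 * \<kappa> * Q)))"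
    have \<eta>: "0 < \<eta>" "\<eta> \<le> 1" "\<eta> \<le> 1 / (4 * \<kappa>)" "\<eta> \<le> e / (4 * \<kappa> * Q)"
      using \<open>Q > 0\<close> \<kappa>_pos \<open>e > 0\<close> by (auto simp: \<eta>_def)
    have \<eta>1: "2 * \<kappa> * \<eta> \<le> 1/2" using \<eta>(3) \<kappa>_pos by (simp add: field_simps)
    have \<eta>2: "4 * \<kappa> * \<eta> * Q \<le> e" using \<eta>(4) \<kappa>_pos \<open>Q > 0\<close> by (simp add: field_simps)
    have cx: "continuous_on {0..1} x" unfolding x_def
      by (intro continuous_intros continuous_on_compose2[OF cw[OF \<tau>]]) auto
    have K: "compact (x ` {0..1})" "x ` {0..1} \<subseteq> strip \<times> UNIV"
      using \<tau> compact_continuous_image[OF cx] by (auto simp: x_def)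
    have "\<exists>r>0. \<forall>t\<in>{0..1}. \<forall>y. dist y (x t) < r \<longrightarrow>
       norm (F y - F (x t) - D t (y - x t)) \<le> \<eta> * norm (y - x t)"
    proof (rule uniform_linearization_near_compact[OF open_strip(2) C1 K \<eta>(1)])
      fix r assume r: "0 < r" "\<And>x' y z. x' \<in> x ` {0..1} \<Longrightarrow> dist y x' < r \<Longrightarrow> dist z x' < r \<Longrightarrow>
        norm (F y - F z - frechet_derivative F (at x') (y - z)) \<le> \<eta> * norm (y - z)"
      show ?thesis
      proof (intro exI[of _ r] conjI ballI allI impI)
        fix t y assume "t \<in> {0..1}" "dist y (x t) < r"
        then show "norm (F y - F (x t) - D t (y - x t)) \<le> \<eta> * norm (y - x t)"
          unfolding D_def using r(1) by (intro r(2)) auto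
      qed (rule r(1))
    qed
    then obtain r1 where r1: "r1 > 0" "\<And>t y. t \<in> {0..1} \<Longrightarrow> dist y (x t) < r1 \<Longrightarrow>
       norm (F y - F (x t) - D t (y - x t)) \<le> \<eta> * norm (y - x t)" by meson
    \<comment> \<open>The interval is longer than a period because \<open>W \<tau>\<close> is
      evaluated at the delayed time \<open>t - \<tau>\<close> with \<open>t\<close> in the unit
      interval.\<close>
    have "compact ({\<tau>} \<times> {- \<epsilon>..1 + \<epsilon>})" "{\<tau>} \<times> {- \<epsilon>..1 + \<epsilon>} \<subseteq> strip"
      using \<tau> by (auto intro!: compact_Times)
    from uniformly_near_compact[OF open_strip(1) cW this \<eta>(1)]
    obtain r2 where r2: "r2 > 0" "\<And>x y. x \<in> {\<tau>} \<times> {- \<epsilon>..1 + \<epsilon>} \<Longrightarrow> dist y x < r2 \<Longrightarrow>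
      y \<in> strip \<and> dist ((\<lambda>(\<sigma>, t). W \<sigma> t) y) ((\<lambda>(\<sigma>, t). W \<sigma> t) x) < \<eta>" by metis
    obtain r3 where r3: "0 < r3" "\<And>\<sigma> t. \<bar>\<sigma> - \<tau>\<bar> < r3 \<Longrightarrow> \<sigma> \<in> I \<and> norm (w \<sigma> t - w \<tau> t) \<le> r1 / 2"
      using delay_family_uniformly_continuous[OF fam cF \<tau>, of "r1 / 2"] r1(1) half_gt_zero by metis
    define r where "r = min (r2 / 2) (min r3 (r1 / (2 * (M + 2))))"
    have "r > 0" using r1(1) r2(1) r3(1) M(1) by (simp add: r_def)
    have "norm (w \<sigma> t - w \<tau> t - (\<sigma> - \<tau>) *\<^sub>R w' t) \<le> e * \<bar>\<sigma> - \<tau>\<bar>" if \<sigma>: "\<bar>\<sigma> - \<tau>\<bar> < r" for \<sigma>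
    proof -
      define s where "s = \<bar>\<sigma> - \<tau>\<bar>"
      have s: "0 \<le> s" "2 * s < r2" "s < r3" "(M + 2) * s < r1 / 2"
        using \<sigma> M(1) by (auto simp: r_def s_def field_simps)
      have \<sigma>I: "\<sigma> \<in> I" using r3(2)[of \<sigma>] s by (simp add: s_def)
      define v where "v t = w \<sigma> t - w \<tau> t - (\<sigma> - \<tau>) *\<^sub>R w' t" for t
      define v' where "v' t = W \<sigma> t - W \<tau> t - (\<sigma> - \<tau>) *\<^sub>R (D t (0, w' (t - \<tau>)) + h t)" for t
      have pv: "v (t + 1) = v t" for t using perw \<tau> \<sigma>I per by (simp add: v_def)
      have dv: "(v has_vector_derivative v' t) (at t)" for t
        unfolding v_def v'_def
        by (intro has_vector_derivative_diff dw \<tau> \<sigma>I bounded_linear.has_vector_derivative[OF bounded_linear_scaleR_right] dw'')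
      have cv': "continuous_on UNIV v'"
        unfolding v'_def by (intro continuous_on_diff cW_t \<tau> \<sigma>I continuous_on_scaleR continuous_on_const cont'')
      have "continuous_on UNIV v" by (rule has_vector_derivative_imp_continuous_on[OF dv])
      then obtain t0 where t0: "\<And>t. norm (v t) \<le> norm (v t0)"
        using periodic_attains_sup pv by metis
      define m where "m = norm (v t0)"
      have m: "m \<ge> 0" "\<And>t. norm (v t) \<le> m" using t0 by (auto simp: m_def)
      have "norm (v t0) \<le> 2 * \<kappa> * (\<eta> * (Q * s + m))"
      proof (rule apriori[OF _ pv dv cv'])
        show "\<bar>\<tau>\<bar> \<le> \<epsilon>" using \<tau> by auto
        fix t assume t: "t \<in> {0..1::real}"
        define a' b c where "a' = w \<sigma> (t - \<sigma>)" and "b = w \<sigma> (t - \<tau>)" and "c = w \<tau> (t - \<tau>)"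
        \<comment> \<open>\<rho> is the error in the first-order expansion of
          \<open>w \<sigma>\<close> from \<open>t - \<tau>\<close> to \<open>t - \<sigma>\<close>,
          with the velocity of \<open>w \<tau>\<close> in place of that of
          \<open>w \<sigma>\<close>. Subtracting the linear function leaves derivative
          \<open>W \<sigma> u - W \<tau> (t - \<tau>)\<close>, which is small by continuity of
          \<open>W\<close> alone.\<close>
        define \<rho> where "\<rho> = a' - b + (\<sigma> - \<tau>) *\<^sub>R W \<tau> (t - \<tau>)"
        define y where "y = ((\<sigma>, t), a')"
        have "norm (\<rho>) \<le> \<eta> * s"
        proof -
          have "norm ((w \<sigma> (t - \<sigma>) - (t - \<sigma>) *\<^sub>R W \<tau> (t - \<tau>)) - (w \<sigma> (t - \<tau>) - (t - \<tau>) *\<^sub>R W \<tau> (t - \<tau>)))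
             \<le> \<eta> * \<bar>(t - \<sigma>) - (t - \<tau>)\<bar>"
          proof (rule vector_lipschitz)
            show "((\<lambda>u. w \<sigma> u - u *\<^sub>R W \<tau> (t - \<tau>)) has_vector_derivative W \<sigma> u - W \<tau> (t - \<tau>)) (at u)" for u
              using dw[OF \<sigma>I] by (auto intro!: derivative_eq_intros)
            fix u assume "u \<in> closed_segment (t - \<sigma>) (t - \<tau>)"
            then have "\<bar>u - (t - \<tau>)\<bar> \<le> s" by (auto simp: closed_segment_eq_real_ivl s_def split: if_splits)
            then have "dist (\<sigma>, u) (\<tau>, t - \<tau>) < r2"
              using dist_Pair_le[of \<sigma> u \<tau> "t - \<tau>"] s(2) by (simp add: dist_real_def s_def)
            moreover have "(\<tau>, t - \<tau>) \<in> {\<tau>} \<times> {- \<epsilon>..1 + \<epsilon>}" using t \<tau> by auto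
            ultimately show "norm (W \<sigma> u - W \<tau> (t - \<tau>)) \<le> \<eta>"
              using r2(2)[of "(\<tau>, t - \<tau>)" "(\<sigma>, u)"] by (simp add: dist_norm less_imp_le)
          qed
          moreover have "(w \<sigma> (t - \<sigma>) - (t - \<sigma>) *\<^sub>R W \<tau> (t - \<tau>)) - (w \<sigma> (t - \<tau>) - (t - \<tau>) *\<^sub>R W \<tau> (t - \<tau>)) = \<rho>"
            by (simp add: \<rho>_def a'_def b_def algebra_simps)
          moreover have "\<bar>(t - \<sigma>) - (t - \<tau>)\<bar> = s" by (simp add: s_def)
          ultimately show ?thesis by simp
        qed
        have ab: "norm (a' - b) \<le> (M + 1) * s"
        proof -
          have "norm (a' - b) \<le> norm \<rho> + norm ((\<sigma> - \<tau>) *\<^sub>R W \<tau> (t - \<tau>))"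
            using norm_triangle_ineq4[of \<rho> "(\<sigma> - \<tau>) *\<^sub>R W \<tau> (t - \<tau>)"] by (simp add: \<rho>_def)
          also have "\<dots> \<le> \<eta> * s + s * M"
            using \<open>norm \<rho> \<le> \<eta> * s\<close> M(2) by (intro add_mono) (auto simp: s_def intro: mult_left_mono)
          also have "\<eta> * s \<le> 1 * s" using \<eta>(2) s(1) by (intro mult_right_mono)
          finally show ?thesis by (simp add: algebra_simps)
        qed
        have bc: "b - c = v (t - \<tau>) + (\<sigma> - \<tau>) *\<^sub>R w' (t - \<tau>)" by (simp add: v_def b_def c_def)
        have bc_le: "norm (b - c) \<le> m + s * N"
          unfolding bc using m(2) N(2) by (intro norm_triangle_mono) (auto simp: s_def intro: mult_left_mono)
        have yx: "y - x t = ((\<sigma> - \<tau>, 0), (a' - b) + (b - c))" by (simp add: y_def x_def c_def)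
        have yx_le: "norm (y - x t) \<le> s + (norm (a' - b) + norm (b - c))"
          unfolding yx using norm_Pair_le[of "(\<sigma> - \<tau>, 0::real)" "(a' - b) + (b - c)"] norm_triangle_ineq[of "a' - b" "b - c"]
          by (simp add: norm_Pair s_def)
        have "norm (b - c) \<le> r1 / 2" using r3(2)[of \<sigma> "t - \<tau>"] s(3) by (simp add: b_def c_def s_def)
        then have "norm (y - x t) < r1" using yx_le ab s(4) by (simp add: algebra_simps)
        then have lin: "norm (F y - F (x t) - D t (y - x t)) \<le> \<eta> * norm (y - x t)"
          using r1(2)[OF t, of y] by (simp add: dist_norm)
        \<comment> \<open>The increment is split into the direction defining \<open>h\<close>, the
          error \<rho>, the remainder \<open>v\<close> to be estimated, and the direction belonging
          to \<open>w'\<close>; after applying \<open>D t\<close>, the first and last cancel against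
          the corresponding terms of \<open>v'\<close>.\<close>
        have e1: "y - x t = (\<sigma> - \<tau>) *\<^sub>R ((1, 0), - W \<tau> (t - \<tau>)) + (0, \<rho>) + (0, v (t - \<tau>)) + (\<sigma> - \<tau>) *\<^sub>R (0, w' (t - \<tau>))"
          unfolding yx bc \<rho>_def by (simp add: zero_prod_def algebra_simps)
        have "D t (y - x t) = (\<sigma> - \<tau>) *\<^sub>R h t + D t (0, \<rho>) + D t (0, v (t - \<tau>)) + (\<sigma> - \<tau>) *\<^sub>R D t (0, w' (t - \<tau>))"
          unfolding e1 h_def by (simp only: linear_add[OF linD] linear_scale[OF linD])
        moreover have "W \<sigma> t = F y" "W \<tau> t = F (x t)" by (simp_all add: W_def y_def x_def a'_def)
        ultimately have "v' t - A t (v (t - \<tau>)) =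
          (D t (0, v (t - \<tau>)) - A t (v (t - \<tau>))) + ((F y - F (x t) - D t (y - x t)) + D t (0, \<rho>))"
          unfolding v'_def by (simp add: algebra_simps)
        also have "norm \<dots> \<le> \<delta> * norm (v (t - \<tau>)) + (\<eta> * norm (y - x t) + (a + \<delta>) * norm \<rho>)"
          by (intro norm_triangle_mono close lin D_le)
        also have "\<dots> \<le> \<delta> * norm (v (t - \<tau>)) + (\<eta> * (s + ((M + 1) * s + (m + s * N))) + (a + \<delta>) * (\<eta> * s))"
          using yx_le ab bc_le \<open>norm \<rho> \<le> \<eta> * s\<close> \<eta>(1) a_pos \<delta>_pos
          by (intro add_left_mono add_mono mult_left_mono) auto
        also have "\<dots> \<le> \<delta> * norm (v (t - \<tau>)) + \<eta> * (Q * s + m)"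
        proof -
          have "\<eta> * (Q * s + m) - (\<eta> * (s + ((M + 1) * s + (m + s * N))) + (a + \<delta>) * (\<eta> * s)) = \<eta> * s"
            by (simp add: Q_def algebra_simps)
          then show ?thesis using \<eta>(1) s(1) by (smt (verit) mult_nonneg_nonneg)
        qed
        finally show "norm (v' t - A t (v (t - \<tau>))) \<le> \<delta> * norm (v (t - \<tau>)) + \<eta> * (Q * s + m)" .
      qed
      then have "m \<le> 2 * \<kappa> * \<eta> * (Q * s) + 2 * \<kappa> * \<eta> * m" by (simp add: m_def algebra_simps)
      also have "2 * \<kappa> * \<eta> * m \<le> 1/2 * m" using \<eta>1 m(1) by (rule mult_right_mono)
      finally have "m \<le> (4 * \<kappa> * \<eta> * Q) * s" by simp
      also have "\<dots> \<le> e * s" using \<eta>2 s(1) by (rule mult_right_mono)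
      finally show ?thesis using m(2)[of t] by (simp add: v_def s_def)
    qed
    with \<open>r > 0\<close> show ?thesis by blast
  qed
  show ?thesis
    unfolding has_vector_derivative_def has_derivative_within_alt
    using main by (auto intro: bounded_linear_scaleR_left)
qed

text \<open>The induction hypothesis is used twice, hence the generality in \<open>F\<close>,
  \<open>P\<close> and \<open>w\<close>: for \<open>w\<close> itself, so that the coefficients of
  \<open>F1\<close>, which contain \<open>w\<close>, are of class \<open>C^k\<close>; and for the
  family \<open>w1\<close> with right-hand side \<open>F1\<close> and no restriction on position,
  the equation being affine. No derivative in \<tau> is presupposed: \<open>w1\<close> is first
  constructed as the solution of the formally differentiated equation and only then recognised as
  that derivative.\<close>

lemma delay_family_Ck_on:
  "delay_family F P w \<Longrightarrow> Ck_on k (strip \<times> UNIV) F \<Longrightarrow> Ck_on k strip (\<lambda>z. w (fst z) (snd z))"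
proof (induction k arbitrary: F P w)
  case 0
  then show ?case using delay_family_continuous by simp
next
  case (Suc k)
  note fam = Suc.prems(1) and CF = Suc.prems(2)
  note op = open_strip(1) and op2 = open_strip(2)
  have C1: "Ck_on (Suc 0) (strip \<times> UNIV) F" by (rule Ck_on_mono[OF CF]) simp
  have CFk: "Ck_on k (strip \<times> UNIV) F" by (rule Ck_on_Suc_imp[OF CF])
  have Cw: "Ck_on k strip (\<lambda>z. w (fst z) (snd z))" by (rule Suc.IH[OF fam CFk])
  let ?D = "\<lambda>y. frechet_derivative F (at y)"
  define sh where "sh z = (fst z, snd z - fst z)" for z :: "real \<times> real"
  have Csh: "Ck_on k strip sh"
    unfolding sh_def[abs_def]
    by (intro Ck_on_linear op bounded_linear_Pair bounded_linear_fst bounded_linear_sub bounded_linear_snd)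
  have sh: "sh ` strip \<subseteq> strip" by (auto simp: sh_def)
  define Y where "Y z = (z, w (fst (sh z)) (snd (sh z)))" for z
  have CY: "Ck_on k strip Y"
    unfolding Y_def[abs_def]
    by (intro Ck_on_Pair op Ck_on_linear bounded_linear_ident Ck_on_compose[OF op op Cw Csh sh])
  have Y: "Y ` strip \<subseteq> strip \<times> UNIV" by (auto simp: Y_def)
  define W where "W z = F (Y z)" for z
  have CW: "Ck_on k strip W"
    unfolding W_def[abs_def] by (rule Ck_on_compose[OF op op2 CFk CY Y])
  define h where "h z = ?D (Y z) ((1, 0), - W (sh z))" for z
  have Ch: "Ck_on k strip h"
    unfolding h_def[abs_def]
    by (intro Ck_on_frechet_derivative_apply[OF op op2 CF CY Y] Ck_on_Pair op Ck_on_const Ck_on_uminus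
        Ck_on_compose[OF op op CW Csh sh])
  \<comment> \<open>Only one derivative of \<open>F\<close> occurs, taken along \<open>Y\<close>. So
    \<open>F1\<close> is of class \<open>C^k\<close> although \<open>Y\<close> has no more than that
    regularity, since \<open>F\<close> has one order to spare.\<close>
  define F1 where "F1 y = ?D (Y (fst y)) (0, snd y) + h (fst y)" for y :: "(real \<times> real) \<times> 'a"
  have CF1: "Ck_on k (strip \<times> UNIV) F1"
  proof -
    have f: "Ck_on k (strip \<times> (UNIV :: 'a set)) fst" "fst ` (strip \<times> (UNIV :: 'a set)) \<subseteq> strip"
      by (auto intro!: Ck_on_linear op2 bounded_linear_fst)
    have "Ck_on k (strip \<times> (UNIV :: 'a set)) (\<lambda>y. (0 :: real \<times> real, snd y))"
      by (intro Ck_on_linear op2 bounded_linear_Pair bounded_linear_zero bounded_linear_snd)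
    moreover have "(\<lambda>y. Y (fst y)) ` (strip \<times> (UNIV :: 'a set)) \<subseteq> strip \<times> UNIV"
      by (auto simp: Y_def)
    ultimately show ?thesis
      unfolding F1_def[abs_def]
      by (intro Ck_on_add op2 Ck_on_frechet_derivative_apply[OF op2 op2 CF] Ck_on_compose[OF op2 op CY f]
          Ck_on_compose[OF op2 op Ch f])
  qed
  have linD: "linear (?D (Y z))" if "z \<in> strip" for z
    using Ck_on_has_derivative[OF C1, of "Y z"] that Y has_derivative_linear by blast
  have perY: "Y (\<tau>, t + 1) = Y (\<tau>, t) + ((0, 1), 0)" if "\<tau> \<in> I" for \<tau> t
    using delay_familyD(2)[OF fam that, of "t - \<tau>"] by (simp add: Y_def sh_def algebra_simps)
  have perD: "?D (Y (\<tau>, t + 1)) = ?D (Y (\<tau>, t))" if "\<tau> \<in> I" for \<tau> t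
    unfolding perY[OF that]
  proof (rule frechet_derivative_periodic[OF op2])
    show "Y (\<tau>, t) \<in> strip \<times> UNIV" using that by (auto simp: Y_def)
    show "F (y + ((0, 1), 0)) = F y" if "y \<in> strip \<times> UNIV" for y
      using that delay_familyD(1)[OF fam] by auto
  qed
  have perW: "W (\<tau>, t + 1) = W (\<tau>, t)" if "\<tau> \<in> I" for \<tau> t
    unfolding W_def perY[OF that] using delay_familyD(1)[OF fam that] by (simp add: Y_def)
  have perh: "h (\<tau>, t + 1) = h (\<tau>, t)" if "\<tau> \<in> I" for \<tau> t
  proof -
    have "t + 1 - \<tau> = (t - \<tau>) + 1" by simp
    then show ?thesis by (simp only: h_def perD[OF that] sh_def fst_conv snd_conv perW[OF that])
  qed
  have close: "norm (?D (Y (\<tau>, t)) (0, v) - A t v) \<le> \<delta> * norm v" if "\<tau> \<in> I" for \<tau> t v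
    using delay_family_derivative_close[OF fam C1 that] by (simp add: Y_def sh_def)
  have D_diff: "?D (Y (\<tau>, t)) (0, p) - ?D (Y (\<tau>, t)) (0, q) = ?D (Y (\<tau>, t)) (0, p - q)" if "\<tau> \<in> I" for \<tau> t p q
    using linear_diff[OF linD, of "(\<tau>, t)" "(0, p)" "(0, q)"] that by simp
  have cF1: "continuous_on UNIV (\<lambda>(t, p). F1 ((\<tau>, t), p))" if "\<tau> \<in> I" for \<tau>
  proof -
    have "continuous_on UNIV (\<lambda>y::real \<times> 'a. ((\<tau>, fst y), snd y))" by (intro continuous_intros)
    from continuous_on_compose2[OF Ck_on_imp_continuous_on[OF CF1] this] that
    show ?thesis by (simp add: split_def image_subset_iff)
  qed
  have ch: "continuous_on UNIV (\<lambda>t. h (\<tau>, t))" if "\<tau> \<in> I" for \<tau>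
  proof -
    have "continuous_on UNIV (\<lambda>t::real. (\<tau>, t))" by (intro continuous_intros)
    from continuous_on_compose2[OF Ck_on_imp_continuous_on[OF Ch] this] that
    show ?thesis by (simp add: image_subset_iff)
  qed
  have cF1_comp: "continuous_on UNIV (\<lambda>t. F1 ((\<tau>, t), f t))" if "\<tau> \<in> I" "continuous_on UNIV f" for \<tau> f
  proof -
    have "continuous_on UNIV (\<lambda>t. (t, f t))" by (intro continuous_intros that)
    from continuous_on_compose2[OF cF1[OF that(1)] this] show ?thesis by simp
  qed
  have "\<exists>v. (\<forall>t. v (t + 1) = v t) \<and> (\<forall>t. (v has_vector_derivative F1 ((\<tau>, t), v (t - \<tau>))) (at t))"
    if \<tau>: "\<tau> \<in> I" for \<tau>
  proof -
    obtain t0 where t0: "\<And>t. norm (h (\<tau>, t)) \<le> norm (h (\<tau>, t0))"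
      using periodic_attains_sup[of "\<lambda>t. h (\<tau>, t)", OF ch[OF \<tau>] perh[OF \<tau>]] by blast
    define R where "R = 2 * \<kappa> * (norm (h (\<tau>, t0)) + 1)"
    have "R > 0" using \<kappa>_pos by (simp add: R_def add_nonneg_pos)
    have "\<exists>v. (\<forall>t. v (t + 1) = v t) \<and> (\<forall>t. (v has_vector_derivative F1 ((\<tau>, t), v (t - \<tau>))) (at t)) \<and>
      (\<forall>t. norm (v t) \<le> R)"
    proof (rule delay_exists[where \<Phi> = "\<lambda>t p. F1 ((\<tau>, t), p)", OF _ \<open>R > 0\<close> cF1[OF \<tau>]])
      show "\<bar>\<tau>\<bar> \<le> \<epsilon>" using \<tau> by auto
      show "(\<lambda>p. F1 ((\<tau>, t + 1), p)) = (\<lambda>p. F1 ((\<tau>, t), p))" for t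
        by (simp add: F1_def perD[OF \<tau>] perh[OF \<tau>])
      show "norm (F1 ((\<tau>, t), p) - F1 ((\<tau>, t), q) - A t (p - q)) \<le> \<delta> * norm (p - q)" for t p q
        using close[OF \<tau>, of t "p - q"] by (simp add: F1_def D_diff[OF \<tau>])
      have "norm (h (\<tau>, t)) \<le> R / (2 * \<kappa>)" for t
        using t0[of t] \<kappa>_pos by (simp add: R_def)
      then show "norm (F1 ((\<tau>, t), 0)) \<le> R / (2 * \<kappa>)" for t
        using linear_0[OF linD, of "(\<tau>, t)"] \<tau> by (simp add: F1_def zero_prod_def)
    qed
    then show ?thesis by blast
  qed
  then obtain w1 where perw1: "\<And>\<tau> t. \<tau> \<in> I \<Longrightarrow> w1 \<tau> (t + 1) = w1 \<tau> t"
    and dw1: "\<And>\<tau> t. \<tau> \<in> I \<Longrightarrow> (w1 \<tau> has_vector_derivative F1 ((\<tau>, t), w1 \<tau> (t - \<tau>))) (at t)"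
    by metis
  have cw1: "continuous_on UNIV (\<lambda>t. w1 \<tau> (t - \<tau>))" if "\<tau> \<in> I" for \<tau>
  proof -
    have "continuous_on UNIV (w1 \<tau>)"
      by (rule has_vector_derivative_imp_continuous_on[OF dw1[OF that]])
    then show ?thesis by (rule continuous_on_compose2) (auto intro!: continuous_intros)
  qed
  have w1_le: "norm (w1 \<tau> t) \<le> 2 * \<kappa> * H" if \<tau>: "\<tau> \<in> I" and H: "\<And>t. t \<in> {0..1} \<Longrightarrow> norm (h (\<tau>, t)) \<le> H" for \<tau> t H
  proof (rule apriori[OF _ perw1[OF \<tau>] dw1[OF \<tau>] cF1_comp[OF \<tau> cw1[OF \<tau>]]])
    show "\<bar>\<tau>\<bar> \<le> \<epsilon>" using \<tau> by auto
    fix t assume t: "t \<in> {0..1::real}"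
    have "norm ((?D (Y (\<tau>, t)) (0, w1 \<tau> (t - \<tau>)) - A t (w1 \<tau> (t - \<tau>))) + h (\<tau>, t)) \<le> \<delta> * norm (w1 \<tau> (t - \<tau>)) + H"
      by (intro norm_triangle_mono close \<tau> H t)
    then show "norm (F1 ((\<tau>, t), w1 \<tau> (t - \<tau>)) - A t (w1 \<tau> (t - \<tau>))) \<le> \<delta> * norm (w1 \<tau> (t - \<tau>)) + H"
      by (simp add: F1_def algebra_simps)
  qed
  have "delay_family F1 (\<lambda>_. UNIV) w1"
    unfolding delay_family_def
  proof (intro conjI ballI allI)
    fix \<tau> assume \<tau>: "\<tau> \<in> I"
    show "F1 ((\<tau>, t + 1), p) = F1 ((\<tau>, t), p)" for t p
      by (simp add: F1_def perD[OF \<tau>] perh[OF \<tau>])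
    show "norm (F1 ((\<tau>, t), p) - F1 ((\<tau>, t), q) - A t (p - q)) \<le> \<delta> * norm (p - q)" for t p q
      using close[OF \<tau>, of t "p - q"] by (simp add: F1_def D_diff[OF \<tau>])
    have K: "compact ({\<tau>} \<times> {0..1::real})" "{\<tau>} \<times> {0..1} \<subseteq> strip" using \<tau> by (auto intro!: compact_Times)
    obtain r where r: "r > 0" "\<And>x y. x \<in> {\<tau>} \<times> {0..1} \<Longrightarrow> dist y x < r \<Longrightarrow> y \<in> strip \<and> dist (h y) (h x) < 1"
      using uniformly_near_compact[OF op Ck_on_imp_continuous_on[OF Ch] K zero_less_one] by metis
    obtain t0 where t0: "\<And>t. norm (h (\<tau>, t)) \<le> norm (h (\<tau>, t0))"
      using periodic_attains_sup[of "\<lambda>t. h (\<tau>, t)", OF ch[OF \<tau>] perh[OF \<tau>]] by blast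
    have "norm (w1 \<sigma> t) \<le> 2 * \<kappa> * (norm (h (\<tau>, t0)) + 1)" if "\<sigma> \<in> I" "\<bar>\<sigma> - \<tau>\<bar> < r" for \<sigma> t
    proof (rule w1_le[OF that(1)])
      fix t assume "t \<in> {0..1::real}"
      then have "dist (h (\<sigma>, t)) (h (\<tau>, t)) < 1"
        using r(2)[of "(\<tau>, t)" "(\<sigma>, t)"] that(2) by (simp add: dist_Pair_Pair dist_real_def)
      then show "norm (h (\<sigma>, t)) \<le> norm (h (\<tau>, t0)) + 1"
        using t0[of t] norm_triangle_sub[of "h (\<sigma>, t)" "h (\<tau>, t)"] by (simp add: dist_norm)
    qed
    then show "\<exists>r>0. \<exists>M. \<forall>\<sigma>\<in>I. \<bar>\<sigma> - \<tau>\<bar> < r \<longrightarrow> (\<forall>t. norm (w1 \<sigma> t) \<le> M)"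
      using r(1) by blast
  qed (use perw1 dw1 in auto)
  from Suc.IH[OF this CF1] have Cw1: "Ck_on k strip (\<lambda>z. w1 (fst z) (snd z))" .
  have d\<tau>: "((\<lambda>\<sigma>. w \<sigma> t) has_vector_derivative w1 \<tau> t) (at \<tau>)" if \<tau>: "\<tau> \<in> I" for \<tau> t
  proof (rule delay_family_parameter_derivative[where w' = "w1 \<tau>", OF fam C1 \<tau> perw1[OF \<tau>]])
    have eq: "frechet_derivative F (at ((\<tau>, t), w \<tau> (t - \<tau>))) (0, w1 \<tau> (t - \<tau>)) +
      frechet_derivative F (at ((\<tau>, t), w \<tau> (t - \<tau>))) ((1, 0), - F ((\<tau>, t - \<tau>), w \<tau> (t - \<tau> - \<tau>)))
      = F1 ((\<tau>, t), w1 \<tau> (t - \<tau>))" for t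
      by (simp add: F1_def h_def W_def Y_def sh_def)
    show "(w1 \<tau> has_vector_derivative frechet_derivative F (at ((\<tau>, t), w \<tau> (t - \<tau>))) (0, w1 \<tau> (t - \<tau>)) +
      frechet_derivative F (at ((\<tau>, t), w \<tau> (t - \<tau>))) ((1, 0), - F ((\<tau>, t - \<tau>), w \<tau> (t - \<tau> - \<tau>)))) (at t)" for t
      unfolding eq by (rule dw1[OF \<tau>])
    show "continuous_on UNIV (\<lambda>t. frechet_derivative F (at ((\<tau>, t), w \<tau> (t - \<tau>))) (0, w1 \<tau> (t - \<tau>)) +
      frechet_derivative F (at ((\<tau>, t), w \<tau> (t - \<tau>))) ((1, 0), - F ((\<tau>, t - \<tau>), w \<tau> (t - \<tau> - \<tau>))))"
      unfolding eq by (rule cF1_comp[OF \<tau> cw1[OF \<tau>]])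
  qed
  have dt: "(w \<tau> has_vector_derivative W (\<tau>, t)) (at t)" if "\<tau> \<in> I" for \<tau> t
    using delay_familyD(3)[OF fam that] by (simp add: W_def Y_def sh_def)
  show ?case
    by (rule Ck_on_partialsI[where ?f1.0 = "\<lambda>z. w1 (fst z) (snd z)" and ?f2.0 = W])
      (use d\<tau> dt Cw1 CW in auto)
qed

end

section \<open>Sobolev norms on the circle\<close>

definition logistic :: "real \<Rightarrow> real" where "logistic x = 1 / (1 + exp (- x))"

text \<open>The function solves \<open>y' = y - y^2\<close>, so its derivative is a polynomial in
  itself and the induction closes.\<close>

lemma Ck_on_logistic: "Ck_on k UNIV logistic"
proof (induction k)
  case 0
  show ?case unfolding Ck_on.simps logistic_def[abs_def]
    by (intro continuous_intros) (simp add: add_pos_pos less_imp_neq[symmetric] add_nonneg_eq_0_iff)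
next
  case (Suc k)
  show ?case
  proof (rule Ck_on_has_vector_derivativeI)
    fix x :: real
    have nz: "1 + exp (- x) > 0" by (simp add: add_pos_pos)
    have "(logistic has_real_derivative (exp (- x) / (1 + exp (- x))\<^sup>2)) (at x)"
      unfolding logistic_def[abs_def]
      using nz by (auto intro!: derivative_eq_intros simp: power2_eq_square)
    also have "exp (- x) / (1 + exp (- x))\<^sup>2 = logistic x - logistic x *\<^sub>R logistic x"
    proof -
      define y where "y = 1 + exp (- x)"
      have "exp (- x) = y - 1" "y \<noteq> 0" using nz by (auto simp: y_def)
      then show ?thesis by (simp add: logistic_def power2_eq_square diff_divide_distrib)
    qed
    finally show "(logistic has_vector_derivative logistic x - logistic x *\<^sub>R logistic x) (at x)"
      by (simp add: has_real_derivative_iff_has_vector_derivative)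
  qed (intro Ck_on_diff Ck_on_scaleR Suc open_UNIV)+
qed

lemma Ck_on_cos_sin: "Ck_on k UNIV (\<lambda>t::real. cos (c * t + d)) \<and> Ck_on k UNIV (\<lambda>t::real. sin (c * t + d))"
proof (induction k)
  case 0
  show ?case by (auto intro!: continuous_intros)
next
  case (Suc k)
  have "Ck_on (Suc k) UNIV (\<lambda>t::real. cos (c * t + d))"
  proof (rule Ck_on_has_vector_derivativeI)
    show "((\<lambda>t. cos (c * t + d)) has_vector_derivative (- c) *\<^sub>R sin (c * t + d)) (at t)" for t
      by (auto intro!: derivative_eq_intros simp flip: has_real_derivative_iff_has_vector_derivative)
    show "Ck_on k UNIV (\<lambda>t. (- c) *\<^sub>R sin (c * t + d))"
      using Suc by (intro Ck_on_compose_linear[OF _ bounded_linear_scaleR_right]) auto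
  qed auto
  moreover have "Ck_on (Suc k) UNIV (\<lambda>t::real. sin (c * t + d))"
  proof (rule Ck_on_has_vector_derivativeI)
    show "((\<lambda>t. sin (c * t + d)) has_vector_derivative c *\<^sub>R cos (c * t + d)) (at t)" for t
      by (auto intro!: derivative_eq_intros simp flip: has_real_derivative_iff_has_vector_derivative)
    show "Ck_on k UNIV (\<lambda>t. c *\<^sub>R cos (c * t + d))"
      using Suc by (intro Ck_on_compose_linear[OF _ bounded_linear_scaleR_right]) auto
  qed auto
  ultimately show ?case by blast
qed

text \<open>For \<open>0 \<le> \<rho> \<le> 1/2\<close> the cosine difference is positive exactly at
  distance less than \<rho> from \<open>m\<close> on the circle. Steepening it by \<open>n\<close>
  inside \<open>logistic\<close> gives smooth periodic approximations of the indicator of that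
  arc.\<close>

definition arc_cutoff :: "real \<Rightarrow> real \<Rightarrow> nat \<Rightarrow> real \<Rightarrow> real" where
  "arc_cutoff m \<rho> n t = logistic (real n * (cos (2 * pi * (t - m)) - cos (2 * pi * \<rho>)))"

lemma smooth_arc_cutoff: "smooth_map (arc_cutoff m \<rho> n)"
proof -
  have "Ck_on k UNIV (arc_cutoff m \<rho> n)" for k
  proof -
    have "Ck_on k UNIV (\<lambda>t. real n *\<^sub>R (cos (2 * pi * t + (- 2 * pi * m)) - cos (2 * pi * \<rho>)))"
      by (intro Ck_on_compose_linear[OF _ bounded_linear_scaleR_right] Ck_on_diff Ck_on_const open_UNIV
          conjunct1[OF Ck_on_cos_sin])
    from Ck_on_compose[OF open_UNIV open_UNIV Ck_on_logistic this subset_UNIV]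
    show ?thesis by (simp add: arc_cutoff_def[abs_def] algebra_simps)
  qed
  then show ?thesis by (simp add: smooth_map_def Ck_on_UNIV)
qed

lemma periodic_arc_cutoff: "periodic_fun_simple' (arc_cutoff m \<rho> n)"
proof
  fix t
  have "cos (2 * pi * (t + 1 - m)) = cos (2 * pi * (t - m) + 2 * pi)" by (simp add: algebra_simps)
  then show "arc_cutoff m \<rho> n (t + 1) = arc_cutoff m \<rho> n t" by (simp add: arc_cutoff_def)
qed

lemma logistic_bounds: "0 < logistic x" "logistic x < 1"
  by (auto simp: logistic_def add_pos_pos)

lemma logistic_tendsto_1:
  assumes "0 < s" shows "(\<lambda>n. logistic (real n * s)) \<longlonglongrightarrow> 1"
proof -
  have "filterlim (\<lambda>n. real n * s) at_top sequentially"
    using filterlim_tendsto_pos_mult_at_top[OF tendsto_const assms filterlim_real_sequentially]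
    by (simp add: mult.commute)
  then have "(\<lambda>n. exp (- (real n * s))) \<longlonglongrightarrow> 0"
    by (intro filterlim_compose[OF exp_at_bot] filterlim_compose[OF filterlim_uminus_at_bot_at_top])
  from tendsto_divide[OF tendsto_const tendsto_add[OF tendsto_const this], of 1 1]
  show ?thesis by (simp add: logistic_def)
qed

lemma logistic_minus: "logistic (- x) = 1 - logistic x"
proof -
  have "1 + exp x \<noteq> 0" "1 + exp (- x) \<noteq> 0" using exp_gt_zero[of x] exp_gt_zero[of "- x"] by linarith+
  moreover have "exp x * exp (- x) = 1" by (simp flip: exp_add)
  ultimately show ?thesis by (simp add: logistic_def field_simps)
qed

lemma logistic_tendsto_0:
  assumes "s < 0" shows "(\<lambda>n. logistic (real n * s)) \<longlonglongrightarrow> 0"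
proof -
  have "(\<lambda>n. 1 - logistic (real n * (- s))) \<longlonglongrightarrow> 1 - 1"
    using assms by (intro tendsto_diff tendsto_const logistic_tendsto_1) simp
  then show ?thesis using logistic_minus[of "real n * (- s)" for n] by simp
qed

text \<open>Only the sign of the cosine difference matters; beyond half a turn the distance is
  measured the other way round the circle. At the ends of the arc the value stays 1/2, so these are
  excluded, and likewise 0 and 1, which are one point of the circle: one of them may coincide with
  an end of the arc represented by the other.\<close>

lemma arc_cutoff_tendsto:
  assumes "0 \<le> \<alpha>" "\<alpha> \<le> \<beta>" "\<beta> \<le> 1" "\<beta> - \<alpha> < 1" "t \<in> {0..1}" "t \<notin> {0, 1, \<alpha>, \<beta>}"
  shows "(\<lambda>n. arc_cutoff ((\<alpha> + \<beta>) / 2) ((\<beta> - \<alpha>) / 2) n t) \<longlonglongrightarrow> indicator {\<alpha>..\<beta>} t"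
proof -
  define m \<rho> where "m = (\<alpha> + \<beta>) / 2" and "\<rho> = (\<beta> - \<alpha>) / 2"
  have cos_abs: "cos (2 * pi * (t - m)) = cos (2 * pi * \<bar>t - m\<bar>)"
    using cos_abs_real[of "2 * pi * (t - m)"] by (simp add: abs_mult)
  have \<rho>: "0 \<le> \<rho>" "2 * \<rho> < 1" using assms by (auto simp: \<rho>_def)
  show ?thesis
  proof (cases "t \<in> {\<alpha>..\<beta>}")
    case True
    then have "\<bar>t - m\<bar> < \<rho>" using assms by (auto simp: m_def \<rho>_def abs_if field_simps)
    then have "cos (2 * pi * \<rho>) < cos (2 * pi * \<bar>t - m\<bar>)"
      using \<rho> by (intro cos_monotone_0_pi) (auto simp: field_simps)
    then show ?thesis using True cos_abs logistic_tendsto_1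
      by (simp add: arc_cutoff_def m_def[symmetric] \<rho>_def[symmetric])
  next
    case False
    then have x: "\<rho> < \<bar>t - m\<bar>" "\<bar>t - m\<bar> < 1 - \<rho>" using assms by (auto simp: m_def \<rho>_def abs_if field_simps)
    have "cos (2 * pi * \<bar>t - m\<bar>) < cos (2 * pi * \<rho>)"
    proof (cases "2 * \<bar>t - m\<bar> \<le> 1")
      case True
      then show ?thesis using x \<rho> by (intro cos_monotone_0_pi) (auto simp: field_simps)
    next
      case False
      have "cos (2 * pi * \<bar>t - m\<bar>) = cos (2 * pi * (1 - \<bar>t - m\<bar>))"
        using cos_2pi_minus[of "2 * pi * \<bar>t - m\<bar>"] by (simp add: algebra_simps)
      also have "\<dots> < cos (2 * pi * \<rho>)"
      proof (rule cos_monotone_0_pi)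
        show "2 * pi * \<rho> < 2 * pi * (1 - \<bar>t - m\<bar>)" using x by simp
        show "2 * pi * (1 - \<bar>t - m\<bar>) \<le> pi"
          using mult_left_mono[of "1 - \<bar>t - m\<bar>" "1/2" "2 * pi"] False by simp
      qed (use \<rho> in simp)
      finally show ?thesis .
    qed
    then show ?thesis using False cos_abs logistic_tendsto_0
      by (simp add: arc_cutoff_def m_def[symmetric] \<rho>_def[symmetric])
  qed
qed

lemma smooth_map_continuous_on: "smooth_map f \<Longrightarrow> continuous_on S f"
  using Ck_on_imp_continuous_on[of 0 UNIV f] continuous_on_subset[of UNIV f S]
  by (auto simp: smooth_map_def Ck_on_UNIV)

lemma smooth_map_const: "smooth_map (\<lambda>x. c)"
  by (simp add: smooth_map_def Ck_on_const flip: Ck_on_UNIV)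

lemma sigma_finite_lebesgue: "sigma_finite_measure (lebesgue :: 'a::euclidean_space measure)"
proof
  obtain \<A> where \<A>: "countable \<A>" "\<A> \<subseteq> sets (lborel :: 'a measure)" "\<Union>\<A> = space lborel"
    "\<forall>a\<in>\<A>. emeasure lborel a \<noteq> \<infinity>"
    using lborel.sigma_finite_countable by blast
  have "emeasure lebesgue a = emeasure lborel a" if "a \<in> \<A>" for a
  proof -
    have "a \<in> sets lborel" using \<A>(2) that by blast
    then show ?thesis by simp
  qed
  then show "\<exists>\<A>. countable \<A> \<and> \<A> \<subseteq> sets (lebesgue :: 'a measure) \<and> \<Union>\<A> = space lebesgue \<and>
      (\<forall>a\<in>\<A>. emeasure lebesgue a \<noteq> \<infinity>)"
    using \<A> by (intro exI[of _ \<A>]) auto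
qed

text \<open>By dominated convergence the cutoffs turn the hypothesis into vanishing integrals over
  intervals. Complements and disjoint unions extend this to Borel sets, and a Lebesgue set differs
  from a Borel set by a null set; an integrable function with all these integrals zero vanishes
  almost everywhere.\<close>

lemma du_Bois_Reymond_circle:
  fixes d :: "real \<Rightarrow> 'a::euclidean_space"
  assumes int: "set_integrable lebesgue {0..1} d"
    and zero: "\<And>\<phi> :: real \<Rightarrow> real. periodic_fun_simple' \<phi> \<Longrightarrow> smooth_map \<phi> \<Longrightarrow>
      (LINT t:{0..1}|lebesgue. \<phi> t *\<^sub>R d t) = 0"
  shows "AE t in lebesgue. t \<in> {0..1} \<longrightarrow> d t = 0"
proof -
  define f where "f t = indicator {0..1} t *\<^sub>R d t" for t :: real
  have intf: "integrable lebesgue f" using int by (simp add: f_def[abs_def] set_integrable_def)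
  have [measurable]: "f \<in> borel_measurable lebesgue" using intf by auto
  have zero_f: "(LINT t|lebesgue. \<phi> t *\<^sub>R f t) = 0"
    if "periodic_fun_simple' \<phi>" "smooth_map \<phi>" for \<phi> :: "real \<Rightarrow> real"
    using zero[OF that] by (simp add: f_def set_lebesgue_integral_def mult.commute)
  have one: "(LINT t|lebesgue. f t) = 0"
    using zero_f[of "\<lambda>_. 1"] smooth_map_const[of 1] by (simp add: periodic_fun_simple'_def)
  have intA: "set_integrable lebesgue A f" if "A \<in> sets lebesgue" for A
    using intf that by (simp add: set_integrable_def integrable_mult_indicator)
  have AE_neq: "AE t in lebesgue. t \<noteq> c" for c :: real
    by (rule AE_I[where N = "{c}"]) auto
  have borel: "(LINT t:A|lebesgue. f t) = 0" if "A \<in> sets borel" for A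
    using that
  proof (induction rule: borel_set_induct)
    case empty
    show ?case by (simp add: set_lebesgue_integral_def)
  next
    case (interval a b)
    define \<alpha> \<beta> where "\<alpha> = max a 0" and "\<beta> = min b 1"
    have ind: "indicator {a..b} t *\<^sub>R f t = indicator {\<alpha>..\<beta>} t *\<^sub>R f t" for t
      by (auto simp: f_def \<alpha>_def \<beta>_def indicator_def)
    \<comment> \<open>After clipping to one period the interval is empty, the full circle, or a
      proper arc. Cutoffs approximate only the latter; the full circle is tested with the constant
      1.\<close>
    consider "\<alpha> > \<beta>" | "\<alpha> = 0" "\<beta> = 1" | "\<alpha> \<le> \<beta>" "\<beta> - \<alpha> < 1"
      by (force simp: \<alpha>_def \<beta>_def)
    then show ?case
    proof cases
      case 1
      then show ?thesis by (simp add: set_lebesgue_integral_def ind)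
    next
      case 2
      have "indicator {0..1} t *\<^sub>R f t = f t" for t by (simp add: f_def indicator_def)
      then show ?thesis using one by (simp add: set_lebesgue_integral_def ind 2)
    next
      case 3
      let ?\<phi> = "arc_cutoff ((\<alpha> + \<beta>) / 2) ((\<beta> - \<alpha>) / 2)"
      have "(\<lambda>n. LINT t|lebesgue. ?\<phi> n t *\<^sub>R f t) \<longlonglongrightarrow> (LINT t|lebesgue. indicator {\<alpha>..\<beta>} t *\<^sub>R f t)"
      proof (rule integral_dominated_convergence[where w = "\<lambda>t. norm (f t)"])
        show "(\<lambda>t. ?\<phi> n t *\<^sub>R f t) \<in> borel_measurable lebesgue" for n
        proof -
          have "?\<phi> n \<in> borel_measurable lborel"
            using borel_measurable_continuous_onI[OF smooth_map_continuous_on[OF smooth_arc_cutoff]] by simp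
          then have [measurable]: "?\<phi> n \<in> borel_measurable lebesgue" by (rule measurable_completion)
          show ?thesis by measurable
        qed
        show "AE t in lebesgue. (\<lambda>n. ?\<phi> n t *\<^sub>R f t) \<longlonglongrightarrow> indicator {\<alpha>..\<beta>} t *\<^sub>R f t"
          using AE_neq[of 0] AE_neq[of 1] AE_neq[of \<alpha>] AE_neq[of \<beta>]
        proof eventually_elim
          case (elim t)
          show ?case
          proof (cases "t \<in> {0..1}")
            case True
            show ?thesis
              by (intro tendsto_scaleR tendsto_const arc_cutoff_tendsto)
                (use True elim 3 in \<open>auto simp: \<alpha>_def \<beta>_def\<close>)
          qed (simp add: f_def)
        qed
        show "AE t in lebesgue. norm (?\<phi> n t *\<^sub>R f t) \<le> norm (f t)" for n
        proof (intro AE_I2)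
          fix t
          have "\<bar>?\<phi> n t\<bar> \<le> 1"
            using logistic_bounds unfolding arc_cutoff_def by (simp add: abs_le_iff less_imp_le minus_le_iff order_trans[of _ 0])
          then show "norm (?\<phi> n t *\<^sub>R f t) \<le> norm (f t)" by (simp add: mult_left_le_one_le)
        qed
      qed (use intf intA[of "{\<alpha>..\<beta>}"] in \<open>auto simp: set_integrable_def\<close>)
      moreover have "(LINT t|lebesgue. ?\<phi> n t *\<^sub>R f t) = 0" for n
        by (intro zero_f periodic_arc_cutoff smooth_arc_cutoff)
      ultimately have "(LINT t|lebesgue. indicator {\<alpha>..\<beta>} t *\<^sub>R f t) = 0"
        by (simp add: LIMSEQ_const_iff)
      then show ?thesis by (simp add: set_lebesgue_integral_def ind)
    qed
  next
    case (compl A)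
    have "A \<in> sets lebesgue" using compl.hyps by simp
    have "(LINT t:(- A)|lebesgue. f t) = (LINT t|lebesgue. f t - indicator A t *\<^sub>R f t)"
      unfolding set_lebesgue_integral_def
      by (intro Bochner_Integration.integral_cong) (auto simp: indicator_def)
    also have "\<dots> = (LINT t|lebesgue. f t) - (LINT t:A|lebesgue. f t)"
      using intf intA[OF \<open>A \<in> sets lebesgue\<close>] unfolding set_lebesgue_integral_def set_integrable_def
      by (intro Bochner_Integration.integral_diff)
    finally show ?case using one compl.IH by simp
  next
    case (union F)
    have "range F \<subseteq> sets lebesgue" using union.hyps(2) by auto
    then have "(LINT t:(\<Union>i. F i)|lebesgue. f t) = (\<Sum>i. (LINT t:(F i)|lebesgue. f t))"
      using union.hyps(1) by (intro lebesgue_integral_countable_add intA) (auto simp: disjoint_family_on_def)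
    then show ?case using union.IH by simp
  qed
  have "AE t in lebesgue. f t = 0"
  proof (rule sigma_finite_measure.density_zero[OF sigma_finite_lebesgue intf])
    fix A :: "real set" assume "A \<in> sets lebesgue"
    then obtain S N N' where A: "A = S \<union> N" "N \<subseteq> N'" "N' \<in> null_sets lborel" "S \<in> sets lborel"
      by (rule sets_completionE)
    have "AE t in lebesgue. t \<notin> N'" using A(3) AE_not_in[of N' lborel] AE_completion by blast
    then have "AE t in lebesgue. (t \<in> A) = (t \<in> S)" by eventually_elim (use A in auto)
    then have "(LINT t:A|lebesgue. f t) = (LINT t:S|lebesgue. f t)"
      using intA[of S] A(4) intA[OF \<open>A \<in> sets lebesgue\<close>]
      by (intro set_integral_cong_set) (auto simp: set_borel_measurable_def set_integrable_def)
    then show "(LINT t:A|lebesgue. f t) = 0" using borel A(4) by simp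
  qed
  then show ?thesis by eventually_elim (auto simp: f_def)
qed


section \<open>Weak derivatives and Sobolev norms of classically differentiable functions\<close>

lemma lebesgue_measurable_continuous:
  fixes f :: "real \<Rightarrow> 'a::euclidean_space"
  shows "continuous_on UNIV f \<Longrightarrow> f \<in> borel_measurable lebesgue"
  using measurable_completion[of f lborel borel] borel_measurable_continuous_onI[of f] by simp

lemma set_integrable_continuous:
  fixes f :: "real \<Rightarrow> 'a::euclidean_space"
  assumes "continuous_on UNIV f" shows "set_integrable lebesgue {0..1} f"
  using absolutely_integrable_continuous_real[of 0 1 f] continuous_on_subset[OF assms] by simp

lemma continuous_mem_L2_circle:
  assumes "continuous_on UNIV f" "\<And>t. f (t + 1) = f t"
  shows "f \<in> L2_circle"
  unfolding L2_circle_def periodic_fun_simple'_def using assms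
  by (auto intro!: lebesgue_measurable_continuous set_integrable_continuous continuous_intros)

lemma L2_circle_set_integrable:
  assumes "f \<in> L2_circle"
  shows "set_integrable lebesgue {0..1} f"
proof (rule set_integrable_bound)
  show "set_integrable lebesgue {0..1} (\<lambda>t. 1 + (norm (f t))\<^sup>2)"
    using assms by (intro set_integral_add) (auto simp: L2_circle_def set_integrable_continuous)
  have "f \<in> borel_measurable lebesgue" using assms by (simp add: L2_circle_def)
  then show "set_borel_measurable lebesgue {0..1} f"
    unfolding set_borel_measurable_def by (intro borel_measurable_scaleR borel_measurable_indicator) auto
  have "x \<le> 1 + x\<^sup>2" if "x \<ge> 0" for x :: real
    using sum_squares_bound[of x 1] that by (simp add: power2_eq_square)
  then show "AE x in lebesgue. x \<in> {0..1} \<longrightarrow> norm (f x) \<le> norm (1 + (norm (f x))\<^sup>2)" by simp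
qed

lemma set_integrable_scaleR_continuous:
  fixes \<phi> :: "real \<Rightarrow> real" and f :: "real \<Rightarrow> 'a::euclidean_space"
  assumes "continuous_on UNIV \<phi>" "set_integrable lebesgue {0..1} f"
  shows "set_integrable lebesgue {0..1} (\<lambda>t. \<phi> t *\<^sub>R f t)"
proof -
  have "compact (\<phi> ` {0..1})" using assms(1) continuous_on_subset by (intro compact_continuous_image) auto
  then obtain B where "\<forall>x\<in>\<phi> ` {0..1}. norm x \<le> B"
    using compact_imp_bounded bounded_iff by metis
  then have B: "\<bar>\<phi> t\<bar> \<le> B" if "t \<in> {0..1}" for t using that by simp
  show ?thesis
  proof (rule set_integrable_bound)
    show "set_integrable lebesgue {0..1} (\<lambda>t. B *\<^sub>R norm (f t))"
      using assms(2) by (intro set_integrable_scaleR_right set_integrable_norm) auto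
    have "(\<lambda>t. indicator {0..1} t *\<^sub>R f t) \<in> borel_measurable lebesgue"
      using assms(2) by (auto simp: set_integrable_def)
    from borel_measurable_scaleR[OF lebesgue_measurable_continuous[OF assms(1)] this]
    have "(\<lambda>t. \<phi> t *\<^sub>R (indicator {0..1} t *\<^sub>R f t)) \<in> borel_measurable lebesgue" .
    then show "set_borel_measurable lebesgue {0..1} (\<lambda>t. \<phi> t *\<^sub>R f t)"
      by (simp add: set_borel_measurable_def mult.commute)
    show "AE t in lebesgue. t \<in> {0..1} \<longrightarrow> norm (\<phi> t *\<^sub>R f t) \<le> norm (B *\<^sub>R norm (f t))"
    proof (intro AE_I2 impI)
      fix t :: real assume "t \<in> {0..1}"
      then have "\<bar>\<phi> t\<bar> \<le> \<bar>B\<bar>" using B[of t] by linarith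
      then show "norm (\<phi> t *\<^sub>R f t) \<le> norm (B *\<^sub>R norm (f t))" by (simp add: abs_mult mult_right_mono)
    qed
  qed
qed

lemma weak_derivative_AE:
  assumes "g \<in> L2_circle" "has_weak_derivative k f g" "g' \<in> L2_circle" "has_weak_derivative k f g'"
  shows "AE t in lebesgue. t \<in> {0..1} \<longrightarrow> g t = g' t"
proof -
  have ig: "set_integrable lebesgue {0..1} g" "set_integrable lebesgue {0..1} g'"
    using assms L2_circle_set_integrable by blast+
  have "AE t in lebesgue. t \<in> {0..1} \<longrightarrow> g t - g' t = 0"
  proof (rule du_Bois_Reymond_circle)
    show "set_integrable lebesgue {0..1} (\<lambda>t. g t - g' t)" using ig by (rule set_integral_diff)
    fix \<phi> :: "real \<Rightarrow> real" assume \<phi>: "periodic_fun_simple' \<phi>" "smooth_map \<phi>"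
    have c\<phi>: "continuous_on UNIV \<phi>" by (rule smooth_map_continuous_on[OF \<phi>(2)])
    have "(-1) ^ k *\<^sub>R (LINT t:{0..1}|lebesgue. \<phi> t *\<^sub>R g t) = (-1) ^ k *\<^sub>R (LINT t:{0..1}|lebesgue. \<phi> t *\<^sub>R g' t)"
      using assms(2)[unfolded has_weak_derivative_def, rule_format, OF conjI[OF \<phi>]]
        assms(4)[unfolded has_weak_derivative_def, rule_format, OF conjI[OF \<phi>]] by (rule trans[OF sym])
    then have "(LINT t:{0..1}|lebesgue. \<phi> t *\<^sub>R g t) = (LINT t:{0..1}|lebesgue. \<phi> t *\<^sub>R g' t)" by simp
    moreover have "(LINT t:{0..1}|lebesgue. \<phi> t *\<^sub>R g t - \<phi> t *\<^sub>R g' t) =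
        (LINT t:{0..1}|lebesgue. \<phi> t *\<^sub>R g t) - (LINT t:{0..1}|lebesgue. \<phi> t *\<^sub>R g' t)"
      using ig by (intro set_integral_diff set_integrable_scaleR_continuous c\<phi>)
    ultimately show "(LINT t:{0..1}|lebesgue. \<phi> t *\<^sub>R (g t - g' t)) = 0"
      by (simp add: scaleR_diff_right)
  qed
  then show ?thesis by simp
qed

lemma smooth_map_deriv:
  fixes \<phi> :: "real \<Rightarrow> real"
  assumes "smooth_map \<phi>" shows "(\<phi> has_real_derivative deriv \<phi> t) (at t)"
proof -
  have "Ck_on (Suc 0) UNIV \<phi>" using assms by (simp only: smooth_map_def Ck_on_UNIV)
  then have "\<phi> differentiable (at t)" by simp
  then show ?thesis using DERIV_deriv_iff_real_differentiable by blast
qed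

lemma periodic_deriv_iterate:
  fixes \<phi> :: "real \<Rightarrow> real"
  assumes "smooth_map \<phi>" "periodic_fun_simple' \<phi>"
  shows "smooth_map ((deriv ^^ k) \<phi>) \<and> periodic_fun_simple' ((deriv ^^ k) \<phi>)"
proof (induction k)
  case (Suc k)
  let ?\<psi> = "(deriv ^^ k) \<phi>"
  have der: "(?\<psi> has_real_derivative deriv ?\<psi> t) (at t)" for t
    using smooth_map_deriv Suc by blast
  have D: "frechet_derivative ?\<psi> (at t) v = v *\<^sub>R deriv ?\<psi> t" for t v
    using frechet_derivative_at[OF der[unfolded has_field_derivative_def], of t] by (simp add: fun_eq_iff mult.commute)
  have "Ck j (deriv ?\<psi>)" for j
  proof -
    have "Ck (Suc j) ?\<psi>" using Suc by (simp only: smooth_map_def)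
    then have "Ck j (\<lambda>t. frechet_derivative ?\<psi> (at t) 1)" unfolding Ck.simps by blast
    then show ?thesis by (simp add: D)
  qed
  moreover have "deriv ?\<psi> (t + 1) = deriv ?\<psi> t" for t
    using has_vector_derivative_periodic[of ?\<psi> "deriv ?\<psi>"] der Suc
    by (auto simp: has_real_derivative_iff_has_vector_derivative periodic_fun_simple'_def)
  ultimately show ?case by (simp add: smooth_map_def periodic_fun_simple'_def)
qed (use assms in auto)

text \<open>The successive derivatives are carried as data, so differences and multiples can be
  formed termwise, and the topmost one need only be continuous.\<close>

definition periodic_tower :: "nat \<Rightarrow> (nat \<Rightarrow> real \<Rightarrow> 'a::euclidean_space) \<Rightarrow> bool" where
  "periodic_tower m f \<longleftrightarrow> (\<forall>k\<le>m. continuous_on UNIV (f k) \<and> (\<forall>t. f k (t + 1) = f k t)) \<and>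
     (\<forall>k<m. \<forall>t. (f k has_vector_derivative f (Suc k) t) (at t))"

lemma periodic_tower_diff:
  assumes "periodic_tower m f" "periodic_tower m g"
  shows "periodic_tower m (\<lambda>k t. f k t - g k t)"
  using assms unfolding periodic_tower_def
  by (auto intro!: continuous_on_diff has_vector_derivative_diff)

lemma periodic_tower_scaleR:
  assumes "periodic_tower m f"
  shows "periodic_tower m (\<lambda>k t. c *\<^sub>R f k t)"
  using assms unfolding periodic_tower_def
  by (auto intro!: continuous_on_scaleR continuous_on_const bounded_linear.has_vector_derivative[OF bounded_linear_scaleR_right])

lemma periodic_tower_weak_derivative:
  assumes "periodic_tower m f" "k \<le> m"
  shows "has_weak_derivative k (f 0) (f k)"
  unfolding has_weak_derivative_def
proof (intro allI impI, elim conjE)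
  fix \<phi> :: "real \<Rightarrow> real" assume \<phi>: "periodic_fun_simple' \<phi>" "smooth_map \<phi>"
  let ?d = "\<lambda>k. (deriv ^^ k) \<phi>"
  have cd: "continuous_on S (?d k)" and pd: "?d k (t + 1) = ?d k t" for k t S
    using periodic_deriv_iterate[OF \<phi>(2,1)] smooth_map_continuous_on by (auto simp: periodic_fun_simple'_def)
  have dd: "(?d k has_real_derivative ?d (Suc k) t) (at t)" for k t
    using smooth_map_deriv[of "?d k" t] periodic_deriv_iterate[OF \<phi>(2,1), of k] by simp
  have cf: "continuous_on S (f k)" and pf: "f k (t + 1) = f k t" if "k \<le> m" for k t S
    using assms(1) that continuous_on_subset[of UNIV "f k" S] unfolding periodic_tower_def by auto
  have df: "(f k has_vector_derivative f (Suc k) t) (at t)" if "k < m" for k t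
    using assms(1) that unfolding periodic_tower_def by auto
  have eq: "(LINT t:{0..1}|lebesgue. \<psi> t *\<^sub>R g t) = integral {0..1} (\<lambda>t. \<psi> t *\<^sub>R g t)"
    if "continuous_on UNIV \<psi>" "continuous_on UNIV g" for \<psi> :: "real \<Rightarrow> real" and g :: "real \<Rightarrow> 'a"
    by (rule set_lebesgue_integral_eq_integral(2)[OF set_integrable_continuous[OF continuous_on_scaleR[OF that]]])
  have parts: "integral {0..1} (\<lambda>t. ?d (Suc i) t *\<^sub>R f j t) = - integral {0..1} (\<lambda>t. ?d i t *\<^sub>R f (Suc j) t)"
    if "j < m" for i j
  proof -
    have "((\<lambda>t. ?d i t *\<^sub>R f j t) has_vector_derivative ?d i t *\<^sub>R f (Suc j) t + ?d (Suc i) t *\<^sub>R f j t)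
        (at t within {0..1})" for t
      by (rule has_vector_derivative_scaleR[OF has_field_derivative_at_within[OF dd]
            has_vector_derivative_at_within[OF df[OF that]]])
    then have "((\<lambda>t. ?d i t *\<^sub>R f (Suc j) t + ?d (Suc i) t *\<^sub>R f j t) has_integral
        (?d i 1 *\<^sub>R f j 1 - ?d i 0 *\<^sub>R f j 0)) {0..1}"
      by (intro fundamental_theorem_of_calculus) auto
    moreover have "?d i 1 *\<^sub>R f j 1 - ?d i 0 *\<^sub>R f j 0 = 0"
      using pd[of i 0] pf[of j 0] that by simp
    moreover have "integral {0..1} (\<lambda>t. ?d i t *\<^sub>R f (Suc j) t + ?d (Suc i) t *\<^sub>R f j t) =
      integral {0..1} (\<lambda>t. ?d i t *\<^sub>R f (Suc j) t) + integral {0..1} (\<lambda>t. ?d (Suc i) t *\<^sub>R f j t)"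
      using that by (intro integral_add integrable_continuous_interval continuous_on_scaleR cd cf) auto
    ultimately show ?thesis by (simp add: has_integral_iff eq_neg_iff_add_eq_0 add.commute)
  qed
  \<comment> \<open>The statement for all \<open>i + j \<le> m\<close> lets each integration by
    parts pass one derivative from the test function to the tower; boundary terms cancel because
    both factors are periodic.\<close>
  have "integral {0..1} (\<lambda>t. ?d i t *\<^sub>R f j t) = (-1) ^ i *\<^sub>R integral {0..1} (\<lambda>t. \<phi> t *\<^sub>R f (i + j) t)"
    if "i + j \<le> m" for i j
    using that
  proof (induction i arbitrary: j)
    case (Suc i)
    then have "integral {0..1} (\<lambda>t. ?d (Suc i) t *\<^sub>R f j t) = - integral {0..1} (\<lambda>t. ?d i t *\<^sub>R f (Suc j) t)"
      by (intro parts) auto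
    then show ?case using Suc.IH[of "Suc j"] Suc.prems by simp
  qed simp
  from this[of k 0] show "(LINT t:{0..1}|lebesgue. ?d k t *\<^sub>R f 0 t) = (-1) ^ k *\<^sub>R (LINT t:{0..1}|lebesgue. \<phi> t *\<^sub>R f k t)"
    using assms(2) by (simp add: eq cd cf smooth_map_continuous_on[OF \<phi>(2)])
qed

lemma periodic_tower_L2: "periodic_tower m f \<Longrightarrow> k \<le> m \<Longrightarrow> f k \<in> L2_circle"
  unfolding periodic_tower_def by (intro continuous_mem_L2_circle) auto

lemma periodic_tower_sobolev_space: "periodic_tower m f \<Longrightarrow> f 0 \<in> sobolev_space m"
  unfolding sobolev_space_def using periodic_tower_L2[of m f] periodic_tower_weak_derivative[of m f] by blast

text \<open>The representative selected by \<open>weak_derivative\<close> is unknown, but uniqueness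
  almost everywhere identifies it with \<open>f k\<close> under the integral, and the norm becomes
  computable from classical derivatives.\<close>

lemma periodic_tower_sobolev_norm:
  assumes "periodic_tower m f"
  shows "sobolev_norm m (f 0) = sqrt (\<Sum>k\<le>m. integral {0..1} (\<lambda>t. (norm (f k t))\<^sup>2))"
proof -
  have "(LINT t:{0..1}|lebesgue. (norm (weak_derivative k (f 0) t))\<^sup>2) = integral {0..1} (\<lambda>t. (norm (f k t))\<^sup>2)"
    if "k \<le> m" for k
  proof -
    let ?w = "weak_derivative k (f 0)"
    have fk: "f k \<in> L2_circle" "has_weak_derivative k (f 0) (f k)"
      by (rule periodic_tower_L2[OF assms that], rule periodic_tower_weak_derivative[OF assms that])
    then have "\<exists>g. g \<in> L2_circle \<and> has_weak_derivative k (f 0) g" by blast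
    from someI_ex[OF this] have w: "?w \<in> L2_circle" "has_weak_derivative k (f 0) ?w"
      by (simp_all only: weak_derivative_def)
    have [measurable]: "?w \<in> borel_measurable lebesgue" "f k \<in> borel_measurable lebesgue"
      using w fk by (auto simp: L2_circle_def)
    have "AE t in lebesgue. t \<in> {0..1} \<longrightarrow> ?w t = f k t"
      by (rule weak_derivative_AE[OF w fk])
    then have "(LINT t:{0..1}|lebesgue. (norm (?w t))\<^sup>2) = (LINT t:{0..1}|lebesgue. (norm (f k t))\<^sup>2)"
      by (intro set_lebesgue_integral_cong_AE) auto
    also have "\<dots> = integral {0..1} (\<lambda>t. (norm (f k t))\<^sup>2)"
      using fk(1) by (intro set_lebesgue_integral_eq_integral) (simp add: L2_circle_def)
    finally show ?thesis .
  qed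
  then show ?thesis unfolding sobolev_norm_def by simp
qed

lemma periodic_tower_sobolev_norm_le:
  assumes "periodic_tower m f" "\<And>k t. k \<le> m \<Longrightarrow> t \<in> {0..1} \<Longrightarrow> norm (f k t) \<le> e" "0 \<le> e"
  shows "sobolev_norm m (f 0) \<le> sqrt (real (Suc m)) * e"
proof -
  have "integral {0..1} (\<lambda>t. (norm (f k t))\<^sup>2) \<le> e\<^sup>2" if "k \<le> m" for k
  proof -
    have "continuous_on {0..1} (f k)"
      using assms(1) that continuous_on_subset[of UNIV "f k"] unfolding periodic_tower_def by auto
    then have "integral {0..1} (\<lambda>t. (norm (f k t))\<^sup>2) \<le> integral {0..1} (\<lambda>t::real. e\<^sup>2)"
      using assms(2)[OF that]
      by (intro integral_le integrable_continuous_interval continuous_intros power_mono) auto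
    then show ?thesis by simp
  qed
  then have "(\<Sum>k\<le>m. integral {0..1} (\<lambda>t. (norm (f k t))\<^sup>2)) \<le> (\<Sum>k\<le>m. e\<^sup>2)" by (intro sum_mono) auto
  then have "sobolev_norm m (f 0) \<le> sqrt (real (Suc m) * e\<^sup>2)"
    unfolding periodic_tower_sobolev_norm[OF assms(1)] by (intro real_sqrt_le_mono) simp
  then show ?thesis using \<open>0 \<le> e\<close> by (simp add: real_sqrt_mult)
qed

text \<open>This is nonnegativity of the variance: the integral of
  \<open>(g t - \<mu>)\<^sup>2\<close> for the mean \<mu>.\<close>

lemma integral_square_ge:
  fixes g :: "real \<Rightarrow> real"
  assumes "continuous_on {0..1} g"
  shows "(integral {0..1} g)\<^sup>2 \<le> integral {0..1} (\<lambda>t. (g t)\<^sup>2)"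
proof -
  define \<mu> where "\<mu> = integral {0..1} g"
  have i: "(\<lambda>t. (g t)\<^sup>2) integrable_on {0..1}" "g integrable_on {0..1}"
    using assms by (auto intro!: integrable_continuous_interval continuous_intros)
  have "((\<lambda>t. (g t)\<^sup>2 - (2 * \<mu>) * g t + \<mu>\<^sup>2) has_integral (integral {0..1} (\<lambda>t. (g t)\<^sup>2) - (2 * \<mu>) * \<mu> + \<mu>\<^sup>2)) {0..1}"
    using i has_integral_const_real[of "\<mu>\<^sup>2" 0 1] unfolding \<mu>_def
    by (intro has_integral_add has_integral_diff has_integral_mult_right integrable_integral) auto
  moreover have "0 \<le> (g t)\<^sup>2 - (2 * \<mu>) * g t + \<mu>\<^sup>2" for t
    using zero_le_power2[of "g t - \<mu>"] by (simp add: power2_eq_square algebra_simps)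
  ultimately have "0 \<le> integral {0..1} (\<lambda>t. (g t)\<^sup>2) - (2 * \<mu>) * \<mu> + \<mu>\<^sup>2"
    by (rule has_integral_nonneg)
  then show ?thesis by (simp add: \<mu>_def power2_eq_square)
qed

text \<open>Sobolev embedding in dimension one. The minimum of \<open>norm (f 0 t)\<close> is at
  most its L^2 mean, and the oscillation over a period is at most the L^1 norm of the derivative,
  hence at most its L^2 norm. Each contribution is bounded by the W^{1,2} norm, which explains the
  factor 2.\<close>

lemma periodic_tower_sup_le:
  assumes "periodic_tower 1 f"
  shows "norm (f 0 t) \<le> 2 * sobolev_norm 1 (f 0)"
proof -
  let ?n = "sobolev_norm 1 (f 0)"
  have c: "continuous_on S (f k)" if "k \<le> 1" for k S
    using assms that continuous_on_subset[of UNIV "f k" S] unfolding periodic_tower_def by auto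
  have p: "f 0 (t + 1) = f 0 t" for t using assms unfolding periodic_tower_def by auto
  have d: "(f 0 has_vector_derivative f 1 t) (at t)" for t using assms unfolding periodic_tower_def by auto
  have pos: "0 \<le> integral {0..1} (\<lambda>t. (norm (f k t))\<^sup>2)" if "k \<le> 1" for k
    using c[OF that] by (intro integral_nonneg integrable_continuous_interval continuous_intros) auto
  have n: "?n = sqrt (integral {0..1} (\<lambda>t. (norm (f 0 t))\<^sup>2) + integral {0..1} (\<lambda>t. (norm (f 1 t))\<^sup>2))"
    using periodic_tower_sobolev_norm[OF assms] by simp
  have n2: "integral {0..1} (\<lambda>t. (norm (f k t))\<^sup>2) \<le> ?n\<^sup>2" if "k \<le> 1" for k
    using pos[of 0] pos[of 1] that unfolding n by (cases "k = 0") (auto simp: le_Suc_eq)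
  have "0 \<le> ?n" using n pos by simp
  obtain s where s: "s \<in> {0..1}" "\<And>t. t \<in> {0..1} \<Longrightarrow> norm (f 0 s) \<le> norm (f 0 t)"
    using continuous_attains_inf[of "{0..1::real}" "\<lambda>t. norm (f 0 t)"] continuous_on_norm[OF c[of 0]] by auto
  have "(norm (f 0 s))\<^sup>2 = integral {0..1::real} (\<lambda>t. (norm (f 0 s))\<^sup>2)" by simp
  also have "\<dots> \<le> integral {0..1} (\<lambda>t. (norm (f 0 t))\<^sup>2)"
    using s(2) c[of 0] by (intro integral_le integrable_continuous_interval continuous_intros power_mono) auto
  also have "\<dots> \<le> ?n\<^sup>2" by (rule n2) simp
  finally have fs: "norm (f 0 s) \<le> ?n" using \<open>0 \<le> ?n\<close> by (rule power2_le_imp_le)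
  have "(integral {0..1} (\<lambda>t. norm (f 1 t)))\<^sup>2 \<le> ?n\<^sup>2"
    using integral_square_ge[of "\<lambda>t. norm (f 1 t)"] n2[of 1] continuous_on_norm[OF c[of 1]] by simp
  then have f1: "integral {0..1} (\<lambda>t. norm (f 1 t)) \<le> ?n" using \<open>0 \<le> ?n\<close> by (rule power2_le_imp_le)
  have diff: "norm (f 0 v - f 0 u) \<le> ?n" if "0 \<le> u" "u \<le> v" "v \<le> 1" for u v
  proof -
    have "(f 1 has_integral (f 0 v - f 0 u)) {u..v}"
      using that by (intro fundamental_theorem_of_calculus has_vector_derivative_at_within[OF d])
    then have "norm (f 0 v - f 0 u) = norm (integral {u..v} (f 1))" by (simp add: has_integral_iff)
    also have "\<dots> \<le> integral {u..v} (\<lambda>t. norm (f 1 t))"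
      using c[of 1] by (intro integral_norm_bound_integral integrable_continuous_interval continuous_on_norm) auto
    also have "\<dots> \<le> integral {0..1} (\<lambda>t. norm (f 1 t))"
      using that c[of 1] by (intro integral_subset_le integrable_continuous_interval continuous_on_norm) auto
    finally show ?thesis using f1 by linarith
  qed
  have "norm (f 0 t) \<le> 2 * ?n" if "t \<in> {0..1}" for t
  proof -
    have "norm (f 0 t - f 0 s) \<le> ?n"
      using diff[of s t] diff[of t s] s(1) that by (cases "s \<le> t") (auto simp: norm_minus_commute)
    then show ?thesis using fs norm_triangle_sub[of "f 0 t" "f 0 s"] by linarith
  qed
  then show ?thesis
    using periodic_ball[of "f 0" "\<lambda>x. norm x \<le> 2 * ?n" t] p by blast
qed

section \<open>Smooth dependence on the delay\<close>

definition D1 :: "(real \<times> real \<Rightarrow> 'a::euclidean_space) \<Rightarrow> real \<times> real \<Rightarrow> 'a" where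
  "D1 f z = frechet_derivative f (at z) (1, 0)"

definition D2 :: "(real \<times> real \<Rightarrow> 'a::euclidean_space) \<Rightarrow> real \<times> real \<Rightarrow> 'a" where
  "D2 f z = frechet_derivative f (at z) (0, 1)"

locale smooth_strip =
  fixes J :: "real set"
  assumes open_J: "open J" and convex_J: "convex J"
begin

abbreviation "S \<equiv> J \<times> (UNIV :: real set)"

lemma open_S: "open S" by (simp add: open_J open_Times)

definition smooth :: "(real \<times> real \<Rightarrow> 'a::euclidean_space) \<Rightarrow> bool" where
  "smooth f \<longleftrightarrow> (\<forall>k. Ck_on k S f)"

lemma smooth_D: assumes "smooth f" shows "smooth (D1 f)" "smooth (D2 f)"
proof -
  have "Ck_on (Suc k) S f" for k using assms by (simp only: smooth_def)
  then show "smooth (D1 f)" "smooth (D2 f)"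
    unfolding smooth_def D1_def[abs_def] D2_def[abs_def] by (blast intro: Ck_on_frechet_derivative)+
qed

lemma smooth_funpow: assumes "smooth f" shows "smooth ((D1 ^^ j) f)" "smooth ((D2 ^^ j) f)"
  by (induction j) (auto simp: assms smooth_D)

lemma smooth_continuous: "smooth f \<Longrightarrow> continuous_on S f"
  unfolding smooth_def using Ck_on_imp_continuous_on by blast

lemma smooth_continuous_slice:
  assumes "smooth f" "\<tau> \<in> J" shows "continuous_on T (\<lambda>t. f (\<tau>, t))"
proof -
  have "continuous_on T (\<lambda>t::real. (\<tau>, t))" by (intro continuous_intros)
  from continuous_on_compose2[OF smooth_continuous[OF assms(1)] this] assms(2) show ?thesis by auto
qed

lemma smooth_partials:
  assumes "smooth f" "\<tau> \<in> J"
  shows "((\<lambda>\<sigma>. f (\<sigma>, t)) has_vector_derivative D1 f (\<tau>, t)) (at \<tau>)"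
    "((\<lambda>s. f (\<tau>, s)) has_vector_derivative D2 f (\<tau>, t)) (at t)"
proof -
  let ?D = "frechet_derivative f (at (\<tau>, t))"
  have "Ck_on (Suc 0) S f" using assms(1) by (simp only: smooth_def)
  then have d: "(f has_derivative ?D) (at (\<tau>, t))" by (rule Ck_on_has_derivative) (use assms(2) in simp)
  have lin: "linear ?D" using has_derivative_linear[OF d] .
  have "((\<lambda>\<sigma>. f (\<sigma>, t)) has_derivative (\<lambda>h. ?D (h, 0))) (at \<tau>)"
    by (rule has_derivative_compose[where f = "\<lambda>\<sigma>. (\<sigma>, t)" and g = f and g' = ?D, OF _ d]) (auto intro!: derivative_eq_intros)
  moreover have "?D (h, 0) = h *\<^sub>R D1 f (\<tau>, t)" for h
    using linear_scale[OF lin, of h "(1, 0)"] by (simp add: D1_def)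
  ultimately show "((\<lambda>\<sigma>. f (\<sigma>, t)) has_vector_derivative D1 f (\<tau>, t)) (at \<tau>)"
    by (simp add: has_vector_derivative_def)
  have "((\<lambda>s. f (\<tau>, s)) has_derivative (\<lambda>h. ?D (0, h))) (at t)"
    by (rule has_derivative_compose[where f = "\<lambda>s. (\<tau>, s)" and g = f and g' = ?D, OF _ d]) (auto intro!: derivative_eq_intros)
  moreover have "?D (0, h) = h *\<^sub>R D2 f (\<tau>, t)" for h
    using linear_scale[OF lin, of h "(0, 1)"] by (simp add: D2_def)
  ultimately show "((\<lambda>s. f (\<tau>, s)) has_vector_derivative D2 f (\<tau>, t)) (at t)"
    by (simp add: has_vector_derivative_def)
qed

lemma D_cong:
  assumes "\<And>z. z \<in> S \<Longrightarrow> f z = g z" "z \<in> S"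
  shows "D1 f z = D1 g z" "D2 f z = D2 g z"
  using frechet_derivative_cong_open[OF open_S assms(2), of f g] assms(1) by (simp_all add: D1_def D2_def)

text \<open>Symmetry of the mixed derivatives is obtained by differentiating under the integral,
  which is where convexity of \<open>J\<close> enters: the \<tau>-derivative of the increment of
  \<open>f\<close> in \<open>t\<close> is the integral of \<open>D1 (D2 f)\<close>. It is also the
  increment of \<open>D1 f\<close>, and differentiating in the upper limit gives the claim. The
  lower limit \<open>t - 1\<close> is merely some point left of \<open>t\<close>.\<close>

lemma D_commute:
  assumes f: "smooth f" and "z \<in> S"
  shows "D1 (D2 f) z = D2 (D1 f) z"
proof -
  obtain \<tau> t where z: "z = (\<tau>, t)" and \<tau>: "\<tau> \<in> J" using assms(2) by auto
  let ?h = "D1 (D2 f)"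
  have J: "integral {t-1..s} (\<lambda>r. ?h (\<tau>, r)) = D1 f (\<tau>, s) - D1 f (\<tau>, t-1)" if s: "s \<in> {t-1..t+1}" for s
  proof -
    have "((\<lambda>\<sigma>. integral (cbox (t-1) s) (\<lambda>r. D2 f (\<sigma>, r))) has_vector_derivative integral (cbox (t-1) s) (\<lambda>r. ?h (\<tau>, r)))
      (at \<tau> within J)"
    proof (rule leibniz_rule_vector_derivative[OF _ _ _ \<tau> convex_J])
      show "((\<lambda>\<sigma>. D2 f (\<sigma>, r)) has_vector_derivative ?h (\<sigma>, r)) (at \<sigma> within J)" if "\<sigma> \<in> J" for \<sigma> r
        using smooth_partials(1)[OF smooth_D(2)[OF f] that] by (rule has_vector_derivative_at_within)
      show "(\<lambda>r. D2 f (\<sigma>, r)) integrable_on cbox (t-1) s" if "\<sigma> \<in> J" for \<sigma>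
        by (intro integrable_continuous smooth_continuous_slice smooth_D f that)
      show "continuous_on (J \<times> cbox (t-1) s) (\<lambda>(\<sigma>, r). ?h (\<sigma>, r))"
        using continuous_on_subset[OF smooth_continuous[OF smooth_D(1)[OF smooth_D(2)[OF f]]], of "J \<times> cbox (t-1) s"]
        by (auto simp: split_def)
    qed
    moreover have "integral (cbox (t-1) s) (\<lambda>r. D2 f (\<sigma>, r)) = f (\<sigma>, s) - f (\<sigma>, t-1)" if "\<sigma> \<in> J" for \<sigma>
    proof -
      have "((\<lambda>r. D2 f (\<sigma>, r)) has_integral f (\<sigma>, s) - f (\<sigma>, t-1)) {t-1..s}"
        using s by (intro fundamental_theorem_of_calculus has_vector_derivative_at_within[OF smooth_partials(2)[OF f that]]) auto
      then show ?thesis by (simp add: has_integral_iff)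
    qed
    ultimately have "((\<lambda>\<sigma>. f (\<sigma>, s) - f (\<sigma>, t-1)) has_vector_derivative integral {t-1..s} (\<lambda>r. ?h (\<tau>, r))) (at \<tau> within J)"
      using \<tau> by (subst has_vector_derivative_cong_ev[where g = "\<lambda>\<sigma>. integral (cbox (t-1) s) (\<lambda>r. D2 f (\<sigma>, r))"]) auto
    then have "((\<lambda>\<sigma>. f (\<sigma>, s) - f (\<sigma>, t-1)) has_vector_derivative integral {t-1..s} (\<lambda>r. ?h (\<tau>, r))) (at \<tau>)"
      by (simp add: at_within_open[OF \<tau> open_J])
    moreover have "((\<lambda>\<sigma>. f (\<sigma>, s) - f (\<sigma>, t-1)) has_vector_derivative D1 f (\<tau>, s) - D1 f (\<tau>, t-1)) (at \<tau>)"
      by (intro has_vector_derivative_diff smooth_partials f \<tau>)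
    ultimately show ?thesis by (rule vector_derivative_unique_at)
  qed
  have "((\<lambda>s. integral {t-1..s} (\<lambda>r. ?h (\<tau>, r))) has_vector_derivative ?h (\<tau>, t)) (at t within {t-1..t+1})"
    by (intro integral_has_vector_derivative smooth_continuous_slice smooth_D f \<tau>) auto
  then have "((\<lambda>s. D1 f (\<tau>, s) - D1 f (\<tau>, t-1)) has_vector_derivative ?h (\<tau>, t)) (at t within {t-1..t+1})"
    by (rule has_vector_derivative_transform[rotated 2]) (auto simp: J)
  moreover have "at t within {t-1..t+1} = at t" by (intro at_within_interior) auto
  ultimately have "((\<lambda>s. D1 f (\<tau>, s) - D1 f (\<tau>, t-1)) has_vector_derivative ?h (\<tau>, t)) (at t)" by simp
  moreover have "((\<lambda>s. D1 f (\<tau>, s) - D1 f (\<tau>, t-1)) has_vector_derivative D2 (D1 f) (\<tau>, t) - 0) (at t)"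
    by (intro has_vector_derivative_diff smooth_partials smooth_D f \<tau> has_vector_derivative_const)
  ultimately show ?thesis using vector_derivative_unique_at z by fastforce
qed

lemma D_commute_funpow:
  assumes "smooth f" "z \<in> S"
  shows "D1 ((D2 ^^ k) f) z = (D2 ^^ k) (D1 f) z"
  using assms(2)
proof (induction k arbitrary: z)
  case (Suc k)
  have "D1 ((D2 ^^ Suc k) f) z = D2 (D1 ((D2 ^^ k) f)) z"
    using D_commute[OF smooth_funpow(2)[OF assms(1)] Suc.prems] by simp
  also have "\<dots> = D2 ((D2 ^^ k) (D1 f)) z" by (rule D_cong(2)[OF Suc.IH Suc.prems])
  finally show ?case by simp
qed simp

text \<open>With the \<open>t\<close>-derivatives outermost, raising \<open>k\<close> is immediate;
  raising \<open>j\<close> is where \<open>D_commute_funpow\<close> is needed.\<close>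

definition "partial_deriv u j k = (D2 ^^ k) ((D1 ^^ j) u)" for u :: "real \<times> real \<Rightarrow> 'a::euclidean_space"

lemma smooth_partial_deriv: "smooth u \<Longrightarrow> smooth (partial_deriv u j k)"
  by (simp add: partial_deriv_def smooth_funpow)

lemma partial_deriv_2:
  assumes "smooth u" "\<tau> \<in> J"
  shows "((\<lambda>s. partial_deriv u j k (\<tau>, s)) has_vector_derivative partial_deriv u j (Suc k) (\<tau>, t)) (at t)"
  using smooth_partials(2)[OF smooth_partial_deriv[OF assms(1)] assms(2)] by (simp add: partial_deriv_def)

lemma partial_deriv_1:
  assumes "smooth u" "\<tau> \<in> J"
  shows "((\<lambda>\<sigma>. partial_deriv u j k (\<sigma>, t)) has_vector_derivative partial_deriv u (Suc j) k (\<tau>, t)) (at \<tau>)"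
  using smooth_partials(1)[OF smooth_partial_deriv[OF assms(1)] assms(2), of j k t]
    D_commute_funpow[OF smooth_funpow(1)[OF assms(1)], of "(\<tau>, t)" k j] assms(2)
  by (simp add: partial_deriv_def)

lemma D_periodic:
  assumes "\<And>\<tau> t. \<tau> \<in> J \<Longrightarrow> f (\<tau>, t + 1) = f (\<tau>, t)" "\<tau> \<in> J"
  shows "D1 f (\<tau>, t + 1) = D1 f (\<tau>, t)" "D2 f (\<tau>, t + 1) = D2 f (\<tau>, t)"
proof -
  have "frechet_derivative f (at ((\<tau>, t) + (0, 1))) = frechet_derivative f (at (\<tau>, t))"
    by (rule frechet_derivative_periodic[OF open_S]) (use assms in auto)
  then show "D1 f (\<tau>, t + 1) = D1 f (\<tau>, t)" "D2 f (\<tau>, t + 1) = D2 f (\<tau>, t)"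
    by (simp_all add: D1_def D2_def)
qed

lemma partial_deriv_periodic:
  assumes "\<And>\<tau> t. \<tau> \<in> J \<Longrightarrow> u (\<tau>, t + 1) = u (\<tau>, t)" "\<tau> \<in> J"
  shows "partial_deriv u j k (\<tau>, t + 1) = partial_deriv u j k (\<tau>, t)"
proof -
  have 1: "(D1 ^^ j) u (\<tau>, t + 1) = (D1 ^^ j) u (\<tau>, t)" if "\<tau> \<in> J" for \<tau> t
    using that by (induction j arbitrary: \<tau> t) (auto simp: assms(1) D_periodic)
  have "(D2 ^^ k) ((D1 ^^ j) u) (\<tau>, t + 1) = (D2 ^^ k) ((D1 ^^ j) u) (\<tau>, t)" if "\<tau> \<in> J" for \<tau> t
    using that by (induction k arbitrary: \<tau> t) (auto simp: 1 D_periodic)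
  then show ?thesis using assms(2) by (simp add: partial_deriv_def)
qed

lemma partial_deriv_tower:
  assumes "smooth u" "\<And>\<tau> t. \<tau> \<in> J \<Longrightarrow> u (\<tau>, t + 1) = u (\<tau>, t)" "\<tau> \<in> J"
  shows "periodic_tower m (\<lambda>k t. partial_deriv u j k (\<tau>, t))"
  unfolding periodic_tower_def
  using smooth_continuous_slice[OF smooth_partial_deriv[OF assms(1)] assms(3)]
    partial_deriv_periodic[of u, OF assms(2,3)] partial_deriv_2[OF assms(1,3)]
  by blast

text \<open>The \<open>j\<close>-th derivative of the curve is the \<open>j\<close>-th partial
  derivative in \<tau>. The \<open>k\<close>-th \<open>t\<close>-derivative of the error of the
  difference quotient is bounded, by the mean value inequality, by the variation of the partial
  derivative of order \<open>(Suc j, k)\<close> between \<tau> and \<sigma>. This is uniformly small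
  over one period by compactness, and only the finitely many \<open>k \<le> m\<close> enter the
  norm.\<close>

lemma smooth_curve_of_partials:
  assumes u: "smooth u" and per: "\<And>\<tau> t. \<tau> \<in> J \<Longrightarrow> u (\<tau>, t + 1) = u (\<tau>, t)" and "T \<subseteq> J"
  shows "smooth_curve_into_sobolev m T (\<lambda>\<tau> t. u (\<tau>, t))"
  unfolding smooth_curve_into_sobolev_def
proof (intro exI[of _ "\<lambda>j \<tau> t. partial_deriv u j 0 (\<tau>, t)"] conjI ballI allI)
  show "(\<lambda>t. partial_deriv u 0 0 (\<tau>, t)) = (\<lambda>t. u (\<tau>, t))" for \<tau> by (simp add: partial_deriv_def)
  fix j \<tau> assume "\<tau> \<in> T"
  then have \<tau>: "\<tau> \<in> J" using assms(3) by auto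
  show "(\<lambda>t. partial_deriv u j 0 (\<tau>, t)) \<in> sobolev_space m"
    by (rule periodic_tower_sobolev_space[OF partial_deriv_tower[where u = u, OF u per \<tau>]])
  show "((\<lambda>\<sigma>. sobolev_norm m (\<lambda>t. (partial_deriv u j 0 (\<sigma>, t) - partial_deriv u j 0 (\<tau>, t)) /\<^sub>R (\<sigma> - \<tau>) -
      partial_deriv u (Suc j) 0 (\<tau>, t))) \<longlongrightarrow> 0) (at \<tau> within T)"
  proof (rule tendstoI)
    fix e :: real assume "e > 0"
    define \<eta> where "\<eta> = e / (2 * sqrt (real (Suc m)))"
    have "\<eta> > 0" using \<open>e > 0\<close> by (simp add: \<eta>_def)
    have K: "compact ({\<tau>} \<times> {0..1::real})" "{\<tau>} \<times> {0..1} \<subseteq> S" using \<tau> by (auto intro!: compact_Times)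
    have "\<exists>r>0. \<forall>x y. x \<in> {\<tau>} \<times> {0..1::real} \<longrightarrow> dist y x < r \<longrightarrow> y \<in> S \<and>
        dist (partial_deriv u (Suc j) k y) (partial_deriv u (Suc j) k x) < \<eta>" for k
      using uniformly_near_compact[OF open_S smooth_continuous[OF smooth_partial_deriv[OF u]] K \<open>\<eta> > 0\<close>, of "Suc j" k]
      by metis
    then obtain r where r: "\<And>k. r k > 0" "\<And>k x y. x \<in> {\<tau>} \<times> {0..1::real} \<Longrightarrow> dist y x < r k \<Longrightarrow> y \<in> S \<and>
        dist (partial_deriv u (Suc j) k y) (partial_deriv u (Suc j) k x) < \<eta>" by metis
    define r0 where "r0 = Min (r ` {..m})"
    have "r0 > 0" using r(1) by (simp add: r0_def)
    have "sobolev_norm m (\<lambda>t. (partial_deriv u j 0 (\<sigma>, t) - partial_deriv u j 0 (\<tau>, t)) /\<^sub>R (\<sigma> - \<tau>) -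
      partial_deriv u (Suc j) 0 (\<tau>, t)) \<le> e / 2" if \<sigma>: "\<sigma> \<in> T" "\<sigma> \<noteq> \<tau>" "dist \<sigma> \<tau> < r0" for \<sigma>
    proof -
      have "\<sigma> \<in> J" using \<sigma>(1) assms(3) by auto
      define q where "q k t = inverse (\<sigma> - \<tau>) *\<^sub>R (partial_deriv u j k (\<sigma>, t) - partial_deriv u j k (\<tau>, t)) -
        partial_deriv u (Suc j) k (\<tau>, t)" for k t
      have tower: "periodic_tower m q"
        unfolding q_def[abs_def]
        by (intro periodic_tower_diff periodic_tower_scaleR partial_deriv_tower[where u = u, OF u per] \<tau> \<open>\<sigma> \<in> J\<close>)
      have "norm (q k t) \<le> \<eta>" if k: "k \<le> m" and t: "t \<in> {0..1}" for k t
      proof -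
        let ?c = "partial_deriv u (Suc j) k (\<tau>, t)"
        have "norm ((partial_deriv u j k (\<sigma>, t) - \<sigma> *\<^sub>R ?c) - (partial_deriv u j k (\<tau>, t) - \<tau> *\<^sub>R ?c)) \<le> \<eta> * \<bar>\<sigma> - \<tau>\<bar>"
        proof (rule vector_lipschitz)
          fix s assume "s \<in> closed_segment \<sigma> \<tau>"
          then have s: "\<bar>s - \<tau>\<bar> \<le> \<bar>\<sigma> - \<tau>\<bar>" by (auto simp: closed_segment_eq_real_ivl split: if_splits)
          have "r0 \<le> r k" using k by (simp add: r0_def)
          then have "dist (s, t) (\<tau>, t) < r k" using s \<sigma>(3) by (simp add: dist_Pair_Pair dist_real_def)
          then have st: "(s, t) \<in> S" "dist (partial_deriv u (Suc j) k (s, t)) ?c < \<eta>"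
            using r(2)[of "(\<tau>, t)" "(s, t)" k] t by auto
          show "((\<lambda>s. partial_deriv u j k (s, t) - s *\<^sub>R ?c) has_vector_derivative partial_deriv u (Suc j) k (s, t) - ?c) (at s)"
            using partial_deriv_1[OF u, of s j k t] st(1) by (auto intro!: derivative_eq_intros)
          show "norm (partial_deriv u (Suc j) k (s, t) - ?c) \<le> \<eta>" using st(2) by (simp add: dist_norm)
        qed
        also have "(partial_deriv u j k (\<sigma>, t) - \<sigma> *\<^sub>R ?c) - (partial_deriv u j k (\<tau>, t) - \<tau> *\<^sub>R ?c) = (\<sigma> - \<tau>) *\<^sub>R q k t"
        proof -
          have "(\<sigma> - \<tau>) *\<^sub>R q k t = (partial_deriv u j k (\<sigma>, t) - partial_deriv u j k (\<tau>, t)) - (\<sigma> - \<tau>) *\<^sub>R ?c"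
            using \<sigma>(2) unfolding q_def scaleR_diff_right[of "\<sigma> - \<tau>" "inverse (\<sigma> - \<tau>) *\<^sub>R _"] by simp
          then show ?thesis by (simp add: algebra_simps)
        qed
        finally show ?thesis using \<sigma>(2) by (simp add: mult.commute)
      qed
      then have "sobolev_norm m (q 0) \<le> sqrt (real (Suc m)) * \<eta>"
        using \<open>\<eta> > 0\<close> by (intro periodic_tower_sobolev_norm_le[OF tower]) auto
      also have "\<dots> = e / 2" by (simp add: \<eta>_def)
      finally show ?thesis by (simp add: q_def[abs_def])
    qed
    moreover have "0 \<le> sobolev_norm m f" for f :: "real \<Rightarrow> 'a"
      unfolding sobolev_norm_def set_lebesgue_integral_def by (intro real_sqrt_ge_zero sum_nonneg integral_nonneg_AE) auto
    ultimately show "eventually (\<lambda>\<sigma>. dist (sobolev_norm m (\<lambda>t. (partial_deriv u j 0 (\<sigma>, t) - partial_deriv u j 0 (\<tau>, t)) /\<^sub>R (\<sigma> - \<tau>) -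
      partial_deriv u (Suc j) 0 (\<tau>, t))) 0 < e) (at \<tau> within T)"
      unfolding eventually_at using \<open>r0 > 0\<close> \<open>e > 0\<close> by (intro exI[of _ r0]) fastforce
  qed
qed

end


section \<open>The delay solutions near the orbit\<close>

context smooth_periodic_orbit
begin

text \<open>The unknown is the deviation \<open>v\<close> from \<open>x0\<close>. At
  \<open>v = 0\<close> its equation has the defect
  \<open>X t (x0 (t - \<tau>)) - X t (x0 t)\<close>, which is proportional to the delay and so
  within the reach of \<open>delay_exists\<close>. The a priori estimate with zero error gives
  uniqueness among solutions in the \<open>R\<close>-tube around \<open>x0\<close>, and in
  particular \<open>u 0 = x0\<close>.\<close>

lemma delay_solutions_exist:
  assumes nondeg: "nondegenerate_orbit X x0"
  obtains \<epsilon> R and u :: "real \<Rightarrow> real \<Rightarrow> 'a" where "0 < \<epsilon>" "0 < R" "u 0 = x0"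
    "\<And>\<tau>. \<bar>\<tau>\<bar> < \<epsilon> \<Longrightarrow> delay_solution X \<tau> (u \<tau>)"
    "\<And>\<tau> t. \<bar>\<tau>\<bar> < \<epsilon> \<Longrightarrow> norm (u \<tau> t - x0 t) \<le> R"
    "\<And>\<tau> y. \<bar>\<tau>\<bar> < \<epsilon> \<Longrightarrow> delay_solution X \<tau> y \<Longrightarrow> (\<And>t. norm (y t - x0 t) \<le> R) \<Longrightarrow> y = u \<tau>"
    "\<And>k. Ck_on k ({- \<epsilon><..<\<epsilon>} \<times> UNIV) (\<lambda>z. u (fst z) (snd z))"
proof (rule periodic_inverse[OF nondegenerate_monodromy[OF nondeg]])
  fix \<kappa> :: real
  assume \<kappa>: "0 < \<kappa>"
    "\<And>h. continuous_on UNIV h \<Longrightarrow> (\<And>t. h (t + 1) = h t) \<Longrightarrow>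
       \<exists>v. (\<forall>t. v (t + 1) = v t) \<and> (\<forall>t. (v has_vector_derivative A t (v t) + h t) (at t))"
    "\<And>v h H t. (\<And>t. v (t + 1) = v t) \<Longrightarrow> (\<And>t. (v has_vector_derivative A t (v t) + h t) (at t)) \<Longrightarrow>
       (\<And>t. norm (h t) \<le> H) \<Longrightarrow> norm (v t) \<le> \<kappa> * H"
  \<comment> \<open>This spends 1/4 of the 1/2 allowed in \<open>small\<close>; the first bound on
    \<epsilon> below spends the other 1/4.\<close>
  define \<delta> where "\<delta> = 1 / (4 * \<kappa>)"
  have "\<delta> > 0" using \<kappa>(1) by (simp add: \<delta>_def)
  then obtain \<rho> where \<rho>: "0 < \<rho>" "\<And>t p q. norm (p - x0 t) < \<rho> \<Longrightarrow> norm (q - x0 t) < \<rho> \<Longrightarrow>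
    norm (X t p - X t q - A t (p - q)) \<le> \<delta> * norm (p - q)"
    using near_orbit by blast
  define R where "R = \<rho> / 2"
  have "R > 0" using \<rho>(1) by (simp add: R_def)
  have cX: "continuous_on UNIV (\<lambda>t. X (f t) (g t))" if "continuous_on UNIV f" "continuous_on UNIV g"
    for f :: "'b::topological_space \<Rightarrow> real" and g
    using continuous_on_compose2[OF Ck_on_imp_continuous_on[OF Ck_XX] continuous_on_Pair[OF that]] by simp
  obtain t1 where t1: "\<And>t. norm (X t (x0 t)) \<le> norm (X t1 (x0 t1))"
    using periodic_attains_sup[of "\<lambda>t. X t (x0 t)", OF cX[OF continuous_on_id cont_x0]] per_X per_x0 by metis
  define b where "b = norm (X t1 (x0 t1)) + 1"
  have b: "b > 0" "\<And>t. norm (X t (x0 t)) \<le> b" using t1 by (auto simp: b_def add_nonneg_pos intro: order_trans[OF t1])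
  \<comment> \<open>The second bound keeps \<open>x0 (t - \<tau>)\<close> closer than
    \<open>\<rho> / 2\<close> to \<open>x0 t\<close>, so the \<open>R\<close>-tube around the
    shifted orbit lies in the region of \<rho>. The third makes the defect of \<open>x0\<close> at
    most \<open>R / (2 * \<kappa>)\<close>, as \<open>delay_exists\<close> requires.\<close>
  define \<epsilon> where "\<epsilon> = min (1 / (4 * a * (a * \<kappa> + 1))) (min (\<rho> / (3 * b)) (R / (2 * \<kappa> * (a + \<delta>) * b)))"
  have c: "0 < 4 * a * (a * \<kappa> + 1)" "0 < 2 * \<kappa> * (a + \<delta>) * b"
    using a_pos \<kappa>(1) \<open>\<delta> > 0\<close> b(1) by (auto intro!: mult_pos_pos add_pos_pos)
  have \<epsilon>: "0 < \<epsilon>" "\<epsilon> \<le> 1 / (4 * a * (a * \<kappa> + 1))" "\<epsilon> \<le> \<rho> / (3 * b)" "\<epsilon> \<le> R / (2 * \<kappa> * (a + \<delta>) * b)"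
    using c \<open>R > 0\<close> \<rho>(1) b(1) by (auto simp: \<epsilon>_def)
  interpret delay_linear A a \<kappa> \<delta> \<epsilon>
  proof (rule delay_linear.intro[OF periodic_linear_axioms], unfold_locales)
    have "a * (a * \<kappa> + 1) * \<epsilon> \<le> 1/4" using \<epsilon>(2) c(1) by (simp add: field_simps)
    moreover have "\<delta> * \<kappa> = 1/4" using \<kappa>(1) by (simp add: \<delta>_def)
    ultimately show "\<delta> * \<kappa> + a * (a * \<kappa> + 1) * \<epsilon> \<le> 1 / 2" by simp
  qed (fact \<kappa> \<open>\<delta> > 0\<close> \<epsilon>(1))+
  have shift: "norm (x0 (t - \<tau>) - x0 t) \<le> b * \<epsilon>" if "\<bar>\<tau>\<bar> \<le> \<epsilon>" for t \<tau>
  proof -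
    have "norm (x0 (t - \<tau>) - x0 t) \<le> b * \<bar>(t - \<tau>) - t\<bar>"
      by (rule vector_lipschitz[OF deriv_x0 b(2)])
    also have "\<dots> \<le> b * \<epsilon>" using that b(1) by simp
    finally show ?thesis .
  qed
  have b\<epsilon>: "b * \<epsilon> < \<rho> / 2" using \<epsilon>(3) b(1) \<rho>(1) by (simp add: field_simps)
  have tube: "norm (p - x0 t) < \<rho>" if "\<bar>\<tau>\<bar> \<le> \<epsilon>" "norm (p - x0 (t - \<tau>)) \<le> R" for p t \<tau>
    using norm_triangle_ineq[of "p - x0 (t - \<tau>)" "x0 (t - \<tau>) - x0 t"] shift[OF that(1), of t] that(2) b\<epsilon>
    by (simp add: R_def)
  have ex: "\<exists>v. (\<forall>t. v (t + 1) = v t) \<and> (\<forall>t. (v has_vector_derivative (X t (x0 (t - \<tau>) + v (t - \<tau>)) - X t (x0 t))) (at t)) \<and>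
      (\<forall>t. norm (v t) \<le> R)" if \<tau>: "\<bar>\<tau>\<bar> \<le> \<epsilon>" for \<tau>
  proof (rule delay_exists[where \<Phi> = "\<lambda>t p. X t (x0 (t - \<tau>) + p) - X t (x0 t)", OF \<tau> \<open>R > 0\<close>])
    have "continuous_on UNIV (\<lambda>z::real \<times> 'a. x0 (fst z - \<tau>))" "continuous_on UNIV (\<lambda>z::real \<times> 'a. x0 (fst z))"
      by (auto intro!: continuous_on_compose2[OF cont_x0[of UNIV]] continuous_intros)
    then show "continuous_on UNIV (\<lambda>(t, p). X t (x0 (t - \<tau>) + p) - X t (x0 t))"
      unfolding split_def by (intro continuous_on_diff cX continuous_on_add continuous_on_fst continuous_on_snd continuous_on_id)
    show "(\<lambda>p. X (t + 1) (x0 (t + 1 - \<tau>) + p) - X (t + 1) (x0 (t + 1))) = (\<lambda>p. X t (x0 (t - \<tau>) + p) - X t (x0 t))" for t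
    proof -
      have "t + 1 - \<tau> = (t - \<tau>) + 1" by simp
      then show ?thesis by (simp only: per_X per_x0)
    qed
    show "norm (X t (x0 (t - \<tau>) + p) - X t (x0 t) - (X t (x0 (t - \<tau>) + q) - X t (x0 t)) - A t (p - q)) \<le> \<delta> * norm (p - q)"
      if "norm p \<le> R" "norm q \<le> R" for t p q
      using \<rho>(2)[OF tube[OF \<tau>, of "x0 (t - \<tau>) + p" t] tube[OF \<tau>, of "x0 (t - \<tau>) + q" t]] that by simp
    show "norm (X t (x0 (t - \<tau>) + 0) - X t (x0 t)) \<le> R / (2 * \<kappa>)" for t
    proof -
      let ?d = "x0 (t - \<tau>) - x0 t"
      have "norm (X t (x0 (t - \<tau>)) - X t (x0 t) - A t ?d) \<le> \<delta> * norm ?d"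
        by (rule \<rho>(2)) (use tube[OF \<tau>, of "x0 (t - \<tau>)" t] \<rho>(1) \<open>R > 0\<close> in auto)
      then have "norm (X t (x0 (t - \<tau>)) - X t (x0 t)) \<le> (a + \<delta>) * norm ?d"
        using bd_A[of t ?d] norm_triangle_sub[of "X t (x0 (t - \<tau>)) - X t (x0 t)" "A t ?d"] by (simp add: algebra_simps)
      also have "\<dots> \<le> (a + \<delta>) * (b * \<epsilon>)" using shift[OF \<tau>, of t] a_pos \<open>\<delta> > 0\<close> by (intro mult_left_mono) auto
      also have "\<dots> \<le> R / (2 * \<kappa>)"
      proof -
        have "\<epsilon> * (2 * \<kappa> * (a + \<delta>) * b) \<le> R" using \<epsilon>(4) c(2) by (simp add: pos_le_divide_eq)
        then show ?thesis using \<kappa>(1) by (simp add: pos_le_divide_eq mult_ac)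
      qed
      finally show ?thesis by simp
    qed
  qed
  have "\<exists>y. delay_solution X \<tau> y \<and> (\<forall>t. norm (y t - x0 t) \<le> R)" if \<tau>: "\<bar>\<tau>\<bar> \<le> \<epsilon>" for \<tau>
  proof -
    obtain v where v: "\<And>t. v (t + 1) = v t" "\<And>t. norm (v t) \<le> R"
      "\<And>t. (v has_vector_derivative (X t (x0 (t - \<tau>) + v (t - \<tau>)) - X t (x0 t))) (at t)"
      using ex[OF \<tau>] by blast
    have "((\<lambda>t. x0 t + v t) has_vector_derivative X t (x0 (t - \<tau>) + v (t - \<tau>))) (at t)" for t
      using has_vector_derivative_add[OF deriv_x0 v(3), of t] by simp
    then show ?thesis using v(1,2) per_x0
      by (intro exI[of _ "\<lambda>t. x0 t + v t"]) (simp add: delay_solution_def periodic_fun_simple'_def)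
  qed
  then obtain u where u: "\<And>\<tau>. \<bar>\<tau>\<bar> \<le> \<epsilon> \<Longrightarrow> delay_solution X \<tau> (u \<tau>)"
    "\<And>\<tau> t. \<bar>\<tau>\<bar> \<le> \<epsilon> \<Longrightarrow> norm (u \<tau> t - x0 t) \<le> R" by metis
  have unique: "y t = z t"
    if \<tau>: "\<bar>\<tau>\<bar> \<le> \<epsilon>" and y: "delay_solution X \<tau> y" "\<And>t. norm (y t - x0 t) \<le> R"
      and z: "delay_solution X \<tau> z" "\<And>t. norm (z t - x0 t) \<le> R" for \<tau> y z t
  proof -
    have dy: "\<And>t. (y has_vector_derivative X t (y (t - \<tau>))) (at t)" "\<And>t. (z has_vector_derivative X t (z (t - \<tau>))) (at t)"
      and p: "\<And>t. y (t + 1) = y t" "\<And>t. z (t + 1) = z t"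
      using y(1) z(1) by (auto simp: delay_solution_def periodic_fun_simple'_def)
    have cyz: "continuous_on UNIV (\<lambda>t. y (t - \<tau>))" "continuous_on UNIV (\<lambda>t. z (t - \<tau>))"
      by (rule continuous_on_shift[OF has_vector_derivative_imp_continuous_on[OF dy(1)]],
          rule continuous_on_shift[OF has_vector_derivative_imp_continuous_on[OF dy(2)]])
    have "norm (y t - z t) \<le> 2 * \<kappa> * 0"
    proof (rule apriori[where v = "\<lambda>t. y t - z t" and v' = "\<lambda>t. X t (y (t - \<tau>)) - X t (z (t - \<tau>))" and \<tau> = \<tau>, OF \<tau>])
      show "continuous_on UNIV (\<lambda>t. X t (y (t - \<tau>)) - X t (z (t - \<tau>)))"
        by (intro continuous_on_diff cX continuous_on_id cyz)
      show "norm (X t (y (t - \<tau>)) - X t (z (t - \<tau>)) - A t (y (t - \<tau>) - z (t - \<tau>))) \<le> \<delta> * norm (y (t - \<tau>) - z (t - \<tau>)) + 0" for t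
        using \<rho>(2)[OF tube[OF \<tau> y(2)] tube[OF \<tau> z(2)]] by simp
    qed (use dy p in \<open>auto intro: has_vector_derivative_diff\<close>)
    then show ?thesis by simp
  qed
  have x0_sol: "delay_solution X 0 x0"
    using deriv_x0 per_x0 by (simp add: delay_solution_def periodic_fun_simple'_def)
  have "u 0 = x0"
    using unique[OF _ u(1)[of 0] u(2)[of 0] x0_sol] \<epsilon>(1) \<open>R > 0\<close> by (intro ext) auto
  moreover have "Ck_on k ({- \<epsilon><..<\<epsilon>} \<times> UNIV) (\<lambda>z. u (fst z) (snd z))" for k
  proof (rule delay_family_Ck_on)
    \<comment> \<open>At this first level the right-hand side does not depend on the delay; such a
      dependence appears only in the families of derivatives.\<close>
    show "delay_family (\<lambda>y. X (snd (fst y)) (snd y)) (\<lambda>t. ball (x0 t) \<rho>) u"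
      unfolding delay_family_def
    proof (intro conjI ballI allI)
      fix \<tau> assume "\<tau> \<in> I"
      then have \<tau>: "\<bar>\<tau>\<bar> \<le> \<epsilon>" by auto
      show "X (snd (fst ((\<tau>, t + 1), p))) (snd ((\<tau>, t + 1), p)) = X (snd (fst ((\<tau>, t), p))) (snd ((\<tau>, t), p))" for t p
        by (simp add: per_X)
      show "u \<tau> (t + 1) = u \<tau> t" for t using u(1)[OF \<tau>] by (simp add: delay_solution_def periodic_fun_simple'_def)
      show "(u \<tau> has_vector_derivative X (snd (fst ((\<tau>, t), u \<tau> (t - \<tau>)))) (snd ((\<tau>, t), u \<tau> (t - \<tau>)))) (at t)" for t
        using u(1)[OF \<tau>] by (simp add: delay_solution_def)
      show "u \<sigma> (t - \<tau>) \<in> ball (x0 t) \<rho>" if "\<sigma> \<in> I" for \<sigma> t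
      proof -
        have "\<bar>\<sigma>\<bar> \<le> \<epsilon>" using that by auto
        from tube[OF \<tau> u(2)[OF this, of "t - \<tau>"]] show ?thesis by (simp add: dist_norm norm_minus_commute)
      qed
      show "norm (X (snd (fst ((\<tau>, t), p))) (snd ((\<tau>, t), p)) - X (snd (fst ((\<tau>, t), q))) (snd ((\<tau>, t), q)) - A t (p - q))
          \<le> \<delta> * norm (p - q)" if "p \<in> ball (x0 t) \<rho>" "q \<in> ball (x0 t) \<rho>" for t p q
        using \<rho>(2)[of p t q] that by (simp add: dist_norm norm_minus_commute)
      obtain t2 where t2: "\<And>t. norm (x0 t) \<le> norm (x0 t2)"
        using periodic_attains_sup[of x0, OF cont_x0 per_x0] by blast
      have "norm (u \<sigma> t) \<le> norm (x0 t2) + R" if "\<sigma> \<in> I" for \<sigma> t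
      proof -
        have "\<bar>\<sigma>\<bar> \<le> \<epsilon>" using that by auto
        from u(2)[OF this, of t] t2[of t] norm_triangle_sub[of "u \<sigma> t" "x0 t"] show ?thesis by simp
      qed
      then show "\<exists>r>0. \<exists>M. \<forall>\<sigma>\<in>I. \<bar>\<sigma> - \<tau>\<bar> < r \<longrightarrow> (\<forall>t. norm (u \<sigma> t) \<le> M)"
        using zero_less_one by blast
    qed auto
    have "Ck_on k (strip \<times> UNIV) (\<lambda>y::(real \<times> real) \<times> 'a. (snd (fst y), snd y))"
      by (intro Ck_on_linear open_strip bounded_linear_Pair bounded_linear_snd
          bounded_linear_compose[OF bounded_linear_snd bounded_linear_fst])
    from Ck_on_compose[OF open_strip(2) open_UNIV Ck_XX this subset_UNIV]
    show "Ck_on k (strip \<times> UNIV) (\<lambda>y. X (snd (fst y)) (snd y))" by simp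
  qed
  ultimately show thesis
    using \<epsilon>(1) \<open>R > 0\<close> u unique[OF _ _ _ u] by (intro that[of \<epsilon> R u]) (auto simp: less_imp_le)
qed

end

text \<open>The two inclusions of local uniqueness pull in opposite directions: the Sobolev ball
  must be small enough to lie in the tube of uniqueness, and then the range of delays small enough
  for the family to stay in that ball.\<close>

lemma periodic_orbit_delay_family:
  fixes X :: "real \<Rightarrow> 'a::euclidean_space \<Rightarrow> 'a" and x0 :: "real \<Rightarrow> 'a"
  assumes X: "smooth_periodic_vector_field X" and nondeg: "nondegenerate_orbit X x0"
  shows "\<exists>\<tau>0 > 0. \<exists>x :: real \<Rightarrow> real \<Rightarrow> 'a.
     x 0 = x0 \<and>
     (\<forall>\<tau>. \<bar>\<tau>\<bar> \<le> \<tau>0 \<longrightarrow> delay_solution X \<tau> (x \<tau>) \<and> smooth_map (x \<tau>)) \<and>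
     (\<exists>\<delta> > 0. {(\<tau>, y). \<bar>\<tau>\<bar> \<le> \<tau>0 \<and> y \<in> sobolev_space 1 \<and>
                 sobolev_norm 1 (\<lambda>t. y t - x0 t) < \<delta> \<and> delay_solution X \<tau> y}
              = {(\<tau>, x \<tau>) |\<tau>. \<bar>\<tau>\<bar> \<le> \<tau>0}) \<and>
     (\<forall>m. smooth_curve_into_sobolev m {-\<tau>0..\<tau>0} x)"
proof -
  interpret smooth_periodic_orbit X x0
    using assms by unfold_locales (auto simp: nondegenerate_orbit_def)
  obtain \<epsilon> R u where \<epsilon>: "0 < \<epsilon>" "0 < R" and u0: "u 0 = x0"
    and sol: "\<And>\<tau>. \<bar>\<tau>\<bar> < \<epsilon> \<Longrightarrow> delay_solution X \<tau> (u \<tau>)"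
    and near: "\<And>\<tau> t. \<bar>\<tau>\<bar> < \<epsilon> \<Longrightarrow> norm (u \<tau> t - x0 t) \<le> R"
    and unique: "\<And>\<tau> y. \<bar>\<tau>\<bar> < \<epsilon> \<Longrightarrow> delay_solution X \<tau> y \<Longrightarrow> (\<And>t. norm (y t - x0 t) \<le> R) \<Longrightarrow> y = u \<tau>"
    and CkU: "\<And>k. Ck_on k ({- \<epsilon><..<\<epsilon>} \<times> UNIV) (\<lambda>z. u (fst z) (snd z))"
    by (rule delay_solutions_exist[OF nondeg]) blast
  interpret smooth_strip "{- \<epsilon><..<\<epsilon>}" by unfold_locales auto
  define U where "U z = u (fst z) (snd z)" for z
  have U: "smooth U" unfolding smooth_def U_def[abs_def] using CkU by blast
  have perU: "U (\<tau>, t + 1) = U (\<tau>, t)" if "\<tau> \<in> {- \<epsilon><..<\<epsilon>}" for \<tau> t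
    using sol[of \<tau>] that by (auto simp: U_def delay_solution_def periodic_fun_simple'_def)
  have tower: "periodic_tower m (\<lambda>k t. partial_deriv U 0 k (\<tau>, t))" if "\<bar>\<tau>\<bar> < \<epsilon>" for m \<tau>
    by (rule partial_deriv_tower[where u = U, OF U perU]) (use that in auto)
  have U00: "partial_deriv U 0 0 (\<tau>, t) = u \<tau> t" for \<tau> t by (simp add: partial_deriv_def U_def)
  \<comment> \<open>The embedding constant 2 turns W^{1,2} distance below \<delta> into supremum
    distance at most \<open>R\<close>.\<close>
  define \<delta> where "\<delta> = R / 2"
  have "\<delta> > 0" using \<epsilon>(2) by (simp add: \<delta>_def)
  have K: "compact ({0} \<times> {0..1::real})" "{0} \<times> {0..1} \<subseteq> {- \<epsilon><..<\<epsilon>} \<times> (UNIV :: real set)"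
    using \<epsilon>(1) by (auto intro!: compact_Times)
  have "\<exists>r>0. \<forall>x y. x \<in> {0} \<times> {0..1::real} \<longrightarrow> dist y x < r \<longrightarrow> y \<in> {- \<epsilon><..<\<epsilon>} \<times> (UNIV :: real set) \<and>
      dist (partial_deriv U 0 k y) (partial_deriv U 0 k x) < \<delta> / 2" for k
    using uniformly_near_compact[OF open_S smooth_continuous[OF smooth_partial_deriv[OF U]] K half_gt_zero[OF \<open>\<delta> > 0\<close>], of 0 k]
    by metis
  then obtain r where r: "\<And>k. r k > 0" "\<And>k x y. x \<in> {0} \<times> {0..1::real} \<Longrightarrow> dist y x < r k \<Longrightarrow>
      dist (partial_deriv U 0 k y) (partial_deriv U 0 k x) < \<delta> / 2" by metis
  \<comment> \<open>Orders 0 and 1 suffice because the neighbourhood is taken in W^{1,2}. Halving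
    makes the inequalities strict, so the closed interval of delays lies inside the open
    strip.\<close>
  define \<tau>0 where "\<tau>0 = min (\<epsilon> / 2) (min (r 0) (r 1) / 2)"
  have \<tau>0: "0 < \<tau>0" "\<tau>0 < \<epsilon>" "\<tau>0 < r 0" "\<tau>0 < r 1"
    using \<epsilon>(1) r(1)[of 0] r(1)[of 1] by (auto simp: \<tau>0_def min_def)
  have smooth_u: "smooth_map (u \<tau>)" if "\<bar>\<tau>\<bar> \<le> \<tau>0" for \<tau>
  proof -
    have "Ck_on k UNIV (u \<tau>)" for k
    proof -
      have "Ck_on k UNIV (\<lambda>t::real. (\<tau>, t))"
        by (intro Ck_on_Pair Ck_on_const Ck_on_linear bounded_linear_ident open_UNIV)
      moreover have "(\<lambda>t. (\<tau>, t)) ` UNIV \<subseteq> {- \<epsilon><..<\<epsilon>} \<times> (UNIV :: real set)" using that \<tau>0 by auto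
      ultimately show ?thesis using Ck_on_compose[OF open_UNIV open_S CkU] by fastforce
    qed
    then show ?thesis by (simp add: smooth_map_def Ck_on_UNIV)
  qed
  have u_sobolev: "u \<tau> \<in> sobolev_space 1" if "\<bar>\<tau>\<bar> \<le> \<tau>0" for \<tau>
    using periodic_tower_sobolev_space[OF tower[of \<tau>], of 1] that \<tau>0 by (simp add: U00)
  have u_close: "sobolev_norm 1 (\<lambda>t. u \<tau> t - x0 t) < \<delta>" if "\<bar>\<tau>\<bar> \<le> \<tau>0" for \<tau>
  proof -
    let ?f = "\<lambda>k t. partial_deriv U 0 k (\<tau>, t) - partial_deriv U 0 k (0, t)"
    have tw: "periodic_tower 1 ?f" using that \<tau>0 \<epsilon>(1) by (intro periodic_tower_diff tower) auto
    have "sobolev_norm 1 (?f 0) \<le> sqrt (real (Suc 1)) * (\<delta> / 2)"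
    proof (rule periodic_tower_sobolev_norm_le[OF tw])
      fix k :: nat and t :: real assume k: "k \<le> 1" and t: "t \<in> {0..1}"
      then have "\<tau>0 < r k" using \<tau>0 by (cases "k = 0") (auto simp: le_Suc_eq)
      then have "dist (partial_deriv U 0 k (\<tau>, t)) (partial_deriv U 0 k (0, t)) < \<delta> / 2"
        using that t by (intro r(2)) (auto simp: dist_Pair_Pair dist_real_def)
      then show "norm (?f k t) \<le> \<delta> / 2" by (simp add: dist_norm)
    qed (use \<open>\<delta> > 0\<close> in simp)
    \<comment> \<open>The two derivatives contribute a factor \<open>sqrt 2\<close>, which is why
      the pointwise closeness was chosen as \<open>\<delta> / 2\<close>.\<close>
    also have "\<dots> < 2 * (\<delta> / 2)" using \<open>\<delta> > 0\<close> real_sqrt_less_mono[of 2 4] by (intro mult_strict_right_mono) auto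
    finally show ?thesis by (simp add: U00 u0)
  qed
  have locally_unique: "y = u \<tau>"
    if \<tau>: "\<bar>\<tau>\<bar> \<le> \<tau>0" and y: "delay_solution X \<tau> y" "sobolev_norm 1 (\<lambda>t. y t - x0 t) < \<delta>" for \<tau> y
  proof (rule unique[OF _ y(1)])
    show "\<bar>\<tau>\<bar> < \<epsilon>" using \<tau> \<tau>0 by simp
    have dy: "(y has_vector_derivative X t (y (t - \<tau>))) (at t)" and py: "y (t + 1) = y t" for t
      using y(1) by (auto simp: delay_solution_def periodic_fun_simple'_def)
    \<comment> \<open>The two equations supply the derivative of \<open>y - x0\<close> explicitly
      and show it to be continuous, so the difference forms a tower of height 1 without any
      regularity assumption on \<open>y\<close>.\<close>
    define f where "f k t = (if k = 0 then y t - x0 t else X t (y (t - \<tau>)) - X t (x0 t))" for k :: nat and t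
    have df: "(f 0 has_vector_derivative f 1 t) (at t)" for t
      unfolding f_def by (simp add: has_vector_derivative_diff[OF dy deriv_x0])
    have cy: "continuous_on S y" for S by (rule has_vector_derivative_imp_continuous_on[OF dy])
    have "periodic_tower 1 f"
      unfolding periodic_tower_def
    proof (intro conjI allI impI)
      have pf: "f 0 (t + 1) = f 0 t" for t by (simp add: f_def py per_x0)
      show "f k (t + 1) = f k t" if "k \<le> 1" for k t
        using that pf has_vector_derivative_periodic[where v = "f 0" and v' = "f 1", OF df pf] by (cases "k = 0") (auto simp: le_Suc_eq)
      have "continuous_on UNIV (\<lambda>t. y (t - \<tau>))"
        by (rule continuous_on_shift[OF cy])
      then have "continuous_on UNIV (\<lambda>t. (t, y (t - \<tau>)))" "continuous_on UNIV (\<lambda>t. (t, x0 t))"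
        using cont_x0 by (auto intro!: continuous_intros)
      then have "continuous_on UNIV (\<lambda>t. X t (y (t - \<tau>)))" "continuous_on UNIV (\<lambda>t. X t (x0 t))"
        using continuous_on_compose2[OF Ck_on_imp_continuous_on[OF Ck_XX]] by fastforce+
      then show "continuous_on UNIV (f k)" if "k \<le> 1" for k
        unfolding f_def[abs_def] using cy cont_x0 by (cases "k = 0") (auto intro!: continuous_on_diff)
      show "(f k has_vector_derivative f (Suc k) t) (at t)" if "k < 1" for k t
        using that df by simp
    qed
    from periodic_tower_sup_le[OF this] y(2)
    show "norm (y t - x0 t) \<le> R" for t by (simp add: f_def[abs_def] \<delta>_def) (smt (verit))
  qed
  show ?thesis
  proof (rule exI[of _ \<tau>0], rule conjI[OF \<tau>0(1)], rule exI[of _ u], intro conjI)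
    show "\<forall>\<tau>. \<bar>\<tau>\<bar> \<le> \<tau>0 \<longrightarrow> delay_solution X \<tau> (u \<tau>) \<and> smooth_map (u \<tau>)"
      using sol smooth_u \<tau>0(2) by auto
    have "{(\<tau>, y). \<bar>\<tau>\<bar> \<le> \<tau>0 \<and> y \<in> sobolev_space 1 \<and> sobolev_norm 1 (\<lambda>t. y t - x0 t) < \<delta> \<and> delay_solution X \<tau> y}
        = {(\<tau>, u \<tau>) |\<tau>. \<bar>\<tau>\<bar> \<le> \<tau>0}"
      using locally_unique u_sobolev u_close sol \<tau>0(2) by fastforce
    then show "\<exists>\<delta>>0. {(\<tau>, y). \<bar>\<tau>\<bar> \<le> \<tau>0 \<and> y \<in> sobolev_space 1 \<and> sobolev_norm 1 (\<lambda>t. y t - x0 t) < \<delta> \<and>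
        delay_solution X \<tau> y} = {(\<tau>, u \<tau>) |\<tau>. \<bar>\<tau>\<bar> \<le> \<tau>0}"
      using \<open>\<delta> > 0\<close> by blast
    have sub: "{- \<tau>0..\<tau>0} \<subseteq> {- \<epsilon><..<\<epsilon>}" using \<tau>0 by auto
    have "smooth_curve_into_sobolev m {- \<tau>0..\<tau>0} u" for m
      using smooth_curve_of_partials[where u = U, OF U perU sub, of m] by (simp add: U_def)
    then show "\<forall>m. smooth_curve_into_sobolev m {- \<tau>0..\<tau>0} u" by blast
  qed (rule u0)
qed

theorem theorem1p1:
  fixes X :: "real \<Rightarrow> real ^ 'n \<Rightarrow> real ^ 'n" and x0 :: "real \<Rightarrow> real ^ 'n"
  assumes "smooth_periodic_vector_field X"
    and "nondegenerate_orbit X x0"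
  shows "\<exists>\<tau>0 > 0. \<exists>x :: real \<Rightarrow> real \<Rightarrow> real ^ 'n.
     x 0 = x0 \<and>
     (\<forall>\<tau>. \<bar>\<tau>\<bar> \<le> \<tau>0 \<longrightarrow> delay_solution X \<tau> (x \<tau>) \<and> smooth_map (x \<tau>)) \<and>
     (\<exists>\<delta> > 0. {(\<tau>, y). \<bar>\<tau>\<bar> \<le> \<tau>0 \<and> y \<in> sobolev_space 1 \<and>
                 sobolev_norm 1 (\<lambda>t. y t - x0 t) < \<delta> \<and> delay_solution X \<tau> y}
              = {(\<tau>, x \<tau>) |\<tau>. \<bar>\<tau>\<bar> \<le> \<tau>0}) \<and>
     (\<forall>m. smooth_curve_into_sobolev m {-\<tau>0..\<tau>0} x)"
  by (rule periodic_orbit_delay_family[OF assms])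

end
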